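(* Let $\kappa\in\mathbb{R}$, let $t_0\in I$, and let $u\in C(I,H^1(\mathbb{R}^2))$ be a weak solution of the Camassa-Holm-Kadomtsev-Petviashvili equation $$Lu_t+\kappa u_{xx}+(3uu_x-2u_xu_{xx}-uu_{xxx})_x+u_{yy}=0,\qquad Lf:=\partial_x(1-\partial_x^2)f,$$ with initial data $u_0(x,y)=u(t_0,x,y)$ such that the equation is locally well-posed (in particular, $u$ is the only weak solution on $I$ with value $u_0$ at time $t_0$). If $u$ is $x$-symmetric, then $u$ is a traveling wave in the $x$-direction.
   Context: $I=[0,T]$ with $T>0$. All functions are real-valued, and identities between $H^1(\mathbb{R}^2)$-valued functions are understood for every $t\in I$ and almost every $(x,y)\in\mathbb{R}^2$. Weak solution: a function $u\in C(I,H^1(\mathbb{R}^2))$ is a weak solution of the equation if $$\iiint_{I\times\mathbb{R}^2} \Bigl[u\,L(\partial_t\phi)+\bigl(\kappa u+\tfrac32u^2+\tfrac12(\partial_xu)^2\bigr)\partial_x^2\phi-\tfrac12u^2\,\partial_x^4\phi+u\,\partial_y^2\phi\Bigr]\,\mathrm{d}t\,\mathrm{d}x\,\mathrm{d}y=0$$ for all $\phi\in C_0^\infty(I\times\mathbb{R}^2)$. Here $C_0^\infty(I\times\mathbb{R}^2)$ denotes smooth functions with compact support in $(0,T)\times\mathbb{R}^2$ (so test functions vanish near the endpoints of $I$). $x$-symmetric: there exists $\lambda\in C^1(\mathbb{R})$ such that $u(t,x,y)=u(t,2\lambda(t)-x,y)$ on $I\times\mathbb{R}^2$. Traveling wave in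 the $x$-direction (equivalently, steady in the $x$-direction): there exist a constant $c\in\mathbb{R}$ and a function $g$ such that $u(t,x,y)=g(x-ct,y)$ on $I\times\mathbb{R}^2$. *)

theory Defs
  imports "HOL-Analysis.Analysis"
begin

definition dderiv :: "'a::euclidean_space \<Rightarrow> ('a \<Rightarrow> real) \<Rightarrow> 'a \<Rightarrow> real" where
  "dderiv v f = (\<lambda>p. frechet_derivative f (at p) v)"

primrec Ck :: "nat \<Rightarrow> ('a::euclidean_space \<Rightarrow> real) \<Rightarrow> bool" where
  "Ck 0 f \<longleftrightarrow> continuous_on UNIV f"
| "Ck (Suc n) f \<longleftrightarrow> (\<forall>p. f differentiable (at p)) \<and> (\<forall>v. Ck n (dderiv v f))"

definition supp :: "('a::topological_space \<Rightarrow> real) \<Rightarrow> 'a set" where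
  "supp f = closure {p. f p \<noteq> 0}"

(* Smooth functions with compact support inside the open set X,
   extended by 0 to the whole space. *)
definition test_functions :: "'a::euclidean_space set \<Rightarrow> ('a \<Rightarrow> real) set" where
  "test_functions X = {\<phi>. (\<forall>n. Ck n \<phi>) \<and> compact (supp \<phi>) \<and> supp \<phi> \<subseteq> X}"

(* Elements of L^2 and H^1 are represented by Borel functions; equality of elements
   is equality almost everywhere. *)
definition L2 :: "('a::euclidean_space \<Rightarrow> real) set" where
  "L2 = {f. f \<in> borel_measurable lborel \<and> integrable lborel (\<lambda>p. (f p)\<^sup>2)}"

definition has_weak_deriv ::
    "'a::euclidean_space \<Rightarrow> ('a \<Rightarrow> real) \<Rightarrow> ('a \<Rightarrow> real) \<Rightarrow> bool" where
  "has_weak_deriv v f g \<longleftrightarrow>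
     (\<forall>\<phi>\<in>test_functions UNIV.
        (LINT p|lborel. f p * dderiv v \<phi> p) = - (LINT p|lborel. g p * \<phi> p))"

definition H1 :: "('a::euclidean_space \<Rightarrow> real) set" where
  "H1 = {f \<in> L2. \<forall>b\<in>Basis. \<exists>g\<in>L2. has_weak_deriv b f g}"

(* A representative of the weak derivative, which is unique up to null sets.
   Only meaningful if a square-integrable weak derivative exists, e.g. for f in H1. *)
definition wderiv :: "'a::euclidean_space \<Rightarrow> ('a \<Rightarrow> real) \<Rightarrow> 'a \<Rightarrow> real" where
  "wderiv v f = (SOME g. g \<in> L2 \<and> has_weak_deriv v f g)"

definition H1_norm :: "('a::euclidean_space \<Rightarrow> real) \<Rightarrow> real" where
  "H1_norm f =
     sqrt ((LINT p|lborel. (f p)\<^sup>2) + (\<Sum>b\<in>Basis. LINT p|lborel. (wderiv b f p)\<^sup>2))"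

definition C_H1 :: "real set \<Rightarrow> (real \<Rightarrow> 'a::euclidean_space \<Rightarrow> real) set" where
  "C_H1 I = {u. (\<forall>t\<in>I. u t \<in> H1) \<and>
     (\<forall>t\<in>I. ((\<lambda>s. H1_norm (\<lambda>p. u s p - u t p)) \<longlongrightarrow> 0) (at t within I))}"

text \<open>Partial derivatives of functions of \<open>(t, x, y)\<close>.\<close>

abbreviation Dt :: "(real \<times> real \<times> real \<Rightarrow> real) \<Rightarrow> real \<times> real \<times> real \<Rightarrow> real" where
  "Dt \<equiv> dderiv (1, 0, 0)"

abbreviation Dx :: "(real \<times> real \<times> real \<Rightarrow> real) \<Rightarrow> real \<times> real \<times> real \<Rightarrow> real" where
  "Dx \<equiv> dderiv (0, 1, 0)"

abbreviation Dy :: "(real \<times> real \<times> real \<Rightarrow> real) \<Rightarrow> real \<times> real \<times> real \<Rightarrow> real" where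
  "Dy \<equiv> dderiv (0, 0, 1)"

definition L_op :: "(real \<times> real \<times> real \<Rightarrow> real) \<Rightarrow> real \<times> real \<times> real \<Rightarrow> real" where
  "L_op f = Dx (\<lambda>p. f p - (Dx ^^ 2) f p)"

(* Weak solutions on [0, T] of
     L u_t + k u_xx + (3 u u_x - 2 u_x u_xx - u u_xxx)_x + u_yy = 0.
   The integral over [0, T] x R^2 is written as an iterated integral: u t is only given
   up to null sets for each t, and so need not be jointly measurable in (t, x, y).  For
   jointly measurable representatives of u and of its weak x-derivative, Fubini's theorem
   identifies it with the triple integral. *)
definition weak_solution :: "real \<Rightarrow> real \<Rightarrow> (real \<Rightarrow> real \<times> real \<Rightarrow> real) \<Rightarrow> bool" where
  "weak_solution \<kappa> T u \<longleftrightarrow> u \<in> C_H1 {0..T} \<and>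
     (\<forall>\<phi>\<in>test_functions ({0<..<T} \<times> UNIV).
        (LINT t:{0..T}|lborel. (LINT p|lborel.
            u t p * L_op (Dt \<phi>) (t, p)
          + (\<kappa> * u t p + 3/2 * (u t p)\<^sup>2 + 1/2 * (wderiv (1, 0) (u t) p)\<^sup>2)
              * (Dx ^^ 2) \<phi> (t, p)
          - 1/2 * (u t p)\<^sup>2 * (Dx ^^ 4) \<phi> (t, p)
          + u t p * (Dy ^^ 2) \<phi> (t, p))) = 0)"

definition x_symmetric :: "real \<Rightarrow> (real \<Rightarrow> real \<times> real \<Rightarrow> real) \<Rightarrow> bool" where
  "x_symmetric T u \<longleftrightarrow>
     (\<exists>l::real \<Rightarrow> real. l C1_differentiable_on UNIV \<and>
        (\<forall>t\<in>{0..T}. AE (x, y) in lborel. u t (x, y) = u t (2 * l t - x, y)))"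

definition x_traveling_wave :: "real \<Rightarrow> (real \<Rightarrow> real \<times> real \<Rightarrow> real) \<Rightarrow> bool" where
  "x_traveling_wave T u \<longleftrightarrow>
     (\<exists>(c::real) (g::real \<times> real \<Rightarrow> real).
        \<forall>t\<in>{0..T}. AE (x, y) in lborel. u t (x, y) = g (x - c * t, y))"

(* Uniqueness part of local well-posedness for the initial value u0 at time t0. *)
definition only_weak_solution ::
    "real \<Rightarrow> real \<Rightarrow> real \<Rightarrow> (real \<times> real \<Rightarrow> real) \<Rightarrow> (real \<Rightarrow> real \<times> real \<Rightarrow> real) \<Rightarrow> bool" where
  "only_weak_solution \<kappa> T t0 u0 u \<longleftrightarrow>
     (\<forall>v. weak_solution \<kappa> T v \<and> (AE p in lborel. v t0 p = u0 p) \<longrightarrow>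
        (\<forall>t\<in>{0..T}. AE p in lborel. v t p = u t p))"

end

theory Submission
  imports Defs
begin

text \<open>Write \<open>\<langle>f, \<psi>\<rangle>\<close> for the integral of \<open>f \<psi>\<close> over the plane and \<open>N(f, \<psi>)\<close> for the sum of the terms
of the weak formulation in which \<open>\<psi>\<close> is not differentiated in time.  Testing the weak formulation
with \<open>\<rho>(t) \<psi>(x, y)\<close> and applying the lemma of du Bois-Reymond in \<open>t\<close> turns it into a family of scalar
evolution equations: for each test function \<open>\<psi>\<close> of the plane the continuous function
\<open>t \<mapsto> \<langle>u(t), L \<psi>\<rangle>\<close> is differentiable on all of \<open>[0, T]\<close>, endpoints included, with derivative
\<open>N(u(t), \<psi>)\<close> (\<open>weak_solution_evolution\<close>).

Now let \<open>u(t)\<close> be symmetric about \<open>x = \<lambda>(t)\<close>.  Since \<open>L\<close> consists of odd powers of \<open>\<partial>\<^sub>x\<close>, it maps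
functions that are even about an axis to functions that are odd about it, and a symmetric function
pairs to zero with the latter.  Take \<open>\<psi>\<close> even about \<open>\<lambda>(t\<^sub>0)\<close> and let \<open>\<psi>\<^sup>\<delta>\<close> be its translate by
\<open>\<delta> = \<lambda>(t) - \<lambda>(t\<^sub>0)\<close>, which is even about \<open>\<lambda>(t)\<close>.  Then \<open>\<langle>u(t), L \<psi>\<^sup>\<delta>\<rangle> = 0\<close> for all \<open>t\<close>, so
\<open>\<langle>u(t), L \<psi>\<rangle> = \<langle>u(t), L \<psi> - L \<psi>\<^sup>\<delta>\<rangle>\<close>; dividing by \<open>t - t\<^sub>0\<close> and letting \<open>t\<close> tend to \<open>t\<^sub>0\<close> gives
\<open>N(u(t\<^sub>0), \<psi>) = c \<langle>u(t\<^sub>0), L \<partial>\<^sub>x \<psi>\<rangle>\<close> with \<open>c = \<lambda>'(t\<^sub>0)\<close>.  For a \<open>\<psi>\<close> without symmetry one applies this to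
the sum of \<open>\<psi>\<close> and its reflection (\<open>symmetric_solution_identity\<close>).

The identity says that the profile \<open>u(t\<^sub>0)\<close> satisfies the equation of a wave that travels with
speed \<open>c\<close>.  Indeed, for \<open>v(t, x, y) = u(t\<^sub>0, x - c (t - t\<^sub>0), y)\<close> a change of variables moves the
translation to the test function and makes the integrand of the weak formulation an exact
\<open>t\<close>-derivative of a function that vanishes at \<open>0\<close> and at \<open>T\<close> (\<open>traveling_weak_solution\<close>).  So \<open>v\<close> is
a weak solution that agrees with \<open>u\<close> at time \<open>t\<^sub>0\<close>, and uniqueness gives \<open>v = u\<close>.

The passages to the limit rest on two facts about \<open>L\<^sup>2\<close>, both consequences of the density of test
functions: weak derivatives are unique, so that convergence in \<open>H\<^sup>1\<close> controls the chosen
representatives of the derivatives, and translation is continuous.\<close>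

section \<open>Calculus of smooth functions\<close>

definition smooth :: "('a::euclidean_space \<Rightarrow> real) \<Rightarrow> bool" where
  "smooth f \<longleftrightarrow> (\<forall>n. Ck n f)"

lemma dderiv_eqI: "(f has_derivative f') (at p) \<Longrightarrow> dderiv v f p = f' v"
  unfolding dderiv_def by (metis frechet_derivative_at)

lemma Ck_Suc_imp_Ck: "Ck (Suc n) f \<Longrightarrow> Ck n f"
proof (induction n arbitrary: f)
  case 0
  then show ?case
    by (auto intro!: continuous_at_imp_continuous_on differentiable_imp_continuous_within)
qed auto

lemma smooth_dderiv: "smooth f \<Longrightarrow> smooth (dderiv v f)"
  unfolding smooth_def by (metis Ck.simps(2))

lemma smooth_differentiable: "smooth f \<Longrightarrow> f differentiable (at p)"
  unfolding smooth_def by (metis Ck.simps(2))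

lemma smooth_continuous_on: "smooth f \<Longrightarrow> continuous_on S f"
  unfolding smooth_def by (metis Ck.simps(1) continuous_on_subset subset_UNIV)

lemma smooth_borel_measurable: "smooth f \<Longrightarrow> f \<in> borel_measurable borel"
  by (intro borel_measurable_continuous_onI smooth_continuous_on)

lemma smoothI:
  assumes "\<And>p. f differentiable (at p)" "\<And>v. smooth (dderiv v f)"
  shows "smooth f"
proof -
  have "Ck n f" for n
    using assms by (induction n) (auto simp: smooth_def intro!: continuous_at_imp_continuous_on
      differentiable_imp_continuous_within)
  then show ?thesis by (simp add: smooth_def)
qed

lemma has_derivative_dderiv:
  assumes "f differentiable (at p)"
  shows "(f has_derivative (\<lambda>v. dderiv v f p)) (at p)"
  using assms unfolding dderiv_def by (simp add: frechet_derivative_works[symmetric])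

lemma dderiv_add:
  assumes "\<And>p. f differentiable (at p)" "\<And>p. g differentiable (at p)"
  shows "dderiv v (\<lambda>p. f p + g p) = (\<lambda>p. dderiv v f p + dderiv v g p)"
  by (rule ext, rule dderiv_eqI) (intro has_derivative_add has_derivative_dderiv assms)

lemma dderiv_diff:
  assumes "\<And>p. f differentiable (at p)" "\<And>p. g differentiable (at p)"
  shows "dderiv v (\<lambda>p. f p - g p) = (\<lambda>p. dderiv v f p - dderiv v g p)"
  by (rule ext, rule dderiv_eqI) (intro has_derivative_diff has_derivative_dderiv assms)

lemma dderiv_mult:
  assumes "\<And>p. f differentiable (at p)" "\<And>p. g differentiable (at p)"
  shows "dderiv v (\<lambda>p. f p * g p) = (\<lambda>p. f p * dderiv v g p + dderiv v f p * g p)"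
  by (rule ext, rule dderiv_eqI) (intro has_derivative_mult has_derivative_dderiv assms)

lemma dderiv_cmult:
  assumes "\<And>p. f differentiable (at p)"
  shows "dderiv v (\<lambda>p. c * f p) = (\<lambda>p. c * dderiv v f p)"
  by (rule ext, rule dderiv_eqI) (intro has_derivative_mult_right has_derivative_dderiv assms)

lemma dderiv_affine:
  assumes "bounded_linear A" "\<And>p. f differentiable (at p)"
  shows "dderiv v (\<lambda>p. f (a + A p)) = (\<lambda>p. dderiv (A v) f (a + A p))"
proof (rule ext, rule dderiv_eqI)
  fix p
  have "((\<lambda>p. a + A p) has_derivative A) (at p)"
    using has_derivative_add[OF has_derivative_const[of a] bounded_linear_imp_has_derivative[OF assms(1)]]
    by simp
  from has_derivative_compose[OF this has_derivative_dderiv[OF assms(2)]]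
  show "((\<lambda>p. f (a + A p)) has_derivative (\<lambda>v. dderiv (A v) f (a + A p))) (at p)" .
qed

lemma dderiv_plus: "f differentiable (at p) \<Longrightarrow> dderiv (v + w) f p = dderiv v f p + dderiv w f p"
  using linear_frechet_derivative unfolding dderiv_def by (metis linear_add)

lemma dderiv_scaleR: "f differentiable (at p) \<Longrightarrow> dderiv (c *\<^sub>R v) f p = c * dderiv v f p"
  using linear_frechet_derivative unfolding dderiv_def by (metis linear_cmul real_scaleR_def)

lemma smooth_const: "smooth (\<lambda>p. c)"
proof -
  have "Ck n (\<lambda>p::'a. c)" for n c
    by (induction n arbitrary: c) (auto simp: dderiv_def)
  then show ?thesis by (auto simp: smooth_def)
qed

lemma Ck_add: "Ck n f \<Longrightarrow> Ck n g \<Longrightarrow> Ck n (\<lambda>p. f p + g p)"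
  by (induction n arbitrary: f g) (auto intro!: continuous_intros simp: dderiv_add)

lemma Ck_mult: "Ck n f \<Longrightarrow> Ck n g \<Longrightarrow> Ck n (\<lambda>p. f p * g p)"
proof (induction n arbitrary: f g)
  case (Suc n)
  note * = Suc.prems[THEN Ck_Suc_imp_Ck]
  from Suc show ?case
    using * by (auto simp: dderiv_mult intro!: Ck_add)
qed (auto intro!: continuous_intros)

lemma Ck_affine: 
  assumes "bounded_linear A"
  shows "Ck n f \<Longrightarrow> Ck n (\<lambda>p. f (a + A p))"
proof (induction n arbitrary: f)
  case 0
  have "continuous_on UNIV (\<lambda>p. a + A p)"
    by (intro continuous_intros linear_continuous_on assms)
  with 0 show ?case
    using continuous_on_compose[of UNIV "\<lambda>p. a + A p" f] 
    by (auto simp: o_def intro: continuous_on_subset)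
next
  case (Suc n)
  have "(\<lambda>p. f (a + A p)) differentiable (at p)" for p
  proof -
    have "(\<lambda>p. a + A p) differentiable (at p)"
      using assms by (intro derivative_intros) (auto simp: bounded_linear_imp_differentiable)
    then show ?thesis
      using differentiable_chain_at[of "\<lambda>p. a + A p" p f] Suc.prems by (simp add: o_def)
  qed
  with Suc show ?case by (auto simp: dderiv_affine[OF assms])
qed

lemma smooth_add: "smooth f \<Longrightarrow> smooth g \<Longrightarrow> smooth (\<lambda>p. f p + g p)"
  by (simp add: smooth_def Ck_add)

lemma smooth_mult: "smooth f \<Longrightarrow> smooth g \<Longrightarrow> smooth (\<lambda>p. f p * g p)"
  by (simp add: smooth_def Ck_mult)

lemma smooth_cmult: "smooth f \<Longrightarrow> smooth (\<lambda>p. c * f p)"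
  by (simp add: smooth_mult smooth_const)

lemma smooth_diff: "smooth f \<Longrightarrow> smooth g \<Longrightarrow> smooth (\<lambda>p. f p - g p)"
  using smooth_add[of f "\<lambda>p. (-1) * g p"] smooth_cmult[of g "-1"] by simp

lemma smooth_affine: "bounded_linear A \<Longrightarrow> smooth f \<Longrightarrow> smooth (\<lambda>p. f (a + A p))"
  by (simp add: smooth_def Ck_affine)

lemma smooth_linear: "bounded_linear A \<Longrightarrow> smooth f \<Longrightarrow> smooth (\<lambda>p. f (A p))"
  using smooth_affine[of A f 0] by simp

lemma smooth_prod: "(\<And>i. i \<in> I \<Longrightarrow> smooth (f i)) \<Longrightarrow> smooth (\<lambda>p. \<Prod>i\<in>I. f i p)"
  by (induction I rule: infinite_finite_induct) (auto intro: smooth_mult smooth_const)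

lemma smooth_dderiv_pow: "smooth f \<Longrightarrow> smooth ((dderiv v ^^ n) f)"
  by (induction n) (auto intro: smooth_dderiv)

lemma has_real_derivative_line:
  assumes "\<And>p. f differentiable (at p)"
  shows "((\<lambda>s. f (p + s *\<^sub>R v)) has_real_derivative dderiv v f (p + s *\<^sub>R v)) (at s)"
proof -
  have "((\<lambda>s. p + s *\<^sub>R v) has_derivative (\<lambda>s. s *\<^sub>R v)) (at s)"
    by (auto intro!: derivative_eq_intros)
  from has_derivative_compose[OF this has_derivative_dderiv[OF assms]]
  show ?thesis
    unfolding has_field_derivative_def
    by (rule has_derivative_eq_rhs) (auto simp: dderiv_scaleR[OF assms] mult.commute)
qed

text \<open>The left-hand side is symmetric in \<open>v\<close> and \<open>w\<close>, so that exchanging the two directions compares the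
two mixed derivatives at nearby points.\<close>

lemma second_difference_mean_value:
  assumes f: "smooth f" and h: "0 < (h::real)"
  shows "\<exists>\<theta> \<eta>. 0 < \<theta> \<and> \<theta> < h \<and> 0 < \<eta> \<and> \<eta> < h \<and>
    f (p + h *\<^sub>R v + h *\<^sub>R w) - f (p + h *\<^sub>R v) - f (p + h *\<^sub>R w) + f p =
    h\<^sup>2 * dderiv w (dderiv v f) (p + \<theta> *\<^sub>R v + \<eta> *\<^sub>R w)"
proof -
  have df: "\<And>p. f differentiable (at p)" "\<And>p. dderiv v f differentiable (at p)"
    using f by (auto intro: smooth_differentiable smooth_dderiv)
  let ?F = "\<lambda>s. f ((p + h *\<^sub>R w) + s *\<^sub>R v) - f (p + s *\<^sub>R v)"
  have "\<exists>z>0. z < h \<and> ?F h - ?F 0 = (h - 0) * (dderiv v f ((p + h *\<^sub>R w) + z *\<^sub>R v) - dderiv v f (p + z *\<^sub>R v))"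
    using h by (intro MVT2) (auto intro!: DERIV_diff has_real_derivative_line df)
  then obtain \<theta> where \<theta>: "0 < \<theta>" "\<theta> < h"
    "?F h - ?F 0 = h * (dderiv v f ((p + h *\<^sub>R w) + \<theta> *\<^sub>R v) - dderiv v f (p + \<theta> *\<^sub>R v))" by auto
  let ?G = "\<lambda>s. dderiv v f ((p + \<theta> *\<^sub>R v) + s *\<^sub>R w)"
  have "\<exists>z>0. z < h \<and> ?G h - ?G 0 = (h - 0) * dderiv w (dderiv v f) ((p + \<theta> *\<^sub>R v) + z *\<^sub>R w)"
    using h by (intro MVT2) (auto intro!: has_real_derivative_line df)
  then obtain \<eta> where \<eta>: "0 < \<eta>" "\<eta> < h"
    "?G h - ?G 0 = h * dderiv w (dderiv v f) ((p + \<theta> *\<^sub>R v) + \<eta> *\<^sub>R w)" by auto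
  show ?thesis
    using \<theta> \<eta> by (intro exI[of _ \<theta>] exI[of _ \<eta>]) (auto simp: algebra_simps power2_eq_square)
qed

text \<open>Schwarz's theorem.  Both mixed derivatives, at suitable points that tend to \<open>p\<close> with \<open>h\<close>, equal the
second difference quotient with step \<open>h\<close>.\<close>

lemma dderiv_commute:
  assumes f: "smooth f"
  shows "dderiv v (dderiv w f) = dderiv w (dderiv v f)"
proof
  fix p
  have close: "\<exists>d>0. \<forall>\<theta> \<eta>. 0 < \<theta> \<and> \<theta> < d \<and> 0 < \<eta> \<and> \<eta> < d \<longrightarrow>
      \<bar>g (p + \<theta> *\<^sub>R a + \<eta> *\<^sub>R b) - g p\<bar> < e" if g: "smooth g" and e: "0 < e" for g :: "'a \<Rightarrow> real" and a b e
  proof -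
    have "((\<lambda>z. g (p + fst z *\<^sub>R a + snd z *\<^sub>R b)) \<longlongrightarrow> g (p + fst (0::real\<times>real) *\<^sub>R a + snd (0::real\<times>real) *\<^sub>R b)) (at 0)"
      by (intro isCont_tendsto_compose[of _ g] tendsto_intros)
         (use g in \<open>auto intro: differentiable_imp_continuous_within smooth_differentiable\<close>)
    then have "\<forall>\<^sub>F z in at (0::real\<times>real). dist (g (p + fst z *\<^sub>R a + snd z *\<^sub>R b)) (g p) < e"
      using e by (auto dest: tendstoD)
    then obtain d where d: "d > 0" "\<And>z. z \<noteq> 0 \<Longrightarrow> dist z 0 < d \<Longrightarrow> dist (g (p + fst z *\<^sub>R a + snd z *\<^sub>R b)) (g p) < e"
      unfolding eventually_at by auto
    show ?thesis
    proof (intro exI[of _ "d/2"] conjI allI impI; (elim conjE)?)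
      fix \<theta> \<eta> :: real assume *: "0 < \<theta>" "\<theta> < d/2" "0 < \<eta>" "\<eta> < d/2"
      have "norm (\<theta>, \<eta>) \<le> norm \<theta> + norm \<eta>" by (rule norm_Pair_le)
      then have "dist (\<theta>, \<eta>) 0 < d" using * by (auto simp: dist_norm)
      with d(2)[of "(\<theta>, \<eta>)"] * show "\<bar>g (p + \<theta> *\<^sub>R a + \<eta> *\<^sub>R b) - g p\<bar> < e"
        by (auto simp: dist_real_def zero_prod_def)
    qed (use d in auto)
  qed
  have "\<bar>dderiv v (dderiv w f) p - dderiv w (dderiv v f) p\<bar> \<le> e" if e: "e > 0" for e
  proof -
    obtain d1 where d1: "d1 > 0" "\<forall>\<theta> \<eta>. 0 < \<theta> \<and> \<theta> < d1 \<and> 0 < \<eta> \<and> \<eta> < d1 \<longrightarrow>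
      \<bar>dderiv v (dderiv w f) (p + \<theta> *\<^sub>R w + \<eta> *\<^sub>R v) - dderiv v (dderiv w f) p\<bar> < e/2"
      using close[of "dderiv v (dderiv w f)" "e/2" w v] e f by (auto intro: smooth_dderiv)
    obtain d2 where d2: "d2 > 0" "\<forall>\<theta> \<eta>. 0 < \<theta> \<and> \<theta> < d2 \<and> 0 < \<eta> \<and> \<eta> < d2 \<longrightarrow>
      \<bar>dderiv w (dderiv v f) (p + \<theta> *\<^sub>R v + \<eta> *\<^sub>R w) - dderiv w (dderiv v f) p\<bar> < e/2"
      using close[of "dderiv w (dderiv v f)" "e/2" v w] e f by (auto intro: smooth_dderiv)
    define h where "h = min d1 d2 / 2"
    have h: "0 < h" "h < d1" "h < d2" using d1(1) d2(1) by (auto simp: h_def)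
    obtain \<theta> \<eta> where 1: "0 < \<theta>" "\<theta> < h" "0 < \<eta>" "\<eta> < h"
      "f (p + h *\<^sub>R v + h *\<^sub>R w) - f (p + h *\<^sub>R v) - f (p + h *\<^sub>R w) + f p =
        h\<^sup>2 * dderiv w (dderiv v f) (p + \<theta> *\<^sub>R v + \<eta> *\<^sub>R w)"
      using second_difference_mean_value[OF f h(1)] by blast
    obtain \<theta>' \<eta>' where 2: "0 < \<theta>'" "\<theta>' < h" "0 < \<eta>'" "\<eta>' < h"
      "f (p + h *\<^sub>R w + h *\<^sub>R v) - f (p + h *\<^sub>R w) - f (p + h *\<^sub>R v) + f p =
        h\<^sup>2 * dderiv v (dderiv w f) (p + \<theta>' *\<^sub>R w + \<eta>' *\<^sub>R v)"
      using second_difference_mean_value[OF f h(1)] by blast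
    have "f (p + h *\<^sub>R w + h *\<^sub>R v) = f (p + h *\<^sub>R v + h *\<^sub>R w)" by (simp add: add_ac)
    with 1(5) 2(5) h(1) have "dderiv w (dderiv v f) (p + \<theta> *\<^sub>R v + \<eta> *\<^sub>R w) = dderiv v (dderiv w f) (p + \<theta>' *\<^sub>R w + \<eta>' *\<^sub>R v)"
      by (simp add: algebra_simps)
    moreover have "\<bar>dderiv v (dderiv w f) (p + \<theta>' *\<^sub>R w + \<eta>' *\<^sub>R v) - dderiv v (dderiv w f) p\<bar> < e/2"
      using d1(2) 2 h by auto
    moreover have "\<bar>dderiv w (dderiv v f) (p + \<theta> *\<^sub>R v + \<eta> *\<^sub>R w) - dderiv w (dderiv v f) p\<bar> < e/2"
      using d2(2) 1 h by auto
    ultimately show ?thesis by arith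
  qed
  then show "dderiv v (dderiv w f) p = dderiv w (dderiv v f) p"
    using field_le_epsilon[of "\<bar>dderiv v (dderiv w f) p - dderiv w (dderiv v f) p\<bar>" 0] by auto
qed

section \<open>Bump functions and test functions\<close>

text \<open>The standard flat function \<open>exp (-1/x)\<close> on the positive half-line, together with its multiples by
powers of \<open>1/x\<close>: the span of this family is closed under differentiation.\<close>

definition exp_flat :: "nat \<Rightarrow> real \<Rightarrow> real" where
  "exp_flat n x = (if x > 0 then (1/x)^n * exp (-(1/x)) else 0)"

lemma exp_flat_tendsto_0: "(exp_flat n \<longlongrightarrow> 0) (at_right 0)"
proof -
  have "((\<lambda>x::real. x ^ n / exp x) \<longlongrightarrow> 0) at_top" by (rule tendsto_power_div_exp_0)
  then have "((\<lambda>x::real. (inverse x) ^ n / exp (inverse x)) \<longlongrightarrow> 0) (at_right 0)"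
    by (rule filterlim_compose) (rule filterlim_inverse_at_top_right)
  then show ?thesis
    by (rule Lim_transform_eventually)
       (auto simp: eventually_at_filter exp_flat_def field_simps exp_minus)
qed

lemma exp_flat_deriv:
  "(exp_flat n has_real_derivative (- real n * exp_flat (n+1) x + exp_flat (n+2) x)) (at x)"
proof -
  consider "x > 0" | "x < 0" | "x = 0" by linarith
  then show ?thesis
  proof cases
    case 1
    have "((\<lambda>x. (1/x)^n * exp (-(1/x))) has_real_derivative (- real n * exp_flat (n+1) x + exp_flat (n+2) x)) (at x)"
    proof -
      have "((\<lambda>x. (1/x)^n) has_real_derivative - real n * (1/x)^(n+1)) (at x)"
      proof (cases n)
        case (Suc m)
        have "((\<lambda>x. 1/x) has_real_derivative - 1 / (x * x)) (at x)"
          using 1 by (auto intro!: derivative_eq_intros)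
        from DERIV_power[OF this, of n] show ?thesis
          unfolding Suc by (rule DERIV_cong) (use 1 in \<open>simp add: field_simps\<close>)
      qed auto
      moreover have "((\<lambda>x. exp (-(1/x))) has_real_derivative exp (-(1/x)) * (1/x)^2) (at x)"
        using 1 by (auto intro!: derivative_eq_intros simp: power2_eq_square)
      ultimately show ?thesis
        using 1 by (auto intro!: DERIV_cong[OF DERIV_mult] simp: exp_flat_def algebra_simps power2_eq_square)
    qed
    then show ?thesis
      by (rule has_field_derivative_transform_within_open[where S="{0<..}"])
         (use 1 in \<open>auto simp: exp_flat_def\<close>)
  next
    case 2
    have "((\<lambda>x. 0::real) has_real_derivative (- real n * exp_flat (n+1) x + exp_flat (n+2) x)) (at x)"
      using 2 by (auto simp: exp_flat_def)
    then show ?thesis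
      by (rule has_field_derivative_transform_within_open[where S="{..<0}"])
         (use 2 in \<open>auto simp: exp_flat_def\<close>)
  next
    case 3
    have "((\<lambda>h. (exp_flat n h - exp_flat n 0) / (h - 0)) \<longlongrightarrow> 0) (at 0)"
      unfolding filterlim_at_split
    proof
      show "((\<lambda>h. (exp_flat n h - exp_flat n 0) / (h - 0)) \<longlongrightarrow> 0) (at_left 0)"
        by (rule Lim_transform_eventually[OF tendsto_const])
           (auto simp: eventually_at_filter exp_flat_def)
      show "((\<lambda>h. (exp_flat n h - exp_flat n 0) / (h - 0)) \<longlongrightarrow> 0) (at_right 0)"
        by (rule Lim_transform_eventually[OF exp_flat_tendsto_0[of "Suc n"]])
           (auto simp: eventually_at_filter exp_flat_def)
    qed
    then show ?thesis
      using 3 by (simp add: has_field_derivative_iff exp_flat_def)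
  qed
qed

lemma dderiv_real: "(f has_real_derivative D) (at x) \<Longrightarrow> dderiv v f x = v * D"
  unfolding has_field_derivative_def by (subst dderiv_eqI) (assumption, rule mult.commute)

lemma smooth_exp_flat: "smooth (exp_flat n)"
proof -
  have d: "exp_flat n differentiable (at x)" for n x
    using exp_flat_deriv[of n x] real_differentiable_def by blast
  have "Ck m (exp_flat n)" for m
  proof (induction m arbitrary: n)
    case 0
    show ?case using d by (auto intro!: continuous_at_imp_continuous_on differentiable_imp_continuous_within)
  next
    case (Suc m)
    have *: "dderiv v (exp_flat n) = (\<lambda>x. (- v * real n) * exp_flat (n+1) x + v * exp_flat (n+2) x)" for v
      by (rule ext) (simp add: dderiv_real[OF exp_flat_deriv] algebra_simps)
    have "Ck m (\<lambda>x::real. c)" for c using smooth_const[of c] by (auto simp: smooth_def)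
    then have "Ck m (dderiv v (exp_flat n))" for v
      unfolding * using Suc.IH by (intro Ck_add Ck_mult) auto
    with d show ?case by simp
  qed
  then show ?thesis by (simp add: smooth_def)
qed

lemma test_functionsI:
  assumes "smooth \<phi>" "compact K" "\<And>p. p \<notin> K \<Longrightarrow> \<phi> p = 0" "K \<subseteq> X"
  shows "\<phi> \<in> test_functions X"
proof -
  have "supp \<phi> \<subseteq> K"
    unfolding supp_def using assms by (intro closure_minimal compact_imp_closed) auto
  moreover from this have "compact (supp \<phi>)"
    using assms by (metis compact_Int_closed closed_closure inf.absorb_iff2 supp_def)
  ultimately show ?thesis using assms by (auto simp: test_functions_def smooth_def)
qed

lemma test_functionsE:
  assumes "\<phi> \<in> test_functions X"
  obtains K where "smooth \<phi>" "compact K" "\<forall>p. p \<notin> K \<longrightarrow> \<phi> p = 0" "K \<subseteq> X"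
proof (rule that[of "supp \<phi>"])
  show "\<forall>p. p \<notin> supp \<phi> \<longrightarrow> \<phi> p = 0"
    using closure_subset[of "{p. \<phi> p \<noteq> 0}"] unfolding supp_def by auto
qed (use assms in \<open>auto simp: test_functions_def smooth_def\<close>)

lemma test_functions_smooth: "\<phi> \<in> test_functions X \<Longrightarrow> smooth \<phi>"
  by (auto simp: test_functions_def smooth_def)

lemma dderiv_eq_0_outside:
  assumes "closed K" "\<And>p. p \<notin> K \<Longrightarrow> \<phi> p = 0" "p \<notin> K"
  shows "dderiv v \<phi> p = 0"
proof -
  have "(\<phi> has_derivative (\<lambda>v. 0)) (at p)"
    by (rule has_derivative_transform_within_open[where s="- K" and f="\<lambda>p. 0"])
       (use assms in \<open>auto simp: open_Compl\<close>)
  then show ?thesis by (rule dderiv_eqI)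
qed

lemma test_functions_dderiv: "\<phi> \<in> test_functions X \<Longrightarrow> dderiv v \<phi> \<in> test_functions X"
  by (erule test_functionsE, rule test_functionsI)
     (auto intro: smooth_dderiv dderiv_eq_0_outside compact_imp_closed)

lemma test_functions_dderiv_pow: "\<phi> \<in> test_functions X \<Longrightarrow> (dderiv v ^^ n) \<phi> \<in> test_functions X"
  by (induction n) (auto intro: test_functions_dderiv)

lemma test_functions_cmult: "\<phi> \<in> test_functions X \<Longrightarrow> (\<lambda>p. c * \<phi> p) \<in> test_functions X"
  by (erule test_functionsE) (auto intro!: test_functionsI smooth_cmult)

lemma test_functions_add:
  assumes "\<phi> \<in> test_functions X" "\<psi> \<in> test_functions X"
  shows "(\<lambda>p. \<phi> p + \<psi> p) \<in> test_functions X"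
proof -
  obtain K where K: "smooth \<phi>" "compact K" "\<forall>p. p \<notin> K \<longrightarrow> \<phi> p = 0" "K \<subseteq> X"
    using assms(1) by (rule test_functionsE)
  obtain L where L: "smooth \<psi>" "compact L" "\<forall>p. p \<notin> L \<longrightarrow> \<psi> p = 0" "L \<subseteq> X"
    using assms(2) by (rule test_functionsE)
  show ?thesis
    by (rule test_functionsI[of _ "K \<union> L"]) (use K L in \<open>auto intro: smooth_add\<close>)
qed

lemma test_functions_diff:
  assumes "\<phi> \<in> test_functions X" "\<psi> \<in> test_functions X"
  shows "(\<lambda>p. \<phi> p - \<psi> p) \<in> test_functions X"
  using test_functions_add[OF assms(1) test_functions_cmult[OF assms(2), of "-1"]] by simp

text \<open>The map \<open>B\<close> is a continuous left inverse of the affine map; it carries the support of \<open>\<phi>\<close> to a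
compact set that contains the support of the composition.\<close>

lemma test_functions_affine:
  assumes \<phi>: "\<phi> \<in> test_functions X" and A: "bounded_linear A"
    and B: "continuous_on UNIV B" "\<And>p. B (a + A p) = p" and Y: "B ` X \<subseteq> Y"
  shows "(\<lambda>p. \<phi> (a + A p)) \<in> test_functions Y"
proof -
  obtain K where K: "smooth \<phi>" "compact K" "\<forall>p. p \<notin> K \<longrightarrow> \<phi> p = 0" "K \<subseteq> X"
    using \<phi> by (rule test_functionsE)
  show ?thesis
  proof (rule test_functionsI[of _ "B ` K"])
    show "compact (B ` K)"
      using K B by (intro compact_continuous_image) (auto intro: continuous_on_subset)
    show "\<phi> (a + A p) = 0" if "p \<notin> B ` K" for p
      using that B(2) K(3) by (metis image_eqI)
  qed (use K A Y in \<open>auto intro: smooth_affine\<close>)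
qed

text \<open>As \<open>n\<close> grows, the factors \<open>exp (- 1 / (n d))\<close>, with \<open>d\<close> the signed distance to a face, increase to 1
inside the box, so that these functions approximate the indicator of the box from below.\<close>

definition box_bump :: "nat \<Rightarrow> 'a::euclidean_space \<Rightarrow> 'a \<Rightarrow> 'a \<Rightarrow> real" where
  "box_bump n a b p =
    (\<Prod>i\<in>Basis. exp_flat 0 (real n * ((p - a) \<bullet> i)) * exp_flat 0 (real n * ((b - p) \<bullet> i)))"

lemma exp_flat_0_bounds: "0 \<le> exp_flat 0 x" "exp_flat 0 x \<le> 1"
  by (auto simp: exp_flat_def)

lemma box_bump_bounds: "0 \<le> box_bump n a b p" "box_bump n a b p \<le> 1"
  unfolding box_bump_def
  by (auto intro!: prod_nonneg prod_le_1 mult_nonneg_nonneg mult_le_one exp_flat_0_bounds)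

lemma box_bump_outside: "p \<notin> box a b \<Longrightarrow> box_bump n a b p = 0"
  by (auto simp: box_bump_def mem_box exp_flat_def inner_diff_left zero_less_mult_iff)

lemma box_bump_pos: "p \<in> box a b \<Longrightarrow> n > 0 \<Longrightarrow> box_bump n a b p > 0"
  unfolding box_bump_def
  by (intro prod_pos) (auto simp: mem_box exp_flat_def inner_diff_left zero_less_mult_iff)

lemma box_bump_tendsto: 
  assumes "p \<in> box a b"
  shows "(\<lambda>n. box_bump n a b p) \<longlonglongrightarrow> 1"
proof -
  have *: "(\<lambda>n. exp_flat 0 (real n * x)) \<longlonglongrightarrow> 1" if "x > 0" for x
  proof -
    have "(\<lambda>n. exp (- ((1/x) * (1 / real n)))) \<longlonglongrightarrow> exp (- ((1/x) * 0))"
      by (intro tendsto_intros lim_1_over_n)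
    moreover have "\<forall>\<^sub>F n in sequentially. exp (- ((1/x) * (1 / real n))) = exp_flat 0 (real n * x)"
      using eventually_gt_at_top[of 0] by eventually_elim (use that in \<open>auto simp: exp_flat_def field_simps\<close>)
    ultimately show ?thesis by (simp add: Lim_transform_eventually)
  qed
  have "(\<lambda>n. box_bump n a b p) \<longlonglongrightarrow> (\<Prod>i\<in>(Basis::'a set). 1 * 1)"
    unfolding box_bump_def using assms
    by (intro tendsto_prod tendsto_mult *) (auto simp: mem_box inner_diff_left)
  then show ?thesis by simp
qed

lemma smooth_box_bump: "smooth (box_bump n a b)"
proof -
  have "smooth (\<lambda>p. exp_flat 0 (real n * ((p - a) \<bullet> i)))" for i
    using smooth_affine[OF bounded_linear_const_mult[OF bounded_linear_inner_left] smooth_exp_flat[of 0], of "- (real n * (a \<bullet> i))" "real n" i]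
    by (simp add: inner_diff_left algebra_simps)
  moreover have "smooth (\<lambda>p. exp_flat 0 (real n * ((b - p) \<bullet> i)))" for i
    using smooth_affine[OF bounded_linear_const_mult[OF bounded_linear_inner_left] smooth_exp_flat[of 0], of "real n * (b \<bullet> i)" "- real n" i]
    by (simp add: inner_diff_left algebra_simps)
  ultimately show ?thesis
    unfolding box_bump_def by (intro smooth_prod smooth_mult) auto
qed

text \<open>An open set is a countable union of boxes.  If \<open>\<phi>\<^sub>1, \<dots>, \<phi>\<^sub>n\<close> approximate the indicators of the first
\<open>n\<close> boxes from below, then \<open>1 - (1 - \<phi>\<^sub>1) \<cdots> (1 - \<phi>\<^sub>n)\<close> is smooth and approximates the indicator of
their union from below.\<close>

lemma indicator_open_approx:
  fixes U :: "'a::euclidean_space set"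
  assumes "open U"
  obtains \<phi> :: "nat \<Rightarrow> 'a \<Rightarrow> real"
  where "\<And>n. \<phi> n \<in> test_functions UNIV" "\<And>n p. 0 \<le> \<phi> n p" "\<And>n p. \<phi> n p \<le> indicator U p"
    "\<And>p. (\<lambda>n. \<phi> n p) \<longlonglongrightarrow> indicator U p"
proof -
  obtain \<D> where D: "countable \<D>" "\<D> \<subseteq> Pow U" "\<And>X. X \<in> \<D> \<Longrightarrow> \<exists>a b. X = box a b" "\<Union>\<D> = U"
    using open_countable_Union_open_box[OF assms] by metis
  \<comment> \<open>Adding an empty box allows the family to be enumerated even if \<open>U\<close> is empty.\<close>
  define \<D>' where "\<D>' = insert (box 0 0) \<D>"
  have D': "countable \<D>'" "\<D>' \<noteq> {}" "\<Union>\<D>' = U"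
    using D by (auto simp: \<D>'_def)
  have "\<exists>a b. X = box a b" if "X \<in> \<D>'" for X
    using that D(3) unfolding \<D>'_def by blast
  note D' = D' this
  have "\<exists>a b. from_nat_into \<D>' i = box a b" for i
    using D' by (simp add: from_nat_into)
  then obtain a b where ab: "\<And>i. from_nat_into \<D>' i = box (a i) (b i)" by metis
  have U: "U = (\<Union>i. box (a i) (b i))"
    using range_from_nat_into[OF D'(2,1)] D'(3) by (auto simp: ab[symmetric])
  define \<phi> where "\<phi> n p = 1 - (\<Prod>i<n. 1 - box_bump n (a i) (b i) p)" for n p
  show ?thesis
  proof (rule that)
    fix n
    show "\<phi> n \<in> test_functions UNIV"
    proof (rule test_functionsI)
      show "smooth (\<phi> n)"
        unfolding \<phi>_def by (intro smooth_diff smooth_const smooth_prod smooth_box_bump)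
      show "compact (\<Union>i<n. cbox (a i) (b i))" by auto
      show "\<phi> n p = 0" if "p \<notin> (\<Union>i<n. cbox (a i) (b i))" for p
      proof -
        have "box_bump n (a i) (b i) p = 0" if "i < n" for i
          using that \<open>p \<notin> _\<close> box_subset_cbox[of "a i" "b i"] by (intro box_bump_outside) auto
        then show ?thesis by (simp add: \<phi>_def)
      qed
    qed auto
    fix p
    have b: "0 \<le> (\<Prod>i<n. 1 - box_bump n (a i) (b i) p)" "(\<Prod>i<n. 1 - box_bump n (a i) (b i) p) \<le> 1"
      using box_bump_bounds[of n] by (auto intro!: prod_nonneg prod_le_1)
    then show "0 \<le> \<phi> n p" by (auto simp: \<phi>_def)
    show "\<phi> n p \<le> indicator U p"
    proof (cases "p \<in> U")
      case False
      then have "box_bump n (a i) (b i) p = 0" for i by (intro box_bump_outside) (auto simp: U)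
      then show ?thesis by (simp add: \<phi>_def)
    qed (use b in \<open>auto simp: \<phi>_def\<close>)
  next
    fix p
    show "(\<lambda>n. \<phi> n p) \<longlonglongrightarrow> indicator U p"
    proof (cases "p \<in> U")
      case False
      then have "box_bump n (a i) (b i) p = 0" for n i by (intro box_bump_outside) (auto simp: U)
      then show ?thesis using False by (simp add: \<phi>_def)
    next
      case True
      then obtain j where j: "p \<in> box (a j) (b j)" by (auto simp: U)
      have "(\<lambda>n. \<phi> n p) \<longlonglongrightarrow> 1"
      proof (rule tendsto_sandwich[OF _ _ box_bump_tendsto[OF j] tendsto_const])
        show "\<forall>\<^sub>F n in sequentially. \<phi> n p \<le> 1"
          using box_bump_bounds by (auto simp: \<phi>_def intro!: always_eventually prod_nonneg)
        show "\<forall>\<^sub>F n in sequentially. box_bump n (a j) (b j) p \<le> \<phi> n p"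
          using eventually_gt_at_top[of j]
        proof eventually_elim
          case (elim n)
          have "(\<Prod>i<n. 1 - box_bump n (a i) (b i) p)
             = (1 - box_bump n (a j) (b j) p) * (\<Prod>i\<in>{..<n} - {j}. 1 - box_bump n (a i) (b i) p)"
            using elim by (subst prod.remove[of _ j]) auto
          also have "\<dots> \<le> (1 - box_bump n (a j) (b j) p) * 1"
            using box_bump_bounds[of n] by (intro mult_left_mono prod_le_1) auto
          finally show ?case by (simp add: \<phi>_def)
        qed
      qed
      then show ?thesis using True by simp
    qed
  qed
qed

section \<open>Square-integrable functions\<close>

lemma L2_borel_measurable: "f \<in> L2 \<Longrightarrow> f \<in> borel_measurable borel"
  by (simp add: L2_def)

lemma L2_integrable_sq: "f \<in> L2 \<Longrightarrow> integrable lborel (\<lambda>p. (f p)\<^sup>2)"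
  by (simp add: L2_def)

lemma L2_I: "f \<in> borel_measurable borel \<Longrightarrow> integrable lborel (\<lambda>p. (f p)\<^sup>2) \<Longrightarrow> f \<in> L2"
  by (simp add: L2_def)

lemma sq_add_le: "(a + b)\<^sup>2 \<le> 2 * a\<^sup>2 + 2 * (b::real)\<^sup>2"
  using zero_le_power2[of "a - b"] by (simp add: power2_eq_square algebra_simps)

lemma sq_diff_le: "(a - b)\<^sup>2 \<le> 2 * a\<^sup>2 + 2 * (b::real)\<^sup>2"
  using sq_add_le[of a "-b"] by simp

lemma abs_mult_le_sq: "\<bar>a * b\<bar> \<le> a\<^sup>2 + (b::real)\<^sup>2"
proof -
  have "0 \<le> (\<bar>a\<bar> - \<bar>b\<bar>)\<^sup>2" by auto
  moreover have "0 \<le> \<bar>a\<bar> * \<bar>b\<bar>" by simp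
  ultimately show ?thesis
    unfolding power2_diff abs_mult power2_abs by linarith
qed

lemma L2_add: 
  assumes "f \<in> L2" "g \<in> L2"
  shows "(\<lambda>p. f p + g p) \<in> L2"
proof (rule L2_I)
  note [measurable] = assms[THEN L2_borel_measurable]
  show "(\<lambda>p. f p + g p) \<in> borel_measurable borel" by measurable
  have "integrable lborel (\<lambda>p. 2 * (f p)\<^sup>2 + 2 * (g p)\<^sup>2)"
    by (auto intro!: integrable_mult_right assms L2_integrable_sq)
  then show "integrable lborel (\<lambda>p. (f p + g p)\<^sup>2)"
    by (rule Bochner_Integration.integrable_bound) (auto intro!: sq_add_le)
qed

lemma L2_cmult: "f \<in> L2 \<Longrightarrow> (\<lambda>p. c * f p) \<in> L2"
  by (auto simp: L2_def power_mult_distrib)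

lemma L2_diff: 
  assumes "f \<in> L2" "g \<in> L2"
  shows "(\<lambda>p. f p - g p) \<in> L2"
  using L2_add[OF assms(1) L2_cmult[OF assms(2), of "-1"]] by simp

lemma L2_integrable_mult:
  assumes "f \<in> L2" "g \<in> L2"
  shows "integrable lborel (\<lambda>p. f p * g p)"
proof -
  note [measurable] = assms[THEN L2_borel_measurable]
  have "integrable lborel (\<lambda>p. (f p)\<^sup>2 + (g p)\<^sup>2)"
    by (auto intro!: assms L2_integrable_sq)
  then show ?thesis
    by (rule Bochner_Integration.integrable_bound) (auto intro!: order_trans[OF abs_mult_le_sq])
qed

lemma L2_sq_add_le:
  assumes "f \<in> L2" "g \<in> L2"
  shows "(LINT p|lborel. (f p + g p)\<^sup>2) \<le> 2 * (LINT p|lborel. (f p)\<^sup>2) + 2 * (LINT p|lborel. (g p)\<^sup>2)"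
proof -
  have "(LINT p|lborel. (f p + g p)\<^sup>2) \<le> (LINT p|lborel. 2 * (f p)\<^sup>2 + 2 * (g p)\<^sup>2)"
    using assms by (intro integral_mono) (auto intro!: L2_integrable_sq L2_add sq_add_le)
  then show ?thesis using assms by (simp add: L2_integrable_sq)
qed

lemma Cauchy_Schwarz_L2:
  assumes "f \<in> L2" "g \<in> L2"
  shows "(LINT p|lborel. \<bar>f p * g p\<bar>)\<^sup>2 \<le> (LINT p|lborel. (f p)\<^sup>2) * (LINT p|lborel. (g p)\<^sup>2)"
proof -
  note [measurable] = assms[THEN L2_borel_measurable]
  have "(\<integral>\<^sup>+p. ennreal \<bar>f p\<bar> * ennreal \<bar>g p\<bar> \<partial>lborel)\<^sup>2
      \<le> (\<integral>\<^sup>+p. (ennreal \<bar>f p\<bar>)\<^sup>2 \<partial>lborel) * (\<integral>\<^sup>+p. (ennreal \<bar>g p\<bar>)\<^sup>2 \<partial>lborel)"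
    by (rule Cauchy_Schwarz_nn_integral) auto
  moreover have "(\<integral>\<^sup>+p. ennreal \<bar>f p\<bar> * ennreal \<bar>g p\<bar> \<partial>lborel) = ennreal (LINT p|lborel. \<bar>f p * g p\<bar>)"
    using integrable_abs[OF L2_integrable_mult[OF assms]]
    by (subst nn_integral_eq_integral[symmetric]) (auto simp: ennreal_mult[symmetric] abs_mult)
  moreover have "(\<integral>\<^sup>+p. (ennreal \<bar>h p\<bar>)\<^sup>2 \<partial>lborel) = ennreal (LINT p|lborel. (h p)\<^sup>2)" if "h \<in> L2" for h :: "'a \<Rightarrow> real"
    using L2_integrable_sq[OF that]
    by (subst nn_integral_eq_integral[symmetric]) (auto simp: ennreal_power)
  ultimately show ?thesis
    using assms by (simp add: ennreal_power ennreal_mult[symmetric] integral_nonneg_AE)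
qed

lemma continuous_compact_support_integrable:
  fixes f :: "'a::euclidean_space \<Rightarrow> real"
  assumes "continuous_on UNIV f" "compact K" "\<And>p. p \<notin> K \<Longrightarrow> f p = 0"
  shows "integrable lborel f"
proof -
  have "integrable lborel (\<lambda>p. indicator K p *\<^sub>R f p)"
    using assms by (intro borel_integrable_compact) (auto intro: continuous_on_subset)
  moreover have "(\<lambda>p. indicator K p *\<^sub>R f p) = f"
    using assms(3) by (auto simp: indicator_def of_bool_def)
  ultimately show ?thesis by simp
qed

lemma continuous_compact_support_L2:
  assumes "continuous_on UNIV f" "compact K" "\<And>p. p \<notin> K \<Longrightarrow> f p = 0"
  shows "f \<in> L2"
  using assms 
  by (intro L2_I continuous_compact_support_integrable[where K=K]) (auto intro!: borel_measurable_continuous_onI continuous_intros)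

lemma test_functions_L2: "\<phi> \<in> test_functions X \<Longrightarrow> \<phi> \<in> L2"
  by (erule test_functionsE) (auto intro: continuous_compact_support_L2 smooth_continuous_on)

lemma continuous_compact_support_bounded:
  fixes f :: "'a::euclidean_space \<Rightarrow> real"
  assumes "continuous_on UNIV f" "compact K" "\<And>p. p \<notin> K \<Longrightarrow> f p = 0"
  obtains B where "B > 0" "\<And>p. \<bar>f p\<bar> \<le> B"
proof -
  have "bounded (f ` K)"
    using assms by (intro compact_imp_bounded compact_continuous_image) (auto intro: continuous_on_subset)
  then obtain B where "B > 0" "\<And>p. p \<in> K \<Longrightarrow> \<bar>f p\<bar> \<le> B"
    by (auto simp: bounded_pos)
  then show ?thesis
    using assms(3) by (intro that[of B]) (metis abs_zero less_eq_real_def)+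
qed

lemma compact_thicken:
  fixes K :: "'a::euclidean_space set"
  assumes "compact K"
  obtains K' where "compact K'" "\<And>p h. norm h \<le> 1 \<Longrightarrow> p + h \<in> K \<Longrightarrow> p \<in> K'"
proof (rule that[of "{x + y |x y. x \<in> K \<and> y \<in> cball 0 1}"])
  show "compact {x + y |x y. x \<in> K \<and> y \<in> cball 0 (1::real)}"
    using assms by (intro compact_sums) auto
  show "p \<in> {x + y |x y. x \<in> K \<and> y \<in> cball 0 1}" if "norm h \<le> 1" "p + h \<in> K" for p h
  proof -
    have "p = (p + h) + (- h) \<and> p + h \<in> K \<and> - h \<in> cball 0 1" using that by auto
    then show ?thesis by blast
  qed
qed

lemma continuous_compact_support_uniform:
  fixes f :: "'a::euclidean_space \<Rightarrow> real"
  assumes "continuous_on UNIV f" "compact K" "\<And>p. p \<notin> K \<Longrightarrow> f p = 0" "e > 0"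
  obtains d where "d > 0" "\<And>p h. norm h < d \<Longrightarrow> \<bar>f (p + h) - f p\<bar> < e"
proof -
  obtain K' where K': "compact K'" "\<And>p h. norm h \<le> 1 \<Longrightarrow> p + h \<in> K \<Longrightarrow> p \<in> K'"
    using compact_thicken[OF assms(2)] by blast
  have "uniformly_continuous_on K' f"
    using assms K' by (intro compact_uniformly_continuous) (auto intro: continuous_on_subset)
  then obtain d where d: "d > 0" "\<And>x y. x \<in> K' \<Longrightarrow> y \<in> K' \<Longrightarrow> dist y x < d \<Longrightarrow> dist (f y) (f x) < e"
    using \<open>e > 0\<close> unfolding uniformly_continuous_on_def by metis
  show ?thesis
  proof (rule that[of "min d 1"])
    fix p h :: 'a assume h: "norm h < min d 1"
    show "\<bar>f (p + h) - f p\<bar> < e"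
    proof (cases "p \<in> K \<or> p + h \<in> K")
      case True
      then have "p \<in> K' \<and> p + h \<in> K'"
        using K'(2)[of 0 p] K'(2)[of 0 "p + h"] K'(2)[of h p] K'(2)[of "-h" "p + h"] h by auto
      then show ?thesis using d(2)[of p "p + h"] h by (auto simp: dist_real_def dist_norm)
    next
      case False
      then show ?thesis using assms by auto
    qed
  qed (use d in auto)
qed

subsection \<open>Density of test functions\<close>

text \<open>Membership in the \<open>L\<^sup>2\<close>-closure of the test functions.  Squared distances are used throughout, with
\<open>(a + b)\<^sup>2 \<le> 2 a\<^sup>2 + 2 b\<^sup>2\<close> in place of the triangle inequality.\<close>

definition test_approximable :: "('a::euclidean_space \<Rightarrow> real) \<Rightarrow> bool" where
  "test_approximable f \<longleftrightarrow> (\<forall>e>0. \<exists>\<phi>\<in>test_functions UNIV. (LINT p|lborel. (f p - \<phi> p)\<^sup>2) < e)"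

lemma test_approximableE:
  assumes "test_approximable f" "e > 0"
  obtains \<phi> where "\<phi> \<in> test_functions UNIV" "(LINT p|lborel. (f p - \<phi> p)\<^sup>2) < e"
  using assms unfolding test_approximable_def by blast

lemma test_approximable_limit:
  assumes f: "f \<in> L2" and g: "\<And>e. e > 0 \<Longrightarrow> \<exists>g\<in>L2. test_approximable g \<and> (LINT p|lborel. (f p - g p)\<^sup>2) < e"
  shows "test_approximable f"
  unfolding test_approximable_def
proof (intro allI impI)
  fix e :: real assume e: "e > 0"
  obtain g where g: "g \<in> L2" "test_approximable g" "(LINT p|lborel. (f p - g p)\<^sup>2) < e/4" 
    using g[of "e/4"] e by auto
  obtain \<phi> where \<phi>: "\<phi> \<in> test_functions UNIV" "(LINT p|lborel. (g p - \<phi> p)\<^sup>2) < e/4"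
    using test_approximableE[OF g(2), of "e/4"] e by auto
  have "(LINT p|lborel. ((f p - g p) + (g p - \<phi> p))\<^sup>2) \<le> 2 * (LINT p|lborel. (f p - g p)\<^sup>2) + 2 * (LINT p|lborel. (g p - \<phi> p)\<^sup>2)"
    using f g \<phi> by (intro L2_sq_add_le L2_diff) (auto intro: test_functions_L2)
  then have "(LINT p|lborel. (f p - \<phi> p)\<^sup>2) < e" using g(3) \<phi>(2) by simp
  with \<phi>(1) show "\<exists>\<phi>\<in>test_functions UNIV. (LINT p|lborel. (f p - \<phi> p)\<^sup>2) < e" by blast
qed

lemma test_approximable_add:
  assumes f: "f \<in> L2" "test_approximable f" and g: "g \<in> L2" "test_approximable g"
  shows "test_approximable (\<lambda>p. f p + g p)"
  unfolding test_approximable_def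
proof (intro allI impI)
  fix e :: real assume e: "e > 0"
  obtain \<phi> where \<phi>: "\<phi> \<in> test_functions UNIV" "(LINT p|lborel. (f p - \<phi> p)\<^sup>2) < e/4"
    using test_approximableE[OF f(2), of "e/4"] e by auto
  obtain \<psi> where \<psi>: "\<psi> \<in> test_functions UNIV" "(LINT p|lborel. (g p - \<psi> p)\<^sup>2) < e/4"
    using test_approximableE[OF g(2), of "e/4"] e by auto
  have "(LINT p|lborel. ((f p - \<phi> p) + (g p - \<psi> p))\<^sup>2) \<le> 2 * (LINT p|lborel. (f p - \<phi> p)\<^sup>2) + 2 * (LINT p|lborel. (g p - \<psi> p)\<^sup>2)"
    using f g \<phi> \<psi> by (intro L2_sq_add_le L2_diff) (auto intro: test_functions_L2)
  then have "(LINT p|lborel. (f p + g p - (\<phi> p + \<psi> p))\<^sup>2) < e" using \<psi>(2) \<phi>(2) by (simp add: algebra_simps)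
  then show "\<exists>\<phi>\<in>test_functions UNIV. (LINT p|lborel. (f p + g p - \<phi> p)\<^sup>2) < e"
    by (rule bexI[OF _ test_functions_add[OF \<phi>(1) \<psi>(1)]])
qed

lemma test_approximable_cmult:
  assumes f: "test_approximable f"
  shows "test_approximable (\<lambda>p. c * f p)"
  unfolding test_approximable_def
proof (intro allI impI)
  fix e :: real assume e: "e > 0"
  have c: "c\<^sup>2 + 1 > 0" by (simp add: add_nonneg_pos)
  obtain \<phi> where \<phi>: "\<phi> \<in> test_functions UNIV" "(LINT p|lborel. (f p - \<phi> p)\<^sup>2) < e/(c\<^sup>2 + 1)"
    using test_approximableE[OF f, of "e/(c\<^sup>2 + 1)"] e c by auto
  have "(LINT p|lborel. (c * f p - c * \<phi> p)\<^sup>2) = c\<^sup>2 * (LINT p|lborel. (f p - \<phi> p)\<^sup>2)"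
    by (simp add: right_diff_distrib[symmetric] power_mult_distrib)
  also have "\<dots> \<le> (c\<^sup>2 + 1) * (LINT p|lborel. (f p - \<phi> p)\<^sup>2)"
    by (intro mult_right_mono) auto
  also have "\<dots> < e" using \<phi>(2) c by (simp add: field_simps)
  finally show "\<exists>\<phi>\<in>test_functions UNIV. (LINT p|lborel. (c * f p - \<phi> p)\<^sup>2) < e"
    by (rule bexI[OF _ test_functions_cmult[OF \<phi>(1)]])
qed

lemma indicator_L2:
  assumes "A \<in> sets borel" "emeasure lborel A < \<infinity>"
  shows "indicat_real A \<in> L2"
proof -
  have "(\<lambda>p. (indicat_real A p)\<^sup>2) = indicat_real A" by (auto simp: indicator_def)
  with assms show ?thesis by (intro L2_I) (auto intro!: integrable_real_indicator)
qed

lemma test_approximable_indicator_open: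
  fixes U :: "'a::euclidean_space set"
  assumes U: "open U" "emeasure lborel U < \<infinity>"
  shows "test_approximable (indicat_real U)"
  unfolding test_approximable_def
proof (intro allI impI)
  fix e :: real assume e: "e > 0"
  obtain \<phi> :: "nat \<Rightarrow> 'a \<Rightarrow> real" where \<phi>: "\<And>n. \<phi> n \<in> test_functions UNIV"
     "\<And>n p. 0 \<le> \<phi> n p" "\<And>n p. \<phi> n p \<le> indicator U p"
    "\<And>p. (\<lambda>n. \<phi> n p) \<longlonglongrightarrow> indicator U p"
    using indicator_open_approx[OF U(1)] by blast
  have "(\<lambda>n. LINT p|lborel. (indicator U p - \<phi> n p)\<^sup>2) \<longlonglongrightarrow> (LINT (p::'a)|lborel. (0::real))"
  proof (rule integral_dominated_convergence[where w="indicator U"])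
    show "integrable lborel (indicat_real U)" using U by (auto intro!: integrable_real_indicator)
    show "AE p in lborel. (\<lambda>n. (indicator U p - \<phi> n p)\<^sup>2) \<longlonglongrightarrow> 0"
    proof (rule AE_I2)
      fix p
      show "(\<lambda>n. (indicator U p - \<phi> n p)\<^sup>2) \<longlonglongrightarrow> 0"
        using tendsto_power[OF tendsto_diff[OF tendsto_const \<phi>(4)], of "indicator U p" p 2] by simp
    qed
    show "AE p in lborel. norm ((indicator U p - \<phi> n p)\<^sup>2) \<le> indicator U p" for n
    proof (rule AE_I2)
      fix p
      show "norm ((indicator U p - \<phi> n p)\<^sup>2) \<le> indicator U p"
        using \<phi>(2,3)[of n p] by (cases "p \<in> U") (auto intro!: power_le_one)
    qed
    have [measurable]: "U \<in> sets borel" "\<phi> n \<in> borel_measurable borel" for n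
      using U(1) L2_borel_measurable[OF test_functions_L2[OF \<phi>(1)[of n]]] by auto
    show "(\<lambda>p. (indicator U p - \<phi> n p)\<^sup>2) \<in> borel_measurable lborel" for n
      by measurable
  qed auto
  then have "\<forall>\<^sub>F n in sequentially. (LINT p|lborel. (indicator U p - \<phi> n p)\<^sup>2) < e"
    using e by (auto dest: order_tendstoD)
  then obtain n where "(LINT p|lborel. (indicator U p - \<phi> n p)\<^sup>2) < e"
    by (auto simp: eventually_sequentially)
  with \<phi>(1) show "\<exists>\<phi>\<in>test_functions UNIV. (LINT p|lborel. (indicator U p - \<phi> p)\<^sup>2) < e" by blast
qed

text \<open>By outer regularity of Lebesgue measure, \<open>A\<close> differs from an open set by little.\<close>

lemma test_approximable_indicator:
  assumes A: "A \<in> sets borel" "emeasure lborel A < \<infinity>"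
  shows "test_approximable (indicat_real A)"
proof (rule test_approximable_limit[OF indicator_L2[OF A]])
  fix e :: real assume e: "e > 0"
  obtain U where U: "open U" "A \<subseteq> U" "emeasure lborel (U - A) < e"
    using outer_regular_lborel[OF A(1) e] by blast
  have UA: "emeasure lborel (U - A) < top"
    using U(3) top_greatest by (rule order_less_le_trans)
  have "emeasure lborel U = emeasure lborel A + emeasure lborel (U - A)"
    using U(1,2) A(1) by (subst plus_emeasure) (auto simp: Un_absorb1)
  also have "\<dots> < \<infinity>" using UA A(2) by simp
  finally have fin: "emeasure lborel U < \<infinity>" .
  have "(\<lambda>p. (indicat_real A p - indicat_real U p)\<^sup>2) = indicat_real (U - A)"
    using U(2) by (auto simp: indicator_def fun_eq_iff)
  then have "(LINT p|lborel. (indicat_real A p - indicat_real U p)\<^sup>2) = measure lborel (U - A)"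
    by simp
  also have "\<dots> < e"
  proof -
    have "ennreal (measure lborel (U - A)) = emeasure lborel (U - A)"
      by (rule emeasure_eq_ennreal_measure[OF less_imp_neq[OF UA], symmetric])
    then have "ennreal (measure lborel (U - A)) < ennreal e" using U(3) by (rule ord_eq_less_trans)
    then show ?thesis by (rule ennreal_less_iff[OF measure_nonneg, THEN iffD1])
  qed
  finally have "(LINT p|lborel. (indicat_real A p - indicat_real U p)\<^sup>2) < e" .
  with test_approximable_indicator_open[OF U(1) fin]
  show "\<exists>g\<in>L2. test_approximable g \<and> (LINT p|lborel. (indicat_real A p - g p)\<^sup>2) < e"
    by (intro bexI[OF _ indicator_L2[OF borel_open[OF U(1)] fin]] conjI)
qed

text \<open>A square-integrable function is the limit of simple functions that it dominates up to a factor of 2.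
Being square-integrable themselves, these are finite combinations of indicators of sets of finite
measure.\<close>

theorem test_functions_dense_L2:
  fixes f :: "'a::euclidean_space \<Rightarrow> real"
  assumes f: "f \<in> L2" 
  shows "test_approximable f"
proof (rule test_approximable_limit[OF f])
  fix e :: real assume e: "e > 0"
  note [measurable] = L2_borel_measurable[OF f]
  have "f \<in> borel_measurable lborel" by simp
  from borel_measurable_implies_sequence_metric[OF this, of 0]
  obtain s where s: "\<And>i. simple_function lborel (s i)" "\<And>p. (\<lambda>i. s i p) \<longlonglongrightarrow> f p"
    "\<And>i p. \<bar>s i p\<bar> \<le> 2 * \<bar>f p\<bar>"
    by (auto simp: dist_real_def)
  have sm [measurable]: "s i \<in> borel_measurable borel" for i
    using borel_measurable_simple_function[OF s(1)[of i]] by simp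
  have s_le: "(s i p)\<^sup>2 \<le> 4 * (f p)\<^sup>2" for i p
    using power_mono[OF s(3)[of i p] abs_ge_zero, of 2] by (simp add: power_mult_distrib)
  have f4: "integrable lborel (\<lambda>p. 4 * (f p)\<^sup>2)" using f by (simp add: L2_integrable_sq)
  have sL: "s i \<in> L2" for i
    by (intro L2_I sm Bochner_Integration.integrable_bound[OF f4]) (auto intro!: s_le)
  have "test_approximable (s i)" for i
  proof -
    let ?R = "s i ` UNIV - {0}"
    let ?A = "\<lambda>y. s i -` {y}"
    have fin: "finite ?R" using simple_functionD(1)[OF s(1)[of i]] by simp
    have Am: "?A y \<in> sets borel" for y using measurable_sets[OF sm, of "{y}" i] by simp
    have Afin: "emeasure lborel (?A y) < \<infinity>" if "y \<noteq> 0" for y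
    proof -
      have "integrable lborel (\<lambda>p. (1 / y\<^sup>2) * (s i p)\<^sup>2)"
        using sL by (simp add: L2_integrable_sq)
      then have "integrable lborel (indicat_real (?A y))"
        by (rule Bochner_Integration.integrable_bound) (use Am that in \<open>auto simp: indicator_def\<close>)
      then show ?thesis using Am by (simp add: integrable_indicator_iff)
    qed
    have "test_approximable (\<lambda>p. \<Sum>y\<in>R. y * indicat_real (?A y) p) \<and> (\<lambda>p. \<Sum>y\<in>R. y * indicat_real (?A y) p) \<in> L2"
      if "finite R" "R \<subseteq> ?R" for R
      using that
    proof (induction R)
      case empty
      have "(\<lambda>p. 0) \<in> test_functions UNIV" by (rule test_functionsI[of _ "{}"]) (auto intro: smooth_const)
      then show ?case
        unfolding test_approximable_def by (auto simp: test_functions_L2 intro!: bexI[of _ "\<lambda>p. 0"])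
    next
      case (insert y R)
      then have "test_approximable (\<lambda>p. y * indicat_real (?A y) p)" "(\<lambda>p. y * indicat_real (?A y) p) \<in> L2"
        using Am Afin by (auto intro!: test_approximable_cmult L2_cmult test_approximable_indicator indicator_L2)
      with insert show ?case
        unfolding sum.insert[OF insert(1,2)] by (auto intro!: test_approximable_add L2_add)
    qed
    from this[OF fin] have "test_approximable (\<lambda>p. \<Sum>y\<in>?R. y * indicat_real (?A y) p)" by simp
    moreover have "(\<Sum>y\<in>?R. y * indicat_real (?A y) p) = s i p" for p
    proof -
      have "(\<Sum>y\<in>?R. y * indicat_real (?A y) p) = (\<Sum>y\<in>?R. if y = s i p then s i p else 0)"
        by (intro sum.cong) (auto simp: indicator_def)
      then show ?thesis using fin by auto
    qed
    ultimately show ?thesis by simp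
  qed
  moreover have "(\<lambda>i. LINT p|lborel. (f p - s i p)\<^sup>2) \<longlonglongrightarrow> (LINT (p::'a)|lborel. (0::real))"
  proof (rule integral_dominated_convergence[where w="\<lambda>p. 10 * (f p)\<^sup>2"])
    show "integrable lborel (\<lambda>p. 10 * (f p)\<^sup>2)" using f by (simp add: L2_integrable_sq)
    show "AE p in lborel. (\<lambda>i. (f p - s i p)\<^sup>2) \<longlonglongrightarrow> 0"
    proof (rule AE_I2)
      fix p
      show "(\<lambda>i. (f p - s i p)\<^sup>2) \<longlonglongrightarrow> 0"
        using tendsto_power[OF tendsto_diff[OF tendsto_const s(2)], of "f p" p 2] by simp
    qed
    show "AE p in lborel. norm ((f p - s i p)\<^sup>2) \<le> 10 * (f p)\<^sup>2" for i
    proof (rule AE_I2)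
      fix p
      show "norm ((f p - s i p)\<^sup>2) \<le> 10 * (f p)\<^sup>2"
        using sq_diff_le[of "f p" "s i p"] s_le[of i p] by simp
    qed
  qed auto
  then have "\<forall>\<^sub>F i in sequentially. (LINT p|lborel. (f p - s i p)\<^sup>2) < e"
    using e by (auto dest: order_tendstoD)
  then obtain i where "(LINT p|lborel. (f p - s i p)\<^sup>2) < e"
    by (auto simp: eventually_sequentially)
  ultimately show "\<exists>g\<in>L2. test_approximable g \<and> (LINT p|lborel. (f p - g p)\<^sup>2) < e"
    using sL by blast
qed


lemma AE_0_if_integral_sq_0:
  assumes "g \<in> L2" "(LINT p|lborel. (g p)\<^sup>2) = 0"
  shows "AE p in lborel. g p = 0"
proof -
  have "AE p in lborel. (g p)\<^sup>2 = 0"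
    using assms integral_nonneg_eq_0_iff_AE[OF L2_integrable_sq[OF assms(1)]] by auto
  then show ?thesis by eventually_elim simp
qed

text \<open>The fundamental lemma of the calculus of variations for \<open>L\<^sup>2\<close>: if \<open>\<phi>\<close> is close to \<open>g\<close>, then
\<open>\<parallel>g\<parallel>\<^sup>2 = \<langle>g, g - \<phi>\<rangle> \<le> \<parallel>g\<parallel> \<parallel>g - \<phi>\<parallel>\<close>.\<close>

lemma L2_orthogonal_test_functions_AE_0:
  assumes g: "g \<in> L2" and orth: "\<And>\<phi>. \<phi> \<in> test_functions UNIV \<Longrightarrow> (LINT p|lborel. g p * \<phi> p) = 0"
  shows "AE p in lborel. g p = 0"
proof (rule AE_0_if_integral_sq_0[OF g])
  let ?G = "LINT p|lborel. (g p)\<^sup>2"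
  have "?G \<le> 0 + e" if e: "e > 0" for e
  proof -
    obtain \<phi> where \<phi>: "\<phi> \<in> test_functions UNIV" "(LINT p|lborel. (g p - \<phi> p)\<^sup>2) < e"
      using test_approximableE[OF test_functions_dense_L2[OF g] e] .
    have d: "(\<lambda>p. g p - \<phi> p) \<in> L2" by (intro L2_diff g test_functions_L2[OF \<phi>(1)])
    have "?G = (LINT p|lborel. g p * (g p - \<phi> p) + g p * \<phi> p)"
      by (intro Bochner_Integration.integral_cong) (simp_all add: algebra_simps power2_eq_square)
    also have "\<dots> = (LINT p|lborel. g p * (g p - \<phi> p))"
      using orth[OF \<phi>(1)] L2_integrable_mult[OF g d] L2_integrable_mult[OF g test_functions_L2[OF \<phi>(1)]]
      by (subst Bochner_Integration.integral_add) simp_all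
    also have "\<dots> \<le> (LINT p|lborel. \<bar>g p * (g p - \<phi> p)\<bar>)"
      using L2_integrable_mult[OF g d] by (intro integral_mono) auto
    finally have "?G\<^sup>2 \<le> (LINT p|lborel. \<bar>g p * (g p - \<phi> p)\<bar>)\<^sup>2"
      by (intro power_mono) auto
    also have "\<dots> \<le> ?G * (LINT p|lborel. (g p - \<phi> p)\<^sup>2)"
      by (rule Cauchy_Schwarz_L2[OF g d])
    also have "\<dots> \<le> ?G * e" using \<phi>(2) by (intro mult_left_mono) auto
    finally have "?G * ?G \<le> ?G * e" by (simp add: power2_eq_square)
    moreover have "?G \<ge> 0" by simp
    ultimately have "?G = 0 \<or> ?G \<le> e" by (metis mult_left_le_imp_le order_le_less)
    then show ?thesis using e by linarith
  qed
  then have "?G \<le> 0" by (rule field_le_epsilon)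
  then show "?G = 0" by (simp add: antisym)
qed

section \<open>Measure-preserving maps and translations\<close>

definition lborel_preserving :: "('a::euclidean_space \<Rightarrow> 'a) \<Rightarrow> bool" where
  "lborel_preserving S \<longleftrightarrow> S \<in> borel \<rightarrow>\<^sub>M borel \<and> distr lborel borel S = lborel"

lemma lborel_preserving_integral:
  fixes f :: "'a::euclidean_space \<Rightarrow> real"
  assumes "lborel_preserving S" "f \<in> borel_measurable borel"
  shows "(LINT p|lborel. f (S p)) = (LINT p|lborel. f p)"
  using assms integral_distr[of S lborel borel f] by (simp add: lborel_preserving_def)

lemma lborel_preserving_integrable:
  fixes f :: "'a::euclidean_space \<Rightarrow> real"
  assumes "lborel_preserving S" "f \<in> borel_measurable borel"
  shows "integrable lborel (\<lambda>p. f (S p)) \<longleftrightarrow> integrable lborel f"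
  using assms integrable_distr_eq[of S lborel borel f] by (simp add: lborel_preserving_def)

lemma lborel_preserving_L2:
  assumes S: "lborel_preserving S" and f: "f \<in> L2"
  shows "(\<lambda>p. f (S p)) \<in> L2"
proof (rule L2_I)
  note [measurable] = L2_borel_measurable[OF f]
  have [measurable]: "S \<in> borel \<rightarrow>\<^sub>M borel" using S by (simp add: lborel_preserving_def)
  show "(\<lambda>p. f (S p)) \<in> borel_measurable borel" by measurable
  show "integrable lborel (\<lambda>p. (f (S p))\<^sup>2)"
    using lborel_preserving_integrable[OF S, of "\<lambda>p. (f p)\<^sup>2"] L2_integrable_sq[OF f] by simp
qed

lemma lborel_preserving_plus: "lborel_preserving (\<lambda>p. p + h)"
  using lborel_distr_plus[of h] by (simp add: lborel_preserving_def add.commute[of _ h])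

text \<open>For a test function this is uniform continuity.  In general, replace \<open>f\<close> by a test function
\<open>\<phi>\<close> near it; the error is the same before and after translation.\<close>

theorem L2_translation_continuous:
  fixes f :: "'a::euclidean_space \<Rightarrow> real"
  assumes f: "f \<in> L2"
  shows "((\<lambda>h. LINT p|lborel. (f (p + h) - f p)\<^sup>2) \<longlongrightarrow> 0) (nhds 0)"
proof (rule tendstoI)
  fix e :: real assume e: "e > 0"
  obtain \<phi> where \<phi>: "\<phi> \<in> test_functions UNIV" "(LINT p|lborel. (f p - \<phi> p)\<^sup>2) < e/24"
    using test_approximableE[OF test_functions_dense_L2[OF f], of "e/24"] e by auto
  obtain K where K: "smooth \<phi>" "compact K" "\<forall>p. p \<notin> K \<longrightarrow> \<phi> p = 0"
    using \<phi>(1) by (rule test_functionsE)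
  note cont = smooth_continuous_on[OF K(1)]
  obtain K' where K': "compact K'" "\<And>p h. norm h \<le> 1 \<Longrightarrow> p + h \<in> K \<Longrightarrow> p \<in> K'"
    using compact_thicken[OF K(2)] by blast
  define m where "m = measure lborel K'"
  have m: "m \<ge> 0" by (simp add: m_def)
  \<comment> \<open>Chosen so that a function bounded by \<open>\<eta>\<close> on the thickened support contributes at most \<open>e / 24\<close>.\<close>
  define \<eta> where "\<eta> = sqrt (e / (24 * (m + 1)))"
  have \<eta>: "\<eta> > 0" "\<eta>\<^sup>2 * m < e / 12"
  proof -
    have "\<eta>\<^sup>2 * m = e * m / (24 * (m + 1))" using e m by (simp add: \<eta>_def)
    also have "\<dots> \<le> e / 24" using e m by (simp add: field_simps)
    finally show "\<eta>\<^sup>2 * m < e / 12" using e by simp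
  qed (use e m in \<open>simp add: \<eta>_def\<close>)
  obtain d where d: "d > 0" "\<And>p h. norm h < d \<Longrightarrow> \<bar>\<phi> (p + h) - \<phi> p\<bar> < \<eta>"
    by (rule continuous_compact_support_uniform[OF cont K(2) _ \<eta>(1)]) (use K(3) in auto)
  have "(LINT p|lborel. (f (p + h) - f p)\<^sup>2) < e" if h: "norm h < min d 1" for h
  proof -
    note S = lborel_preserving_plus[of h]
    let ?\<tau> = "\<lambda>g p. g (p + h) :: real"
    have L: "f \<in> L2" "\<phi> \<in> L2" "?\<tau> f \<in> L2" "?\<tau> \<phi> \<in> L2" "(\<lambda>p. f p - \<phi> p) \<in> L2"
      using f test_functions_L2[OF \<phi>(1)] lborel_preserving_L2[OF S] by (auto intro: L2_diff)
    have "(LINT p|lborel. (\<phi> (p + h) - \<phi> p)\<^sup>2) \<le> (LINT p|lborel. \<eta>\<^sup>2 * indicator K' p)"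
    proof (rule integral_mono)
      show "integrable lborel (\<lambda>p. (\<phi> (p + h) - \<phi> p)\<^sup>2)" by (intro L2_integrable_sq L2_diff L)
      show "integrable lborel (\<lambda>p. \<eta>\<^sup>2 * indicator K' p :: real)"
        using K'(1) emeasure_bounded_finite[OF compact_imp_bounded[OF K'(1)]]
        by (intro integrable_mult_right integrable_real_indicator) (auto intro: borel_compact)
      show "(\<phi> (p + h) - \<phi> p)\<^sup>2 \<le> \<eta>\<^sup>2 * indicator K' p" for p
      proof (cases "p \<in> K'")
        case True
        have "\<bar>\<phi> (p + h) - \<phi> p\<bar>\<^sup>2 \<le> \<eta>\<^sup>2" using d(2)[of h p] h by (intro power_mono) auto
        with True show ?thesis by simp
      next
        case False
        then have "p + h \<notin> K" "p \<notin> K" using K'(2)[of h p] K'(2)[of 0 p] h by auto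
        then show ?thesis using K(3) by simp
      qed
    qed
    also have "\<dots> < e / 12" using \<eta>(2) K'(1) by (simp add: m_def borel_compact)
    finally have 1: "(LINT p|lborel. (\<phi> (p + h) - \<phi> p)\<^sup>2) < e / 12" .
    have 2: "(LINT p|lborel. (f (p + h) - \<phi> (p + h))\<^sup>2) = (LINT p|lborel. (f p - \<phi> p)\<^sup>2)"
      using lborel_preserving_integral[OF S, of "\<lambda>p. (f p - \<phi> p)\<^sup>2"] L2_borel_measurable[OF L(5)] by simp
    have 3: "(LINT p|lborel. (\<phi> p - f p)\<^sup>2) = (LINT p|lborel. (f p - \<phi> p)\<^sup>2)"
      by (simp add: power2_commute)
    have "(LINT p|lborel. ((\<phi> (p + h) - \<phi> p) + (\<phi> p - f p))\<^sup>2)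
      \<le> 2 * (LINT p|lborel. (\<phi> (p + h) - \<phi> p)\<^sup>2) + 2 * (LINT p|lborel. (\<phi> p - f p)\<^sup>2)"
      by (intro L2_sq_add_le L2_diff L)
    with 1 3 \<phi>(2) have 4: "(LINT p|lborel. (\<phi> (p + h) - f p)\<^sup>2) < e / 4" by simp
    have "(LINT p|lborel. ((f (p + h) - \<phi> (p + h)) + (\<phi> (p + h) - f p))\<^sup>2)
      \<le> 2 * (LINT p|lborel. (f (p + h) - \<phi> (p + h))\<^sup>2) + 2 * (LINT p|lborel. (\<phi> (p + h) - f p)\<^sup>2)"
      by (intro L2_sq_add_le L2_diff L)
    then show ?thesis using 2 4 \<phi>(2) e by simp
  qed
  then show "\<forall>\<^sub>F h in nhds 0. dist (LINT p|lborel. (f (p + h) - f p)\<^sup>2) 0 < e"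
    unfolding eventually_nhds_metric using d(1)
    by (intro exI[of _ "min d 1"]) (auto simp: dist_real_def)
qed

section \<open>Weak derivatives\<close>

lemma has_weak_deriv_unique:
  assumes "has_weak_deriv v f g" "has_weak_deriv v f h" "g \<in> L2" "h \<in> L2"
  shows "AE p in lborel. g p = h p"
proof -
  have "AE p in lborel. g p - h p = 0"
  proof (rule L2_orthogonal_test_functions_AE_0[OF L2_diff[OF assms(3,4)]])
    fix \<phi> :: "'a \<Rightarrow> real" assume \<phi>: "\<phi> \<in> test_functions UNIV"
    have "(LINT p|lborel. g p * \<phi> p) = (LINT p|lborel. h p * \<phi> p)"
      using assms(1,2) \<phi> unfolding has_weak_deriv_def by fastforce
    then show "(LINT p|lborel. (g p - h p) * \<phi> p) = 0"
      using L2_integrable_mult[OF assms(3) test_functions_L2[OF \<phi>]] L2_integrable_mult[OF assms(4) test_functions_L2[OF \<phi>]]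
      by (simp add: left_diff_distrib)
  qed
  then show ?thesis by eventually_elim simp
qed

lemma H1_L2: "f \<in> H1 \<Longrightarrow> f \<in> L2"
  by (simp add: H1_def)

lemma wderiv_H1:
  assumes "f \<in> H1" "b \<in> Basis"
  shows "wderiv b f \<in> L2" "has_weak_deriv b f (wderiv b f)"
proof -
  have "\<exists>g. g \<in> L2 \<and> has_weak_deriv b f g" using assms by (auto simp: H1_def)
  from someI_ex[OF this] show "wderiv b f \<in> L2" "has_weak_deriv b f (wderiv b f)"
    by (auto simp: wderiv_def)
qed

lemma has_weak_deriv_wderiv_eq:
  assumes "f \<in> H1" "b \<in> Basis" "g \<in> L2" "has_weak_deriv b f g"
  shows "AE p in lborel. wderiv b f p = g p"
  using has_weak_deriv_unique[OF wderiv_H1(2)[OF assms(1,2)] assms(4) wderiv_H1(1)[OF assms(1,2)] assms(3)] .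

lemma has_weak_deriv_diff:
  assumes "has_weak_deriv v f f'" "has_weak_deriv v g g'" "f \<in> L2" "f' \<in> L2" "g \<in> L2" "g' \<in> L2"
  shows "has_weak_deriv v (\<lambda>p. f p - g p) (\<lambda>p. f' p - g' p)"
  unfolding has_weak_deriv_def
proof
  fix \<phi> :: "'a \<Rightarrow> real" assume \<phi>: "\<phi> \<in> test_functions UNIV"
  note L = test_functions_L2[OF \<phi>] test_functions_L2[OF test_functions_dderiv[OF \<phi>]]
  have "(LINT p|lborel. (f p - g p) * dderiv v \<phi> p) = (LINT p|lborel. f p * dderiv v \<phi> p) - (LINT p|lborel. g p * dderiv v \<phi> p)"
    using L2_integrable_mult[OF assms(3) L(2)[of v]] L2_integrable_mult[OF assms(5) L(2)[of v]]
    by (simp add: left_diff_distrib)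
  also have "\<dots> = - (LINT p|lborel. f' p * \<phi> p) + (LINT p|lborel. g' p * \<phi> p)"
    using assms(1,2) \<phi> by (simp add: has_weak_deriv_def)
  also have "\<dots> = - (LINT p|lborel. (f' p - g' p) * \<phi> p)"
    using L2_integrable_mult[OF assms(4) L(1)] L2_integrable_mult[OF assms(6) L(1)]
    by (simp add: left_diff_distrib)
  finally show "(LINT p|lborel. (f p - g p) * dderiv v \<phi> p) = - (LINT p|lborel. (f' p - g' p) * \<phi> p)" .
qed

lemma H1_diff:
  assumes "f \<in> H1" "g \<in> H1"
  shows "(\<lambda>p. f p - g p) \<in> H1"
proof -
  have "\<exists>h\<in>L2. has_weak_deriv b (\<lambda>p. f p - g p) h" if "b \<in> Basis" for b
    using has_weak_deriv_diff[OF wderiv_H1(2)[OF assms(1) that] wderiv_H1(2)[OF assms(2) that]]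
      L2_diff[OF wderiv_H1(1)[OF assms(1) that] wderiv_H1(1)[OF assms(2) that]]
      wderiv_H1(1)[OF assms(1) that] wderiv_H1(1)[OF assms(2) that] H1_L2[OF assms(1)] H1_L2[OF assms(2)]
    by (intro bexI)
  then show ?thesis using assms by (auto simp: H1_def intro: L2_diff)
qed

text \<open>The representatives of weak derivatives are chosen arbitrarily, so linearity holds only almost
everywhere, and only because weak derivatives are unique.\<close>

lemma integral_sq_wderiv_diff:
  assumes "f \<in> H1" "g \<in> H1" "b \<in> Basis"
  shows "(LINT p|lborel. (wderiv b (\<lambda>p. f p - g p) p)\<^sup>2) = (LINT p|lborel. (wderiv b f p - wderiv b g p)\<^sup>2)"
proof -
  note w = wderiv_H1[OF assms(1,3)] wderiv_H1[OF assms(2,3)]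
  have "AE p in lborel. wderiv b (\<lambda>p. f p - g p) p = wderiv b f p - wderiv b g p"
    by (rule has_weak_deriv_wderiv_eq)
       (use assms w H1_L2 in \<open>auto intro!: H1_diff L2_diff has_weak_deriv_diff\<close>)
  then have ae: "AE p in lborel. (wderiv b (\<lambda>p. f p - g p) p)\<^sup>2 = (wderiv b f p - wderiv b g p)\<^sup>2"
    by eventually_elim simp
  note [measurable] = L2_borel_measurable[OF wderiv_H1(1)[OF H1_diff[OF assms(1,2)] assms(3)]]
     L2_borel_measurable[OF w(1)] L2_borel_measurable[OF w(3)]
  show ?thesis by (rule integral_cong_AE) (use ae in auto)
qed

subsection \<open>Convergence in \<open>L\<^sup>2\<close> and in \<open>H\<^sup>1\<close>\<close>

definition L2_conv :: "('b \<Rightarrow> 'a::euclidean_space \<Rightarrow> real) \<Rightarrow> ('a \<Rightarrow> real) \<Rightarrow> 'b filter \<Rightarrow> bool" where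
  "L2_conv f g F \<longleftrightarrow> g \<in> L2 \<and> (\<forall>\<^sub>F s in F. f s \<in> L2) \<and>
     ((\<lambda>s. LINT p|lborel. (f s p - g p)\<^sup>2) \<longlongrightarrow> 0) F"

text \<open>Continuity into \<open>H\<^sup>1\<close>, in the form in which the limit arguments consume it: the function and the
chosen representative of each weak derivative converge in \<open>L\<^sup>2\<close> separately.\<close>

lemma C_H1_conv:
  assumes u: "u \<in> C_H1 I" and t: "t \<in> I"
  shows "L2_conv u (u t) (at t within I)"
    and "b \<in> Basis \<Longrightarrow> L2_conv (\<lambda>s. wderiv b (u s)) (wderiv b (u t)) (at t within I)"
proof -
  have H: "s \<in> I \<Longrightarrow> u s \<in> H1" for s using u by (simp add: C_H1_def)
  have ev: "\<forall>\<^sub>F s in at t within I. s \<in> I" by (simp add: eventually_at_filter)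
  let ?N = "\<lambda>s. (LINT p|lborel. (u s p - u t p)\<^sup>2) + (\<Sum>b\<in>Basis. LINT p|lborel. (wderiv b (\<lambda>p. u s p - u t p) p)\<^sup>2)"
  have N0: "0 \<le> ?N s" for s by (intro add_nonneg_nonneg sum_nonneg) auto
  have "((\<lambda>s. H1_norm (\<lambda>p. u s p - u t p)) \<longlongrightarrow> 0) (at t within I)"
    using u t by (simp add: C_H1_def)
  from tendsto_power[OF this, of 2] have N: "(?N \<longlongrightarrow> 0) (at t within I)"
    using N0 by (simp add: H1_norm_def)
  have "((\<lambda>s. LINT p|lborel. (u s p - u t p)\<^sup>2) \<longlongrightarrow> 0) (at t within I)"
    by (rule tendsto_sandwich[OF _ _ tendsto_const N]) (auto intro!: always_eventually sum_nonneg)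
  then show "L2_conv u (u t) (at t within I)"
    unfolding L2_conv_def using eventually_mono[OF ev, of "\<lambda>s. u s \<in> L2"] H t by (auto intro: H1_L2)
  assume b: "b \<in> Basis"
  have *: "(LINT p|lborel. (wderiv b (u s) p - wderiv b (u t) p)\<^sup>2) \<le> ?N s" if "s \<in> I" for s
  proof -
    have "(LINT p|lborel. (wderiv b (u s) p - wderiv b (u t) p)\<^sup>2) = (LINT p|lborel. (wderiv b (\<lambda>p. u s p - u t p) p)\<^sup>2)"
      using integral_sq_wderiv_diff[OF H[OF that] H[OF t] b] by simp
    also have "\<dots> \<le> (\<Sum>b\<in>Basis. LINT p|lborel. (wderiv b (\<lambda>p. u s p - u t p) p)\<^sup>2)"
      using b by (intro member_le_sum) auto
    also have "\<dots> \<le> ?N s" by simp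
    finally show ?thesis .
  qed
  have "((\<lambda>s. LINT p|lborel. (wderiv b (u s) p - wderiv b (u t) p)\<^sup>2) \<longlongrightarrow> 0) (at t within I)"
    by (rule tendsto_sandwich[OF _ _ tendsto_const N])
       (use * in \<open>auto intro: eventually_mono[OF ev]\<close>)
  then show "L2_conv (\<lambda>s. wderiv b (u s)) (wderiv b (u t)) (at t within I)"
    unfolding L2_conv_def using eventually_mono[OF ev, of "\<lambda>s. wderiv b (u s) \<in> L2"] wderiv_H1(1)[OF H b] t by auto
qed

section \<open>Pairings with compactly supported functions\<close>

definition pair :: "('a::euclidean_space \<Rightarrow> real) \<Rightarrow> ('a \<Rightarrow> real) \<Rightarrow> real" where
  "pair f \<psi> = (LINT p|lborel. f p * \<psi> p)"

definition locally_integrable :: "('a::euclidean_space \<Rightarrow> real) \<Rightarrow> bool" where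
  "locally_integrable f \<longleftrightarrow> f \<in> borel_measurable borel \<and>
     (\<forall>K. compact K \<longrightarrow> integrable lborel (\<lambda>p. indicator K p * \<bar>f p\<bar>))"

text \<open>The weak formulation is quadratic in \<open>u\<close> and in its derivative.  Local \<open>L\<^sup>1\<close>-convergence covers
linear and quadratic terms alike.\<close>

definition L1loc_conv :: "('b \<Rightarrow> 'a::euclidean_space \<Rightarrow> real) \<Rightarrow> ('a \<Rightarrow> real) \<Rightarrow> 'b filter \<Rightarrow> bool" where
  "L1loc_conv f g F \<longleftrightarrow> locally_integrable g \<and> (\<forall>\<^sub>F s in F. locally_integrable (f s)) \<and>
     (\<forall>K. compact K \<longrightarrow> ((\<lambda>s. LINT p|lborel. indicator K p * \<bar>f s p - g p\<bar>) \<longlongrightarrow> 0) F)"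

lemma indicator_compact_L2: "compact K \<Longrightarrow> indicat_real K \<in> L2"
  using emeasure_bounded_finite[OF compact_imp_bounded[of K]]
  by (intro indicator_L2) (auto intro: borel_compact)

lemma locally_integrable_L2: "f \<in> L2 \<Longrightarrow> locally_integrable f"
  unfolding locally_integrable_def
proof (intro conjI allI impI)
  fix K :: "'a set" assume f: "f \<in> L2" and "compact K"
  from integrable_abs[OF L2_integrable_mult[OF indicator_compact_L2[OF this(2)] f]]
  show "integrable lborel (\<lambda>p. indicator K p * \<bar>f p\<bar>)" by (simp add: abs_mult)
qed (rule L2_borel_measurable)

lemma locally_integrable_integrable: 
  assumes "integrable lborel f"
  shows "locally_integrable f"
  unfolding locally_integrable_def
proof (intro conjI allI impI)
  show "f \<in> borel_measurable borel" using borel_measurable_integrable[OF assms] by simp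
  fix K :: "'a set" assume "compact K"
  then have "K \<in> sets lborel" by (simp add: borel_compact)
  from integrable_mult_indicator[OF this integrable_abs[OF assms]]
  show "integrable lborel (\<lambda>p. indicator K p * \<bar>f p\<bar>)" by simp
qed

lemma L2_conv_L1loc_conv:
  fixes g :: "'a::euclidean_space \<Rightarrow> real"
  assumes "L2_conv f g F"
  shows "L1loc_conv f g F"
  unfolding L1loc_conv_def
proof (intro conjI allI impI)
  from assms have g: "g \<in> L2" and f: "\<forall>\<^sub>F s in F. f s \<in> L2"
    and lim: "((\<lambda>s. LINT p|lborel. (f s p - g p)\<^sup>2) \<longlongrightarrow> 0) F" by (auto simp: L2_conv_def)
  show "locally_integrable g" using g by (rule locally_integrable_L2)
  show "\<forall>\<^sub>F s in F. locally_integrable (f s)" using f by eventually_elim (rule locally_integrable_L2)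
  fix K :: "'a set" assume K: "compact K"
  let ?m = "LINT p|lborel. (indicat_real K p)\<^sup>2"
  have "((\<lambda>s. sqrt (?m * (LINT p|lborel. (f s p - g p)\<^sup>2))) \<longlongrightarrow> sqrt (?m * 0)) F"
    by (intro tendsto_intros lim)
  then have lim': "((\<lambda>s. sqrt (?m * (LINT p|lborel. (f s p - g p)\<^sup>2))) \<longlongrightarrow> 0) F" by simp
  show "((\<lambda>s. LINT p|lborel. indicator K p * \<bar>f s p - g p\<bar>) \<longlongrightarrow> 0) F"
  proof (rule tendsto_sandwich[OF _ _ tendsto_const lim'])
    show "\<forall>\<^sub>F s in F. (LINT p|lborel. indicator K p * \<bar>f s p - g p\<bar>) \<le> sqrt (?m * (LINT p|lborel. (f s p - g p)\<^sup>2))"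
      using f
    proof eventually_elim
      case (elim s)
      show ?case
        using Cauchy_Schwarz_L2[OF indicator_compact_L2[OF K] L2_diff[OF elim g]]
        by (intro real_le_rsqrt) (simp add: abs_mult)
    qed
  qed (auto intro!: always_eventually integral_nonneg_AE)
qed

text \<open>With \<open>d = f - g\<close> one has \<open>f\<^sup>2 - g\<^sup>2 = d\<^sup>2 + 2 g d\<close>, and the mixed term is bounded by the
Cauchy-Schwarz inequality.\<close>

lemma L2_conv_sq_L1loc_conv:
  fixes g :: "'a::euclidean_space \<Rightarrow> real"
  assumes "L2_conv f g F"
  shows "L1loc_conv (\<lambda>s p. (f s p)\<^sup>2) (\<lambda>p. (g p)\<^sup>2) F"
  unfolding L1loc_conv_def
proof (intro conjI allI impI)
  from assms have g: "g \<in> L2" and f: "\<forall>\<^sub>F s in F. f s \<in> L2"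
    and lim: "((\<lambda>s. LINT p|lborel. (f s p - g p)\<^sup>2) \<longlongrightarrow> 0) F" by (auto simp: L2_conv_def)
  show "locally_integrable (\<lambda>p. (g p)\<^sup>2)"
    using g by (intro locally_integrable_integrable L2_integrable_sq)
  show "\<forall>\<^sub>F s in F. locally_integrable (\<lambda>p. (f s p)\<^sup>2)"
    using f by eventually_elim (intro locally_integrable_integrable L2_integrable_sq)
  fix K :: "'a set" assume K: "compact K"
  let ?d = "\<lambda>s. LINT p|lborel. (f s p - g p)\<^sup>2" and ?G = "LINT p|lborel. (g p)\<^sup>2"
  have "((\<lambda>s. ?d s + 2 * sqrt (?G * ?d s)) \<longlongrightarrow> 0 + 2 * sqrt (?G * 0)) F"
    by (intro tendsto_intros lim)
  then have lim': "((\<lambda>s. ?d s + 2 * sqrt (?G * ?d s)) \<longlongrightarrow> 0) F" by simp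
  show "((\<lambda>s. LINT p|lborel. indicator K p * \<bar>(f s p)\<^sup>2 - (g p)\<^sup>2\<bar>) \<longlongrightarrow> 0) F"
  proof (rule tendsto_sandwich[OF _ _ tendsto_const lim'])
    show "\<forall>\<^sub>F s in F. (LINT p|lborel. indicator K p * \<bar>(f s p)\<^sup>2 - (g p)\<^sup>2\<bar>) \<le> ?d s + 2 * sqrt (?G * ?d s)"
      using f
    proof eventually_elim
      case (elim s)
      note d = L2_diff[OF elim g]
      have i: "integrable lborel (\<lambda>p. (f s p - g p)\<^sup>2)" "integrable lborel (\<lambda>p. \<bar>g p * (f s p - g p)\<bar>)"
        "integrable lborel (\<lambda>p. (f s p)\<^sup>2 - (g p)\<^sup>2)"
        using L2_integrable_sq[OF d] L2_integrable_mult[OF g d] L2_integrable_sq[OF elim] L2_integrable_sq[OF g]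
        by auto
      have "(LINT p|lborel. indicator K p * \<bar>(f s p)\<^sup>2 - (g p)\<^sup>2\<bar>)
        \<le> (LINT p|lborel. (f s p - g p)\<^sup>2 + 2 * \<bar>g p * (f s p - g p)\<bar>)"
      proof (rule integral_mono)
        show "integrable lborel (\<lambda>p. indicator K p * \<bar>(f s p)\<^sup>2 - (g p)\<^sup>2\<bar>)"
          using locally_integrable_integrable[OF i(3)] K by (simp add: locally_integrable_def)
        show "integrable lborel (\<lambda>p. (f s p - g p)\<^sup>2 + 2 * \<bar>g p * (f s p - g p)\<bar>)"
          using i by auto
        fix p
        have "(f s p)\<^sup>2 - (g p)\<^sup>2 = (f s p - g p)\<^sup>2 + 2 * (g p * (f s p - g p))"
          by (simp add: power2_eq_square algebra_simps)
        then have "\<bar>(f s p)\<^sup>2 - (g p)\<^sup>2\<bar> \<le> (f s p - g p)\<^sup>2 + 2 * \<bar>g p * (f s p - g p)\<bar>"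
          using zero_le_power2[of "f s p - g p"] by linarith
        then show "indicator K p * \<bar>(f s p)\<^sup>2 - (g p)\<^sup>2\<bar> \<le> (f s p - g p)\<^sup>2 + 2 * \<bar>g p * (f s p - g p)\<bar>"
          by (cases "p \<in> K") (auto intro: add_nonneg_nonneg)
      qed
      also have "\<dots> = ?d s + 2 * (LINT p|lborel. \<bar>g p * (f s p - g p)\<bar>)"
        using i by simp
      also have "(LINT p|lborel. \<bar>g p * (f s p - g p)\<bar>) \<le> sqrt (?G * ?d s)"
        using Cauchy_Schwarz_L2[OF g d] by (rule real_le_rsqrt)
      finally show ?case by simp
    qed
  qed (auto intro!: always_eventually integral_nonneg_AE)
qed

lemma pair_integrable:
  assumes f: "locally_integrable f" and \<psi>: "continuous_on UNIV \<psi>" "compact K" "\<And>p. p \<notin> K \<Longrightarrow> \<psi> p = 0"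
  shows "integrable lborel (\<lambda>p. f p * \<psi> p)"
proof -
  obtain B where B: "B > 0" "\<And>p. \<bar>\<psi> p\<bar> \<le> B"
    by (rule continuous_compact_support_bounded[OF \<psi>(1,2)]) (use \<psi>(3) in auto)
  have [measurable]: "f \<in> borel_measurable borel" "\<psi> \<in> borel_measurable borel"
    using f \<psi>(1) by (auto simp: locally_integrable_def intro: borel_measurable_continuous_onI)
  have "integrable lborel (\<lambda>p. B * (indicator K p * \<bar>f p\<bar>))"
    using f \<psi>(2) by (simp add: locally_integrable_def)
  then show ?thesis
  proof (rule Bochner_Integration.integrable_bound)
    show "AE p in lborel. norm (f p * \<psi> p) \<le> norm (B * (indicator K p * \<bar>f p\<bar>))"
    proof (rule AE_I2)
      fix p
      show "norm (f p * \<psi> p) \<le> norm (B * (indicator K p * \<bar>f p\<bar>))"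
        using B(1) mult_left_mono[OF B(2)[of p] abs_ge_zero[of "f p"]] \<psi>(3)[of p]
        by (cases "p \<in> K") (auto simp: abs_mult mult.commute)
    qed
  qed measurable
qed

text \<open>The pairing is jointly continuous for local \<open>L\<^sup>1\<close>-convergence on the left and uniform convergence with
a common compact support on the right, by \<open>f \<Psi> - g \<psi> = (f - g) \<Psi> + g (\<Psi> - \<psi>)\<close>.\<close>

lemma pair_tendsto:
  assumes f: "L1loc_conv f g F" and K: "compact K"
    and \<Psi>: "\<forall>\<^sub>F s in F. continuous_on UNIV (\<Psi> s) \<and> (\<forall>p. p \<notin> K \<longrightarrow> \<Psi> s p = 0)"
    and \<psi>: "continuous_on UNIV \<psi>" "\<And>p. p \<notin> K \<Longrightarrow> \<psi> p = 0"
    and lim: "uniform_limit UNIV \<Psi> \<psi> F"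
  shows "((\<lambda>s. pair (f s) (\<Psi> s)) \<longlongrightarrow> pair g \<psi>) F"
proof (rule tendstoI)
  fix e :: real assume e: "e > 0"
  have g: "locally_integrable g" and fl: "\<forall>\<^sub>F s in F. locally_integrable (f s)"
    and f0: "((\<lambda>s. LINT p|lborel. indicator K p * \<bar>f s p - g p\<bar>) \<longlongrightarrow> 0) F"
    using f K by (auto simp: L1loc_conv_def)
  obtain B where B: "B > 0" "\<And>p. \<bar>\<psi> p\<bar> \<le> B"
    by (rule continuous_compact_support_bounded[OF \<psi>(1) K]) (use \<psi>(2) in auto)
  define M where "M = (LINT p|lborel. indicator K p * \<bar>g p\<bar>)"
  have M: "M \<ge> 0" by (auto simp: M_def intro!: integral_nonneg_AE)
  define \<eta> where "\<eta> = min 1 (e / (2 * (M + 1)))"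
  have \<eta>: "0 < \<eta>" "\<eta> \<le> 1" "\<eta> * M \<le> e / 2"
  proof -
    show "0 < \<eta>" "\<eta> \<le> 1" using e M by (auto simp: \<eta>_def)
    have "\<eta> * M \<le> e / (2 * (M + 1)) * (M + 1)"
      using e M by (intro mult_mono) (auto simp: \<eta>_def)
    also have "\<dots> = e / 2" using M by (simp add: field_simps)
    finally show "\<eta> * M \<le> e / 2" .
  qed
  have "\<forall>\<^sub>F s in F. \<forall>p\<in>UNIV. dist (\<Psi> s p) (\<psi> p) < \<eta>"
    using uniform_limitD[OF lim \<eta>(1)] .
  moreover have "e / (2 * (B + 1)) > 0" using e B(1) by simp
  then have "\<forall>\<^sub>F s in F. (LINT p|lborel. indicator K p * \<bar>f s p - g p\<bar>) < e / (2 * (B + 1))"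
    using order_tendstoD(2)[OF f0] by blast
  ultimately show "\<forall>\<^sub>F s in F. dist (pair (f s) (\<Psi> s)) (pair g \<psi>) < e"
    using \<Psi> fl
  proof eventually_elim
    case (elim s)
    have \<Psi>s: "continuous_on UNIV (\<Psi> s)" "\<And>p. p \<notin> K \<Longrightarrow> \<Psi> s p = 0" using elim(3) by auto
    have i: "integrable lborel (\<lambda>p. f s p * \<Psi> s p)" "integrable lborel (\<lambda>p. g p * \<psi> p)"
      using pair_integrable[OF elim(4) \<Psi>s(1) K \<Psi>s(2)] pair_integrable[OF g \<psi>(1) K \<psi>(2)] by auto
    have i2: "integrable lborel (\<lambda>p. indicator K p * \<bar>g p\<bar>)" using g K by (simp add: locally_integrable_def)
    have [measurable]: "K \<in> sets borel" "f s \<in> borel_measurable borel" "g \<in> borel_measurable borel"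
      using K elim(4) g by (auto simp: locally_integrable_def borel_compact)
    have i3: "integrable lborel (\<lambda>p. indicator K p * \<bar>f s p - g p\<bar>)"
    proof (rule Bochner_Integration.integrable_bound)
      show "integrable lborel (\<lambda>p. indicator K p * \<bar>f s p\<bar> + indicator K p * \<bar>g p\<bar>)"
        using elim(4) g K by (auto simp: locally_integrable_def)
      show "AE p in lborel. norm (indicator K p * \<bar>f s p - g p\<bar>) \<le> norm (indicator K p * \<bar>f s p\<bar> + indicator K p * \<bar>g p\<bar>)"
        by (rule AE_I2) (simp add: indicator_def abs_triangle_ineq4)
    qed measurable
    have "\<bar>pair (f s) (\<Psi> s) - pair g \<psi>\<bar> = \<bar>LINT p|lborel. f s p * \<Psi> s p - g p * \<psi> p\<bar>"
      using i by (simp add: pair_def)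
    also have "\<dots> \<le> (LINT p|lborel. \<bar>f s p * \<Psi> s p - g p * \<psi> p\<bar>)"
      by (rule integral_abs_bound)
    also have "\<dots> \<le> (LINT p|lborel. (B + 1) * (indicator K p * \<bar>f s p - g p\<bar>) + \<eta> * (indicator K p * \<bar>g p\<bar>))"
    proof (rule integral_mono)
      show "integrable lborel (\<lambda>p. \<bar>f s p * \<Psi> s p - g p * \<psi> p\<bar>)" using i by auto
      show "integrable lborel (\<lambda>p. (B + 1) * (indicator K p * \<bar>f s p - g p\<bar>) + \<eta> * (indicator K p * \<bar>g p\<bar>))"
        using i2 i3 by auto
      fix p
      show "\<bar>f s p * \<Psi> s p - g p * \<psi> p\<bar> \<le> (B + 1) * (indicator K p * \<bar>f s p - g p\<bar>) + \<eta> * (indicator K p * \<bar>g p\<bar>)"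
      proof (cases "p \<in> K")
        case True
        have d: "\<bar>\<Psi> s p - \<psi> p\<bar> \<le> \<eta>" using elim(1) by (auto simp: dist_real_def intro: less_imp_le)
        have "\<bar>f s p * \<Psi> s p - g p * \<psi> p\<bar> = \<bar>(f s p - g p) * \<Psi> s p + g p * (\<Psi> s p - \<psi> p)\<bar>"
          by (simp add: algebra_simps)
        also have "\<dots> \<le> \<bar>f s p - g p\<bar> * \<bar>\<Psi> s p\<bar> + \<bar>g p\<bar> * \<bar>\<Psi> s p - \<psi> p\<bar>"
          by (simp add: abs_mult[symmetric] abs_triangle_ineq)
        also have "\<dots> \<le> \<bar>f s p - g p\<bar> * (B + 1) + \<bar>g p\<bar> * \<eta>"
          using d B(2)[of p] \<eta>(2) by (intro add_mono mult_left_mono) auto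
        finally show ?thesis using True by (simp add: mult.commute)
      next
        case False
        then show ?thesis using \<Psi>s(2)[of p] \<psi>(2)[of p] by simp
      qed
    qed
    also have "\<dots> = (B + 1) * (LINT p|lborel. indicator K p * \<bar>f s p - g p\<bar>) + \<eta> * M"
      using i2 i3 by (simp add: M_def)
    also have "\<dots> < (B + 1) * (e / (2 * (B + 1))) + e / 2"
      using elim(2) B(1) \<eta>(3) by (intro add_less_le_mono mult_strict_left_mono) auto
    also have "\<dots> = e" using B(1) by (simp add: field_simps)
    finally show ?case by (simp add: dist_real_def)
  qed
qed

lemma pair_test_tendsto:
  assumes "L1loc_conv f g F" "\<psi> \<in> test_functions X"
  shows "((\<lambda>s. pair (f s) \<psi>) \<longlongrightarrow> pair g \<psi>) F"
proof -
  obtain K where K: "smooth \<psi>" "compact K" "\<forall>p. p \<notin> K \<longrightarrow> \<psi> p = 0"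
    using assms(2) by (rule test_functionsE)
  show ?thesis
    by (rule pair_tendsto[OF assms(1) K(2)])
       (use K in \<open>auto intro!: always_eventually smooth_continuous_on uniform_limit_const\<close>)
qed

text \<open>By the mean value theorem the quotient is a value of the derivative nearby, and the derivative is
uniformly continuous.  The value at \<open>h = 0\<close> is filled in so that \<open>h\<close> can be replaced by any
function that tends to 0, even one that takes the value 0 repeatedly.\<close>

lemma difference_quotient_uniform_limit:
  assumes \<phi>: "smooth \<phi>" "compact K" "\<And>p. p \<notin> K \<Longrightarrow> \<phi> p = 0"
  shows "uniform_limit UNIV (\<lambda>h p. if h = 0 then dderiv v \<phi> p else (\<phi> (p + h *\<^sub>R v) - \<phi> p) / h) (dderiv v \<phi>) (nhds 0)"
proof (rule uniform_limitI)
  fix e :: real assume e: "e > 0"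
  have sup: "\<And>p. p \<notin> K \<Longrightarrow> dderiv v \<phi> p = 0"
    using dderiv_eq_0_outside[OF compact_imp_closed[OF \<phi>(2)]] \<phi>(3) by blast
  obtain d where d: "d > 0" "\<And>p h. norm h < d \<Longrightarrow> \<bar>dderiv v \<phi> (p + h) - dderiv v \<phi> p\<bar> < e"
    by (rule continuous_compact_support_uniform[OF smooth_continuous_on[OF smooth_dderiv[OF \<phi>(1)]] \<phi>(2) sup e], assumption, erule that)
  have "dist (if h = 0 then dderiv v \<phi> p else (\<phi> (p + h *\<^sub>R v) - \<phi> p) / h) (dderiv v \<phi> p) < e"
    if h: "\<bar>h\<bar> < d / (norm v + 1)" for h p
  proof (cases "h = 0")
    case False
    have hv: "norm (\<theta> *\<^sub>R v) < d" if "\<bar>\<theta>\<bar> \<le> \<bar>h\<bar>" for \<theta>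
    proof -
      have "\<bar>\<theta>\<bar> * norm v \<le> \<bar>h\<bar> * (norm v + 1)" using that by (intro mult_mono) auto
      also have "\<dots> < d" using h by (simp add: pos_less_divide_eq add_nonneg_pos)
      finally show ?thesis by simp
    qed
    have der: "((\<lambda>s. \<phi> (p + s *\<^sub>R v)) has_real_derivative dderiv v \<phi> (p + s *\<^sub>R v)) (at s)" for s
      by (rule has_real_derivative_line) (rule smooth_differentiable[OF \<phi>(1)])
    have "\<exists>\<theta>. \<bar>\<theta>\<bar> \<le> \<bar>h\<bar> \<and> \<phi> (p + h *\<^sub>R v) - \<phi> p = h * dderiv v \<phi> (p + \<theta> *\<^sub>R v)"
    proof (cases "h > 0")
      case True
      from MVT2[OF True der] obtain z where "0 < z" "z < h"
        "\<phi> (p + h *\<^sub>R v) - \<phi> (p + 0 *\<^sub>R v) = (h - 0) * dderiv v \<phi> (p + z *\<^sub>R v)" by blast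
      then show ?thesis by (intro exI[of _ z]) auto
    next
      case neg: False
      with False have "h < 0" by simp
      from MVT2[OF this der] obtain z where "h < z" "z < 0" 
        "\<phi> (p + 0 *\<^sub>R v) - \<phi> (p + h *\<^sub>R v) = (0 - h) * dderiv v \<phi> (p + z *\<^sub>R v)" by blast
      then show ?thesis by (intro exI[of _ z]) (auto simp: algebra_simps)
    qed
    then obtain \<theta> where \<theta>: "\<bar>\<theta>\<bar> \<le> \<bar>h\<bar>" "\<phi> (p + h *\<^sub>R v) - \<phi> p = h * dderiv v \<phi> (p + \<theta> *\<^sub>R v)" by blast
    then show ?thesis using d(2)[OF hv[OF \<theta>(1)], of p] False by (simp add: dist_real_def)
  qed (use e in auto)
  note * = this
  have ev: "\<forall>\<^sub>F h in nhds 0. \<bar>h\<bar> < d / (norm v + 1)"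
    unfolding eventually_nhds_metric using d(1)
    by (intro exI[of _ "d / (norm v + 1)"]) (auto simp: dist_real_def add_nonneg_pos)
  show "\<forall>\<^sub>F h in nhds 0. \<forall>p\<in>UNIV. dist (if h = 0 then dderiv v \<phi> p else (\<phi> (p + h *\<^sub>R v) - \<phi> p) / h) (dderiv v \<phi> p) < e"
    by (rule eventually_mono[OF ev], intro ballI, rule *)
qed

section \<open>Reflections and translations in the \<open>x\<close>-variable\<close>

text \<open>For \<open>s = -1\<close> the reflection about the axis \<open>x = a / 2\<close>, for \<open>s = 1\<close> the translation by \<open>a\<close> in \<open>x\<close>.
Both are needed, and they share all their properties through \<open>s\<^sup>2 = 1\<close>.\<close>

definition xaff :: "real \<Rightarrow> real \<Rightarrow> real \<times> real \<Rightarrow> real \<times> real" where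
  "xaff s a p = (a + s * fst p, snd p)"

abbreviation d1 :: "(real \<times> real \<Rightarrow> real) \<Rightarrow> real \<times> real \<Rightarrow> real" where
  "d1 \<equiv> dderiv (1, 0)"

abbreviation d2 :: "(real \<times> real \<Rightarrow> real) \<Rightarrow> real \<times> real \<Rightarrow> real" where
  "d2 \<equiv> dderiv (0, 1)"

lemma Basis_real_prod: "(Basis :: (real \<times> real) set) = {(1, 0), (0, 1)}"
  by (auto simp: Basis_prod_def)

lemma xaff_eq: "xaff s a p = (a, 0) + (s * fst p, snd p)"
  by (simp add: xaff_def)

lemma bounded_linear_xscale: "bounded_linear (\<lambda>p::real\<times>real. (s * fst p, snd p))"
  by (intro bounded_linear_Pair bounded_linear_const_mult bounded_linear_fst bounded_linear_snd)

lemma continuous_on_xaff: "continuous_on S (xaff s a)"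
  unfolding xaff_def by (intro continuous_intros)

lemma xaff_inverse: "s * s = 1 \<Longrightarrow> xaff s (- (s * a)) (xaff s a p) = p"
  "s * s = 1 \<Longrightarrow> xaff s a (xaff s (- (s * a)) p) = p"
  by (cases p; simp add: xaff_def algebra_simps flip: mult.assoc)+

lemma lborel_preserving_xaff:
  assumes "s * s = 1"
  shows "lborel_preserving (xaff s a)"
proof -
  define c where "c j = (if j = (1, 0) then s else 1)" for j :: "real \<times> real"
  have s: "\<bar>s\<bar> = 1" using assms by (metis abs_mult_self_eq abs_1 abs_abs abs_mult power2_eq_1_iff power2_eq_square abs_minus_cancel)
  have T: "(\<lambda>p. (a, 0) + (\<Sum>j\<in>Basis. (c j * (p \<bullet> j)) *\<^sub>R j)) = xaff s a"
    by (auto simp: xaff_def Basis_real_prod c_def fun_eq_iff)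
  have "(\<Prod>j\<in>Basis. \<bar>c j\<bar>) = 1" using s by (simp add: Basis_real_prod c_def)
  moreover have "c j \<noteq> 0" for j using s by (auto simp: c_def)
  ultimately have "lborel = density (distr lborel borel (xaff s a)) (\<lambda>_. 1)"
    using lborel_affine_euclidean[of c "(a, 0)"] unfolding T by simp
  then show ?thesis
    unfolding lborel_preserving_def
    by (auto simp: density_1 intro: borel_measurable_continuous_onI continuous_on_xaff)
qed

lemma smooth_xaff: "smooth \<phi> \<Longrightarrow> smooth (\<lambda>p. \<phi> (xaff s a p))"
  unfolding xaff_eq by (rule smooth_affine[OF bounded_linear_xscale])

lemma dderiv_xaff:
  assumes "smooth \<phi>"
  shows "d1 (\<lambda>p. \<phi> (xaff s a p)) = (\<lambda>p. s * d1 \<phi> (xaff s a p))"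
    and "d2 (\<lambda>p. \<phi> (xaff s a p)) = (\<lambda>p. d2 \<phi> (xaff s a p))"
proof -
  note * = dderiv_affine[OF bounded_linear_xscale smooth_differentiable[OF assms], of _ "(a, 0)" s, folded xaff_eq]
  show "d1 (\<lambda>p. \<phi> (xaff s a p)) = (\<lambda>p. s * d1 \<phi> (xaff s a p))"
    unfolding * using dderiv_scaleR[OF smooth_differentiable[OF assms], of s "(1, 0)"] by simp
  show "d2 (\<lambda>p. \<phi> (xaff s a p)) = (\<lambda>p. d2 \<phi> (xaff s a p))"
    unfolding * by simp
qed

lemma dderiv_pow_xaff:
  assumes "smooth \<phi>"
  shows "(d1 ^^ n) (\<lambda>p. \<phi> (xaff s a p)) = (\<lambda>p. s ^ n * (d1 ^^ n) \<phi> (xaff s a p))"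
    and "(d2 ^^ n) (\<lambda>p. \<phi> (xaff s a p)) = (\<lambda>p. (d2 ^^ n) \<phi> (xaff s a p))"
proof (induction n)
  case (Suc n)
  { case 1
    show ?case 
      using Suc(1) smooth_dderiv_pow[OF assms, where v="(1, 0)" and n=n]
      by (simp add: dderiv_cmult smooth_differentiable smooth_xaff dderiv_xaff mult_ac) }
  { case 2
    show ?case 
      using Suc(2) smooth_dderiv_pow[OF assms, where v="(0, 1)" and n=n]
      by (simp add: dderiv_xaff) }
qed auto

lemma test_functions_xaff:
  assumes "s * s = 1" "\<phi> \<in> test_functions UNIV"
  shows "(\<lambda>p. \<phi> (xaff s a p)) \<in> test_functions UNIV"
  using test_functions_affine[OF assms(2) bounded_linear_xscale, of "xaff s (- (s * a))" "(a, 0)" s UNIV, folded xaff_eq]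
    xaff_inverse(1)[OF assms(1)] continuous_on_xaff by simp

lemma pair_xaff:
  assumes s: "s * s = 1" and [measurable]: "f \<in> borel_measurable borel" "\<psi> \<in> borel_measurable borel"
  shows "pair (\<lambda>p. f (xaff s a p)) (\<lambda>p. \<psi> (xaff s a p)) = pair f \<psi>"
  unfolding pair_def by (rule lborel_preserving_integral[OF lborel_preserving_xaff[OF s]]) measurable

text \<open>Move the map to the test function, use the weak derivative there, and move it back.  The factor \<open>c\<close>
is the sign \<open>s\<close> for the direction \<open>x\<close> and 1 for the direction \<open>y\<close>.\<close>

lemma has_weak_deriv_xaff:
  assumes s: "s * s = 1" and c: "c * c = 1"
    and D: "\<And>\<phi> a. smooth \<phi> \<Longrightarrow> dderiv b (\<lambda>p. \<phi> (xaff s a p)) = (\<lambda>p. c * dderiv b \<phi> (xaff s a p))"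
    and fg: "f \<in> borel_measurable borel" "g \<in> borel_measurable borel" "has_weak_deriv b f g"
  shows "has_weak_deriv b (\<lambda>p. f (xaff s a p)) (\<lambda>p. c * g (xaff s a p))"
  unfolding has_weak_deriv_def
proof
  fix \<phi> :: "real \<times> real \<Rightarrow> real" assume \<phi>: "\<phi> \<in> test_functions UNIV"
  note sm = test_functions_smooth[OF \<phi>]
  define \<psi> where "\<psi> p = \<phi> (xaff s (- (s * a)) p)" for p
  have \<psi>: "\<psi> \<in> test_functions UNIV" unfolding \<psi>_def by (rule test_functions_xaff[OF s \<phi>])
  have m: "\<psi> \<in> borel_measurable borel" "dderiv b \<psi> \<in> borel_measurable borel"
    using \<psi> by (auto intro: smooth_borel_measurable test_functions_smooth test_functions_dderiv)
  have "dderiv b \<psi> (xaff s a p) = c * dderiv b \<phi> p" for p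
    using D[OF sm, of "- (s * a)"] xaff_inverse(1)[OF s] by (simp add: \<psi>_def[abs_def])
  then have "c * dderiv b \<psi> (xaff s a p) = dderiv b \<phi> p" for p
    using c by (simp add: mult.assoc[symmetric])
  then have "(LINT p|lborel. f (xaff s a p) * dderiv b \<phi> p) = c * pair (\<lambda>p. f (xaff s a p)) (\<lambda>p. dderiv b \<psi> (xaff s a p))"
    unfolding pair_def integral_mult_right_zero[symmetric]
    by (intro Bochner_Integration.integral_cong refl) (metis mult.left_commute)
  also have "\<dots> = c * (LINT p|lborel. f p * dderiv b \<psi> p)"
    using pair_xaff[OF s fg(1) m(2), of a] by (simp add: pair_def)
  also have "\<dots> = - c * pair g \<psi>"
    using fg(3) \<psi> by (simp add: has_weak_deriv_def pair_def)
  also have "\<dots> = - c * pair (\<lambda>p. g (xaff s a p)) (\<lambda>p. \<psi> (xaff s a p))"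
    using pair_xaff[OF s fg(2) m(1)] by simp
  also have "\<dots> = - (LINT p|lborel. c * g (xaff s a p) * \<phi> p)"
    using xaff_inverse(1)[OF s] unfolding pair_def \<psi>_def
    by (simp add: mult.assoc)
  finally show "(LINT p|lborel. f (xaff s a p) * dderiv b \<phi> p) = - (LINT p|lborel. c * g (xaff s a p) * \<phi> p)" .
qed

lemma H1_xaff:
  assumes s: "s * s = 1" and f: "f \<in> H1"
  shows "(\<lambda>p. f (xaff s a p)) \<in> H1"
    and "AE p in lborel. wderiv (1, 0) (\<lambda>p. f (xaff s a p)) p = s * wderiv (1, 0) f (xaff s a p)"
    and "AE p in lborel. wderiv (0, 1) (\<lambda>p. f (xaff s a p)) p = wderiv (0, 1) f (xaff s a p)"
proof -
  note S = lborel_preserving_xaff[OF s]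
  have B: "(1, 0) \<in> (Basis :: (real\<times>real) set)" "(0, 1) \<in> (Basis :: (real\<times>real) set)"
    by (auto simp: Basis_real_prod)
  note w1 = wderiv_H1[OF f B(1)] and w2 = wderiv_H1[OF f B(2)]
  have L: "(\<lambda>p. s * wderiv (1, 0) f (xaff s a p)) \<in> L2" "(\<lambda>p. wderiv (0, 1) f (xaff s a p)) \<in> L2"
    by (intro L2_cmult lborel_preserving_L2[OF S] w1 w2)+
  have W: "has_weak_deriv (1, 0) (\<lambda>p. f (xaff s a p)) (\<lambda>p. s * wderiv (1, 0) f (xaff s a p))"
    by (rule has_weak_deriv_xaff[OF s s dderiv_xaff(1)])
       (auto intro: L2_borel_measurable H1_L2 f w1)
  have W': "has_weak_deriv (0, 1) (\<lambda>p. f (xaff s a p)) (\<lambda>p. wderiv (0, 1) f (xaff s a p))"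
    using has_weak_deriv_xaff[OF s, of 1 "(0, 1)" f "wderiv (0, 1) f" a] dderiv_xaff(2)
    by (auto intro: L2_borel_measurable H1_L2 f w2)
  show H: "(\<lambda>p. f (xaff s a p)) \<in> H1"
    using L W W' lborel_preserving_L2[OF S H1_L2[OF f]]
    by (auto simp: H1_def Basis_real_prod)
  show "AE p in lborel. wderiv (1, 0) (\<lambda>p. f (xaff s a p)) p = s * wderiv (1, 0) f (xaff s a p)"
    by (rule has_weak_deriv_wderiv_eq[OF H B(1) L(1) W])
  show "AE p in lborel. wderiv (0, 1) (\<lambda>p. f (xaff s a p)) p = wderiv (0, 1) f (xaff s a p)"
    by (rule has_weak_deriv_wderiv_eq[OF H B(2) L(2) W'])
qed

lemma has_weak_deriv_cong_AE:
  assumes "AE p in lborel. f p = g p" "f \<in> borel_measurable borel" "g \<in> borel_measurable borel"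
    "has_weak_deriv b f h"
  shows "has_weak_deriv b g h"
  unfolding has_weak_deriv_def
proof
  fix \<phi> :: "'a \<Rightarrow> real" assume \<phi>: "\<phi> \<in> test_functions UNIV"
  have [measurable]: "f \<in> borel_measurable borel" "g \<in> borel_measurable borel" "dderiv b \<phi> \<in> borel_measurable borel"
    using assms \<phi> by (auto intro: smooth_borel_measurable test_functions_smooth test_functions_dderiv)
  have "(LINT p|lborel. f p * dderiv b \<phi> p) = (LINT p|lborel. g p * dderiv b \<phi> p)"
  proof (rule integral_cong_AE)
    show "AE p in lborel. f p * dderiv b \<phi> p = g p * dderiv b \<phi> p"
      using assms(1) by eventually_elim simp
  qed auto
  then show "(LINT p|lborel. g p * dderiv b \<phi> p) = - (LINT p|lborel. h p * \<phi> p)"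
    using assms(4) \<phi> by (simp add: has_weak_deriv_def)
qed

section \<open>The weak formulation at a fixed time\<close>

definition Lx :: "(real \<times> real \<Rightarrow> real) \<Rightarrow> real \<times> real \<Rightarrow> real" where
  "Lx \<psi> = d1 (\<lambda>p. \<psi> p - (d1 ^^ 2) \<psi> p)"

text \<open>The part of the weak formulation in which the test function is not differentiated in time.  The
argument \<open>w\<close> stands for the weak \<open>x\<close>-derivative of \<open>f\<close>; keeping it separate allows other
representatives.\<close>

definition nonlin :: "real \<Rightarrow> (real \<times> real \<Rightarrow> real) \<Rightarrow> (real \<times> real \<Rightarrow> real) \<Rightarrow> (real \<times> real \<Rightarrow> real) \<Rightarrow> real" where
  "nonlin \<kappa> f w \<psi> = \<kappa> * pair f ((d1 ^^ 2) \<psi>) + 3/2 * pair (\<lambda>p. (f p)\<^sup>2) ((d1 ^^ 2) \<psi>)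
     + 1/2 * pair (\<lambda>p. (w p)\<^sup>2) ((d1 ^^ 2) \<psi>) - 1/2 * pair (\<lambda>p. (f p)\<^sup>2) ((d1 ^^ 4) \<psi>)
     + pair f ((d2 ^^ 2) \<psi>)"

lemma test_functions_Lx: "\<psi> \<in> test_functions X \<Longrightarrow> Lx \<psi> \<in> test_functions X"
  unfolding Lx_def by (intro test_functions_dderiv test_functions_diff test_functions_dderiv_pow)

lemma Lx_add:
  assumes "smooth \<phi>" "smooth \<psi>"
  shows "Lx (\<lambda>p. \<phi> p + \<psi> p) = (\<lambda>p. Lx \<phi> p + Lx \<psi> p)"
  using assms
  by (simp add: Lx_def numeral_2_eq_2 dderiv_add dderiv_diff smooth_differentiable smooth_dderiv smooth_add smooth_diff algebra_simps)

lemma Lx_cmult: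
  assumes "smooth \<phi>"
  shows "Lx (\<lambda>p. c * \<phi> p) = (\<lambda>p. c * Lx \<phi> p)"
  using assms
  by (simp add: Lx_def numeral_2_eq_2 dderiv_cmult dderiv_diff smooth_differentiable smooth_dderiv smooth_cmult smooth_diff right_diff_distrib)

lemma Lx_d1: "smooth \<psi> \<Longrightarrow> Lx (d1 \<psi>) = d1 (Lx \<psi>)"
  by (simp add: Lx_def numeral_2_eq_2 dderiv_diff smooth_differentiable smooth_dderiv)

text \<open>\<open>Lx\<close> has only odd powers of \<open>\<partial>\<^sub>x\<close>, so a reflection changes its sign.  The functional \<open>nonlin\<close> in the
next lemma has only even powers and the square of \<open>w\<close>, so it is invariant.\<close>

lemma Lx_xaff:
  assumes "s * s = 1" "smooth \<psi>"
  shows "Lx (\<lambda>p. \<psi> (xaff s a p)) = (\<lambda>p. s * Lx \<psi> (xaff s a p))"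
proof -
  have "(\<lambda>p. \<psi> (xaff s a p) - (d1 ^^ 2) (\<lambda>p. \<psi> (xaff s a p)) p) = (\<lambda>p. (\<lambda>q. \<psi> q - (d1 ^^ 2) \<psi> q) (xaff s a p))"
    using assms by (simp add: dderiv_pow_xaff power2_eq_square)
  moreover have "smooth (\<lambda>q. \<psi> q - (d1 ^^ 2) \<psi> q)"
    by (intro smooth_diff smooth_dderiv_pow assms)
  ultimately show ?thesis
    unfolding Lx_def using dderiv_xaff(1)[of "\<lambda>q. \<psi> q - (d1 ^^ 2) \<psi> q" s a] by simp
qed

lemma nonlin_xaff:
  assumes s: "s * s = 1" and \<psi>: "smooth \<psi>" and m: "f \<in> borel_measurable borel" "w \<in> borel_measurable borel"
  shows "nonlin \<kappa> (\<lambda>p. f (xaff s a p)) (\<lambda>p. w (xaff s a p)) (\<lambda>p. \<psi> (xaff s a p)) = nonlin \<kappa> f w \<psi>"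
proof -
  have m2: "(\<lambda>p. (f p)\<^sup>2) \<in> borel_measurable borel" "(\<lambda>p. (w p)\<^sup>2) \<in> borel_measurable borel" using m by auto
  have d: "(d1 ^^ n) \<psi> \<in> borel_measurable borel" "(d2 ^^ n) \<psi> \<in> borel_measurable borel" for n
    by (intro smooth_borel_measurable smooth_dderiv_pow \<psi>)+
  have s2: "s ^ 2 = 1" "s ^ 4 = 1"
    using s power_mult[of s 2 2] by (auto simp: power2_eq_square)
  show ?thesis
    unfolding nonlin_def dderiv_pow_xaff[OF \<psi>] s2 mult_1_left
    using pair_xaff[OF s m(1) d(1)] pair_xaff[OF s m2(1) d(1)] pair_xaff[OF s m2(2) d(1)] pair_xaff[OF s m(1) d(2)]
    by simp
qed

lemma pair_cong_AE:
  assumes "AE p in lborel. f p = g p" "f \<in> borel_measurable borel" "g \<in> borel_measurable borel" "smooth \<psi>"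
  shows "pair f \<psi> = pair g \<psi>"
  unfolding pair_def
proof (rule integral_cong_AE)
  note [measurable] = assms(2,3) smooth_borel_measurable[OF assms(4)]
  show "(\<lambda>p. f p * \<psi> p) \<in> borel_measurable lborel" "(\<lambda>p. g p * \<psi> p) \<in> borel_measurable lborel" by measurable
  show "AE p in lborel. f p * \<psi> p = g p * \<psi> p" using assms(1) by eventually_elim simp
qed

lemma nonlin_cong_AE:
  assumes f: "AE p in lborel. f p = f' p" and w: "AE p in lborel. (w p)\<^sup>2 = (w' p)\<^sup>2" 
    and m: "f \<in> borel_measurable borel" "f' \<in> borel_measurable borel" "w \<in> borel_measurable borel" "w' \<in> borel_measurable borel"
    and \<psi>: "smooth \<psi>"
  shows "nonlin \<kappa> f w \<psi> = nonlin \<kappa> f' w' \<psi>"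
proof -
  have f2: "AE p in lborel. (f p)\<^sup>2 = (f' p)\<^sup>2" using f by eventually_elim simp
  note d = smooth_dderiv_pow[OF \<psi>]
  have "pair f ((dderiv v ^^ n) \<psi>) = pair f' ((dderiv v ^^ n) \<psi>)" for v n
    by (rule pair_cong_AE[OF f m(1,2) d])
  moreover have "pair (\<lambda>p. (f p)\<^sup>2) ((dderiv v ^^ n) \<psi>) = pair (\<lambda>p. (f' p)\<^sup>2) ((dderiv v ^^ n) \<psi>)" for v n
    by (rule pair_cong_AE[OF f2 _ _ d]) (use m in auto)
  moreover have "pair (\<lambda>p. (w p)\<^sup>2) ((dderiv v ^^ n) \<psi>) = pair (\<lambda>p. (w' p)\<^sup>2) ((dderiv v ^^ n) \<psi>)" for v n
    by (rule pair_cong_AE[OF w _ _ d]) (use m in auto)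
  ultimately show ?thesis unfolding nonlin_def by simp
qed

lemma pair_test_integrable: "locally_integrable f \<Longrightarrow> \<psi> \<in> test_functions X \<Longrightarrow> integrable lborel (\<lambda>p. f p * \<psi> p)"
  by (erule test_functionsE, rule pair_integrable) (auto intro: smooth_continuous_on)

lemma pair_add:
  assumes "locally_integrable f" "\<phi> \<in> test_functions X" "\<psi> \<in> test_functions X"
  shows "pair f (\<lambda>p. \<phi> p + \<psi> p) = pair f \<phi> + pair f \<psi>"
  using pair_test_integrable[OF assms(1,2)] pair_test_integrable[OF assms(1,3)]
  by (simp add: pair_def distrib_left)

lemma pair_cmult: "pair f (\<lambda>p. c * \<psi> p) = c * pair f \<psi>"
  by (simp add: pair_def mult.left_commute)

lemma locally_integrable_sq: "f \<in> L2 \<Longrightarrow> locally_integrable (\<lambda>p. (f p)\<^sup>2)"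
  by (intro locally_integrable_integrable L2_integrable_sq)

lemma dderiv_pow_add:
  assumes "smooth \<phi>" "smooth \<psi>"
  shows "(dderiv v ^^ n) (\<lambda>p. \<phi> p + \<psi> p) = (\<lambda>p. (dderiv v ^^ n) \<phi> p + (dderiv v ^^ n) \<psi> p)"
  by (induction n) (simp_all add: assms dderiv_add smooth_differentiable smooth_dderiv_pow)

lemma dderiv_pow_cmult:
  assumes "smooth \<phi>"
  shows "(dderiv v ^^ n) (\<lambda>p. c * \<phi> p) = (\<lambda>p. c * (dderiv v ^^ n) \<phi> p)"
  by (induction n) (simp_all add: assms dderiv_cmult smooth_differentiable smooth_dderiv_pow)

lemma nonlin_add:
  assumes "f \<in> L2" "w \<in> L2" "\<phi> \<in> test_functions X" "\<psi> \<in> test_functions X"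
  shows "nonlin \<kappa> f w (\<lambda>p. \<phi> p + \<psi> p) = nonlin \<kappa> f w \<phi> + nonlin \<kappa> f w \<psi>"
  unfolding nonlin_def dderiv_pow_add[OF test_functions_smooth[OF assms(3)] test_functions_smooth[OF assms(4)]]
  using assms
  by (simp add: pair_add[where X=X] locally_integrable_L2 locally_integrable_sq test_functions_dderiv_pow distrib_left)

lemma nonlin_cmult:
  assumes "smooth \<psi>"
  shows "nonlin \<kappa> f w (\<lambda>p. c * \<psi> p) = c * nonlin \<kappa> f w \<psi>"
  unfolding nonlin_def dderiv_pow_cmult[OF assms] pair_cmult by (simp add: algebra_simps)

lemma nonlin_integral:
  assumes f: "f \<in> L2" and w: "w \<in> L2" and \<eta>: "\<eta> \<in> test_functions UNIV" and \<psi>: "\<psi> \<in> test_functions UNIV"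
  shows "(LINT p|lborel. f p * \<eta> p
          + (\<kappa> * f p + 3/2 * (f p)\<^sup>2 + 1/2 * (w p)\<^sup>2) * (d1 ^^ 2) \<psi> p
          - 1/2 * (f p)\<^sup>2 * (d1 ^^ 4) \<psi> p + f p * (d2 ^^ 2) \<psi> p)
     = pair f \<eta> + nonlin \<kappa> f w \<psi>"
proof -
  note li = locally_integrable_L2[OF f] locally_integrable_sq[OF f] locally_integrable_sq[OF w]
  note d = test_functions_dderiv_pow[OF \<psi>]
  have i: "integrable lborel (\<lambda>p. f p * \<eta> p)" "integrable lborel (\<lambda>p. f p * (d1 ^^ 2) \<psi> p)"
    "integrable lborel (\<lambda>p. (f p)\<^sup>2 * (d1 ^^ 2) \<psi> p)" "integrable lborel (\<lambda>p. (w p)\<^sup>2 * (d1 ^^ 2) \<psi> p)"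
    "integrable lborel (\<lambda>p. (f p)\<^sup>2 * (d1 ^^ 4) \<psi> p)" "integrable lborel (\<lambda>p. f p * (d2 ^^ 2) \<psi> p)"
    by (rule pair_test_integrable[OF li(1) \<eta>] pair_test_integrable[OF li(1) d] pair_test_integrable[OF li(2) d]
        pair_test_integrable[OF li(3) d])+
  have "(LINT p|lborel. f p * \<eta> p
          + (\<kappa> * f p + 3/2 * (f p)\<^sup>2 + 1/2 * (w p)\<^sup>2) * (d1 ^^ 2) \<psi> p
          - 1/2 * (f p)\<^sup>2 * (d1 ^^ 4) \<psi> p + f p * (d2 ^^ 2) \<psi> p)
    = (LINT p|lborel. f p * \<eta> p + (\<kappa> * (f p * (d1 ^^ 2) \<psi> p) + 3/2 * ((f p)\<^sup>2 * (d1 ^^ 2) \<psi> p)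
          + 1/2 * ((w p)\<^sup>2 * (d1 ^^ 2) \<psi> p) - 1/2 * ((f p)\<^sup>2 * (d1 ^^ 4) \<psi> p) + f p * (d2 ^^ 2) \<psi> p))"
    by (intro Bochner_Integration.integral_cong refl) (simp add: algebra_simps)
  also have "\<dots> = pair f \<eta> + nonlin \<kappa> f w \<psi>"
    unfolding nonlin_def pair_def using i
    by (simp only: Bochner_Integration.integral_add Bochner_Integration.integral_diff
        Bochner_Integration.integrable_add Bochner_Integration.integrable_diff
        integrable_mult_right integral_mult_right_zero)
  finally show ?thesis .
qed

subsection \<open>Time slices of space-time test functions\<close>

lemma bounded_linear_slice: "bounded_linear (\<lambda>p::real\<times>real. (0::real, p))"
  by (intro bounded_linear_Pair bounded_linear_zero bounded_linear_ident)

lemma dderiv_slice: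
  fixes \<phi> :: "real \<times> real \<times> real \<Rightarrow> real"
  assumes "smooth \<phi>"
  shows "dderiv v (\<lambda>p. \<phi> (t, p)) = (\<lambda>p. dderiv (0, v) \<phi> (t, p))"
  using dderiv_affine[OF bounded_linear_slice smooth_differentiable[OF assms], of v "(t, 0)"] by simp

lemma dderiv_pow_slice:
  fixes \<phi> :: "real \<times> real \<times> real \<Rightarrow> real"
  assumes "smooth \<phi>"
  shows "(dderiv v ^^ n) (\<lambda>p. \<phi> (t, p)) = (\<lambda>p. (dderiv (0, v) ^^ n) \<phi> (t, p))"
  by (induction n) (simp_all add: dderiv_slice smooth_dderiv_pow assms)

lemma smooth_slice:
  fixes \<phi> :: "real \<times> real \<times> real \<Rightarrow> real"
  shows "smooth \<phi> \<Longrightarrow> smooth (\<lambda>p. \<phi> (t, p))"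
  using smooth_affine[OF bounded_linear_slice, of \<phi> "(t, 0)"] by simp

lemma test_functions_slice:
  fixes \<phi> :: "real \<times> real \<times> real \<Rightarrow> real"
  assumes "\<phi> \<in> test_functions X"
  shows "(\<lambda>p. \<phi> (t, p)) \<in> test_functions UNIV"
proof -
  obtain K where K: "smooth \<phi>" "compact K" "\<forall>p. p \<notin> K \<longrightarrow> \<phi> p = 0"
    using assms by (rule test_functionsE)
  show ?thesis
  proof (rule test_functionsI[of _ "snd ` K"])
    show "compact (snd ` K)" using K(2) by (intro compact_continuous_image continuous_intros)
    show "\<phi> (t, p) = 0" if "p \<notin> snd ` K" for p
      using that K(3)[rule_format, of "(t, p)"] image_eqI[of p snd "(t, p)" K] by auto
  qed (use K in \<open>auto intro: smooth_slice\<close>)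
qed

lemma L_op_slice:
  assumes "smooth \<phi>"
  shows "L_op \<phi> (t, p) = Lx (\<lambda>p. \<phi> (t, p)) p"
proof -
  have "smooth (\<lambda>p. \<phi> p - (Dx ^^ 2) \<phi> p)"
    by (intro smooth_diff smooth_dderiv_pow assms)
  from dderiv_slice[OF this, of "(1, 0)" t] show ?thesis
    unfolding Lx_def L_op_def dderiv_pow_slice[OF assms] by simp
qed

text \<open>The double integral split at each time: the inner integrand depends on the test function only through
its slice and the slice of its time derivative.\<close>

lemma weak_solution_iff:
  "weak_solution \<kappa> T u \<longleftrightarrow> u \<in> C_H1 {0..T} \<and>
    (\<forall>\<phi>\<in>test_functions ({0<..<T} \<times> UNIV).
      (LINT t:{0..T}|lborel. pair (u t) (Lx (\<lambda>p. Dt \<phi> (t, p)))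
         + nonlin \<kappa> (u t) (wderiv (1, 0) (u t)) (\<lambda>p. \<phi> (t, p))) = 0)"
proof -
  have "(LINT t:{0..T}|lborel. (LINT p|lborel.
            u t p * L_op (Dt \<phi>) (t, p)
          + (\<kappa> * u t p + 3/2 * (u t p)\<^sup>2 + 1/2 * (wderiv (1, 0) (u t) p)\<^sup>2)
              * (Dx ^^ 2) \<phi> (t, p)
          - 1/2 * (u t p)\<^sup>2 * (Dx ^^ 4) \<phi> (t, p)
          + u t p * (Dy ^^ 2) \<phi> (t, p))) =
      (LINT t:{0..T}|lborel. pair (u t) (Lx (\<lambda>p. Dt \<phi> (t, p)))
         + nonlin \<kappa> (u t) (wderiv (1, 0) (u t)) (\<lambda>p. \<phi> (t, p)))"
    if u: "u \<in> C_H1 {0..T}" and \<phi>: "\<phi> \<in> test_functions ({0<..<T} \<times> UNIV)" for \<phi>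
  proof (rule set_lebesgue_integral_cong)
    show "\<forall>t. t \<in> {0..T} \<longrightarrow> (LINT p|lborel.
            u t p * L_op (Dt \<phi>) (t, p)
          + (\<kappa> * u t p + 3/2 * (u t p)\<^sup>2 + 1/2 * (wderiv (1, 0) (u t) p)\<^sup>2)
              * (Dx ^^ 2) \<phi> (t, p)
          - 1/2 * (u t p)\<^sup>2 * (Dx ^^ 4) \<phi> (t, p)
          + u t p * (Dy ^^ 2) \<phi> (t, p)) = pair (u t) (Lx (\<lambda>p. Dt \<phi> (t, p)))
         + nonlin \<kappa> (u t) (wderiv (1, 0) (u t)) (\<lambda>p. \<phi> (t, p))"
    proof (intro allI impI)
      fix t assume t: "t \<in> {0..T}"
      have H: "u t \<in> H1" using u t by (auto simp: C_H1_def)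
      have w: "wderiv (1, 0) (u t) \<in> L2" by (rule wderiv_H1[OF H]) (simp add: Basis_real_prod)
      note sm = test_functions_smooth[OF \<phi>]
      show "(LINT p|lborel.
            u t p * L_op (Dt \<phi>) (t, p)
          + (\<kappa> * u t p + 3/2 * (u t p)\<^sup>2 + 1/2 * (wderiv (1, 0) (u t) p)\<^sup>2)
              * (Dx ^^ 2) \<phi> (t, p)
          - 1/2 * (u t p)\<^sup>2 * (Dx ^^ 4) \<phi> (t, p)
          + u t p * (Dy ^^ 2) \<phi> (t, p)) = pair (u t) (Lx (\<lambda>p. Dt \<phi> (t, p)))
         + nonlin \<kappa> (u t) (wderiv (1, 0) (u t)) (\<lambda>p. \<phi> (t, p))"
        using nonlin_integral[OF H1_L2[OF H] w test_functions_Lx[OF test_functions_slice[OF test_functions_dderiv[OF \<phi>, of "(1, 0, 0)"], of t]]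
           test_functions_slice[OF \<phi>, of t], of \<kappa>]
        unfolding dderiv_pow_slice[OF sm] L_op_slice[OF smooth_dderiv[OF sm]] .
    qed
  qed auto
  then show ?thesis unfolding weak_solution_def by (auto cong: conj_cong)
qed

section \<open>The fundamental lemma of du Bois-Reymond\<close>

text \<open>A smooth step \<open>P\<close>, constant on both sides of \<open>[-1, 1]\<close>, with a bump \<open>B\<close> as its derivative.\<close>

lemma smooth_step_exists:
  obtains P B :: "real \<Rightarrow> real"
  where "smooth P" "smooth B" "\<And>x. (P has_real_derivative B x) (at x)" "\<And>x. 0 \<le> B x" "B 0 > 0"
    "\<And>x. \<bar>x\<bar> \<ge> 1 \<Longrightarrow> B x = 0" "\<And>x. x \<le> -1 \<Longrightarrow> P x = P (-1)" "\<And>x. 1 \<le> x \<Longrightarrow> P x = P 1"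
proof -
  define B :: "real \<Rightarrow> real" where "B = box_bump 1 (-1) 1"
  have sB: "smooth B" unfolding B_def by (rule smooth_box_bump)
  have "\<exists>P. \<forall>x. - \<infinity> < ereal x \<longrightarrow> ereal x < \<infinity> \<longrightarrow> (P has_vector_derivative B x) (at x)"
    using smooth_differentiable[OF sB]
    by (intro einterval_antiderivative) (auto intro: differentiable_imp_continuous_within)
  then obtain P where P: "\<And>x. (P has_real_derivative B x) (at x)"
    by (auto simp: has_real_derivative_iff_has_vector_derivative)
  have B0: "B x = 0" if "\<bar>x\<bar> \<ge> 1" for x
    unfolding B_def by (rule box_bump_outside) (use that in \<open>auto simp: box_real\<close>)
  have const: "P x = P y" if "x \<le> y" "\<And>z. x \<le> z \<Longrightarrow> z \<le> y \<Longrightarrow> B z = 0" for x y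
  proof (cases "x = y")
    case False
    then have "x < y" using that(1) by simp
    from MVT2[OF this P] obtain z where "x < z" "z < y" "P y - P x = (y - x) * B z" by blast
    then show ?thesis using that(2)[of z] by simp
  qed simp
  show ?thesis
  proof (rule that[OF _ sB P])
    show "smooth P"
    proof (rule smoothI)
      show "P differentiable (at x)" for x using P real_differentiable_def by blast
      have "dderiv v P = (\<lambda>x. v * B x)" for v by (rule ext) (rule dderiv_real[OF P])
      then show "smooth (dderiv v P)" for v by (simp add: smooth_cmult sB)
    qed
    show "0 \<le> B x" for x unfolding B_def by (rule box_bump_bounds)
    show "B 0 > 0" unfolding B_def by (rule box_bump_pos) (auto simp: box_real)
    show "P x = P (-1)" if "x \<le> -1" for x by (rule const) (use that in \<open>auto intro: B0\<close>)
    show "P x = P 1" if "1 \<le> x" for x by (rule const[symmetric]) (use that in \<open>auto intro: B0\<close>)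
  qed (rule B0)
qed

text \<open>The test function \<open>\<rho>\<close> is the difference of two steps of width \<open>\<epsilon>\<close> at \<open>a\<close> and \<open>b\<close>.  Its derivative
consists of two bumps of the same mass, opposite in sign, so that the hypothesis equates the averages
of \<open>W\<close> near \<open>a\<close> and near \<open>b\<close>.\<close>

lemma du_Bois_Reymond_interior:
  fixes W :: "real \<Rightarrow> real"
  assumes W: "continuous_on {0..T} W"
    and orth: "\<And>\<rho>. \<rho> \<in> test_functions {0<..<T} \<Longrightarrow> integral {0..T} (\<lambda>t. dderiv 1 \<rho> t * W t) = 0"
    and ab: "0 < a" "a < b" "b < T"
  shows "W a = W b"
proof (rule ccontr)
  assume ne: "W a \<noteq> W b"
  obtain P B :: "real \<Rightarrow> real"
  where PB: "smooth P" "smooth B" "\<And>x. (P has_real_derivative B x) (at x)" "\<And>x. 0 \<le> B x" "B 0 > 0"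
    "\<And>x. \<bar>x\<bar> \<ge> 1 \<Longrightarrow> B x = 0" "\<And>x. x \<le> -1 \<Longrightarrow> P x = P (-1)" "\<And>x. 1 \<le> x \<Longrightarrow> P x = P 1"
    by (rule smooth_step_exists) (erule that)
  define \<eta> where "\<eta> = \<bar>W a - W b\<bar> / 3"
  have \<eta>: "\<eta> > 0" using ne by (simp add: \<eta>_def)
  have close: "\<exists>d>0. \<forall>x\<in>{0..T}. \<bar>x - c\<bar> < d \<longrightarrow> \<bar>W x - W c\<bar> < \<eta>" if "c \<in> {0..T}" for c
    using W[unfolded continuous_on_iff dist_real_def, rule_format, OF that \<eta>] .
  obtain da where da: "da > 0" "\<And>x. x \<in> {0..T} \<Longrightarrow> \<bar>x - a\<bar> < da \<Longrightarrow> \<bar>W x - W a\<bar> < \<eta>"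
    using close[of a] ab by auto
  obtain db where db: "db > 0" "\<And>x. x \<in> {0..T} \<Longrightarrow> \<bar>x - b\<bar> < db \<Longrightarrow> \<bar>W x - W b\<bar> < \<eta>"
    using close[of b] ab by auto
  define \<epsilon> where "\<epsilon> = min (min da db) (min a (T - b)) / 2"
  have \<epsilon>: "\<epsilon> > 0" "\<epsilon> < da" "\<epsilon> < db" "\<epsilon> < a" "b + \<epsilon> < T"
    using da(1) db(1) ab by (auto simp: \<epsilon>_def min_def field_simps)
  define Bs where "Bs c x = B ((x - c) / \<epsilon>)" for c x
  define \<rho> where "\<rho> x = P ((x - a) / \<epsilon>) - P ((x - b) / \<epsilon>)" for x
  have Bs0: "Bs c x = 0" if "\<bar>x - c\<bar> \<ge> \<epsilon>" for c x
    using that \<epsilon>(1) unfolding Bs_def by (intro PB(6)) (simp add: abs_divide)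
  have scale: "smooth (\<lambda>x. f ((x - c) / \<epsilon>))" if "smooth f" for f :: "real \<Rightarrow> real" and c
    using smooth_affine[OF bounded_linear_mult_left[of "1/\<epsilon>"] that, of "- c / \<epsilon>"]
    by (simp add: diff_divide_distrib)
  have d\<rho>: "(\<rho> has_real_derivative (Bs a x - Bs b x) / \<epsilon>) (at x)" for x
  proof -
    have "((\<lambda>x. P ((x - c) / \<epsilon>)) has_real_derivative Bs c x * (1 / \<epsilon>)) (at x)" for c
      unfolding Bs_def using \<epsilon>(1) by (intro DERIV_chain2[OF PB(3)]) (auto intro!: derivative_eq_intros)
    from DERIV_diff[OF this[of a] this[of b]] show ?thesis
      unfolding \<rho>_def by (simp add: diff_divide_distrib)
  qed
  have \<rho>_out: "\<rho> x = 0" if "x \<notin> {a - \<epsilon>..b + \<epsilon>}" for x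
  proof (cases "x < a - \<epsilon>")
    case True
    then have "(x - a) / \<epsilon> \<le> -1" "(x - b) / \<epsilon> \<le> -1" using \<epsilon>(1) ab by (auto simp: field_simps)
    then show ?thesis using PB(7)[of "(x - a) / \<epsilon>"] PB(7)[of "(x - b) / \<epsilon>"] by (simp add: \<rho>_def)
  next
    case False
    then have "(x - a) / \<epsilon> \<ge> 1" "(x - b) / \<epsilon> \<ge> 1" using that \<epsilon>(1) ab by (auto simp: field_simps)
    then show ?thesis using PB(8)[of "(x - a) / \<epsilon>"] PB(8)[of "(x - b) / \<epsilon>"] by (simp add: \<rho>_def)
  qed
  have "\<rho> \<in> test_functions {0<..<T}"
  proof (rule test_functionsI)
    show "smooth \<rho>" unfolding \<rho>_def[abs_def] by (intro smooth_diff scale PB(1))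
    show "{a - \<epsilon>..b + \<epsilon>} \<subseteq> {0<..<T}" using \<epsilon> by auto
  qed (use \<rho>_out in auto)
  from orth[OF this] have orth': "integral {0..T} (\<lambda>x. (Bs a x - Bs b x) / \<epsilon> * W x) = 0"
    by (simp add: dderiv_real[OF d\<rho>])
  have T: "0 \<le> T" using ab by simp
  \<comment> \<open>The two bumps have the same mass because \<open>\<rho>\<close> vanishes at both ends.\<close>
  have FTC: "((\<lambda>x. (Bs a x - Bs b x) / \<epsilon>) has_integral (\<rho> T - \<rho> 0)) {0..T}"
    using T d\<rho> by (intro fundamental_theorem_of_calculus)
      (auto simp: has_real_derivative_iff_has_vector_derivative intro: has_vector_derivative_at_within)
  have "\<rho> T = 0" "\<rho> 0 = 0" using \<epsilon> by (auto intro!: \<rho>_out)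
  with integral_unique[OF FTC] have mass: "integral {0..T} (\<lambda>x. (Bs a x - Bs b x) / \<epsilon>) = 0" by linarith
  have cB: "continuous_on {0..T} (Bs c)" for c
    unfolding Bs_def[abs_def] by (intro smooth_continuous_on scale PB(2))
  have int: "Bs c integrable_on {0..T}" "(\<lambda>x. Bs c x * W x) integrable_on {0..T}" "(\<lambda>x. k * Bs c x) integrable_on {0..T}" for c k
    by (intro integrable_continuous_real continuous_intros cB W)+
  define J where "J = integral {0..T} (Bs a)"
  have Jb: "integral {0..T} (Bs b) = J"
    using mass \<epsilon>(1) int by (simp add: J_def integral_diff)
  have orth2: "integral {0..T} (\<lambda>x. Bs a x * W x) = integral {0..T} (\<lambda>x. Bs b x * W x)"
  proof -
    have "(\<lambda>x. (Bs a x - Bs b x) / \<epsilon> * W x) = (\<lambda>x. (Bs a x * W x - Bs b x * W x) / \<epsilon>)"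
      by (auto simp: algebra_simps diff_divide_distrib)
    then have "integral {0..T} (\<lambda>x. (Bs a x * W x - Bs b x * W x) / \<epsilon>) = 0" using orth' by simp
    then show ?thesis using \<epsilon>(1) int by (simp add: integral_diff)
  qed
  have "J \<noteq> 0"
  proof
    assume "J = 0"
    then have "\<forall>x\<in>{0..T}. Bs a x = 0"
      unfolding J_def using integral_eq_0_iff[OF cB] ab PB(4) by (simp add: Bs_def)
    then have "Bs a a = 0" using ab by auto
    then show False using PB(5) by (simp add: Bs_def)
  qed
  moreover have "J \<ge> 0" unfolding J_def Bs_def by (intro integral_nonneg int[unfolded Bs_def]) (simp add: PB(4))
  ultimately have J: "J > 0" by simp
  have est: "\<bar>integral {0..T} (\<lambda>x. Bs c x * W x) - W c * integral {0..T} (Bs c)\<bar> \<le> \<eta> * integral {0..T} (Bs c)"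
    if c: "c \<in> {0..T}" and W: "\<And>x. x \<in> {0..T} \<Longrightarrow> \<bar>x - c\<bar> < \<epsilon> \<Longrightarrow> \<bar>W x - W c\<bar> < \<eta>" for c
  proof -
    have b: "W c * Bs c x - \<eta> * Bs c x \<le> Bs c x * W x \<and> Bs c x * W x \<le> W c * Bs c x + \<eta> * Bs c x" if "x \<in> {0..T}" for x
    proof (cases "\<bar>x - c\<bar> < \<epsilon>")
      case True
      have "Bs c x * (W c - \<eta>) \<le> Bs c x * W x" "Bs c x * W x \<le> Bs c x * (W c + \<eta>)"
        using W[OF that True] PB(4) by (auto intro!: mult_left_mono simp: Bs_def)
      then show ?thesis by (simp add: algebra_simps)
    qed (use Bs0[of x c] in auto)
    have "integral {0..T} (\<lambda>x. W c * Bs c x - \<eta> * Bs c x) \<le> integral {0..T} (\<lambda>x. Bs c x * W x)"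
      by (rule integral_le) (use b int in \<open>auto intro!: integrable_diff\<close>)
    moreover have "integral {0..T} (\<lambda>x. Bs c x * W x) \<le> integral {0..T} (\<lambda>x. W c * Bs c x + \<eta> * Bs c x)"
      by (rule integral_le) (use b int in \<open>auto intro!: integrable_add\<close>)
    ultimately show ?thesis
      using int by (simp add: integral_diff integral_add abs_le_iff algebra_simps)
  qed
  have "\<bar>integral {0..T} (\<lambda>x. Bs a x * W x) - W a * J\<bar> \<le> \<eta> * J"
  proof -
    have W: "\<bar>W x - W a\<bar> < \<eta>" if "x \<in> {0..T}" "\<bar>x - a\<bar> < \<epsilon>" for x
      using da(2)[OF that(1)] that(2) \<epsilon> by simp
    have "a \<in> {0..T}" using ab by simp
    from est[OF this W] show ?thesis unfolding J_def .
  qed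
  moreover have "\<bar>integral {0..T} (\<lambda>x. Bs a x * W x) - W b * J\<bar> \<le> \<eta> * J"
  proof -
    have W: "\<bar>W x - W b\<bar> < \<eta>" if "x \<in> {0..T}" "\<bar>x - b\<bar> < \<epsilon>" for x
      using db(2)[OF that(1)] that(2) \<epsilon> by simp
    have "b \<in> {0..T}" using ab by simp
    from est[OF this W] show ?thesis unfolding Jb orth2 .
  qed
  ultimately have "\<bar>W a * J - W b * J\<bar> \<le> 2 * \<eta> * J" by linarith
  then have "\<bar>W a - W b\<bar> * J \<le> (2 * \<eta>) * J" using J by (simp add: abs_mult flip: left_diff_distrib)
  then have "\<bar>W a - W b\<bar> \<le> 2 * \<eta>" using J by simp
  then show False using \<eta> by (simp add: \<eta>_def)
qed

lemma du_Bois_Reymond: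
  fixes W :: "real \<Rightarrow> real"
  assumes W: "continuous_on {0..T} W" and T: "0 < T"
    and orth: "\<And>\<rho>. \<rho> \<in> test_functions {0<..<T} \<Longrightarrow> integral {0..T} (\<lambda>t. dderiv 1 \<rho> t * W t) = 0"
    and t: "t \<in> {0..T}"
  shows "W t = W 0"
proof -
  have eq: "W x = W (T/2)" if "x \<in> {0<..<T}" for x
  proof -
    consider "x < T/2" | "x = T/2" | "T/2 < x" by linarith
    then show ?thesis
    proof cases
      case 1
      show ?thesis by (rule du_Bois_Reymond_interior[OF W orth]) (use 1 that T in auto)
    next
      case 2
      show ?thesis unfolding 2 ..
    next
      case 3
      show ?thesis by (rule du_Bois_Reymond_interior[OF W orth, symmetric]) (use 3 that T in auto)
    qed
  qed
  have cl: "closure {0<..<T} = {0..T}" using T by simp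
  have all: "W x = W (T/2)" if "x \<in> {0..T}" for x
    by (rule continuous_constant_on_closure[of "{0<..<T}" W, unfolded cl, OF W eq that])
  have "0 \<in> {0..T}" using T by simp
  from all[OF t] all[OF this, symmetric] show ?thesis by (rule trans)
qed

section \<open>Evolution of the pairings of a weak solution\<close>

lemma continuous_on_pair_nonlin:
  assumes u: "u \<in> C_H1 I" and \<psi>: "\<psi> \<in> test_functions UNIV"
  shows "continuous_on I (\<lambda>t. pair (u t) \<psi>)"
    and "continuous_on I (\<lambda>t. nonlin \<kappa> (u t) (wderiv (1, 0) (u t)) \<psi>)"
proof -
  have B: "(1, 0) \<in> (Basis :: (real\<times>real) set)" by (simp add: Basis_real_prod)
  have 1: "continuous_on I (\<lambda>t. pair (u t) \<phi>)" if \<phi>: "\<phi> \<in> test_functions UNIV" for \<phi>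
    unfolding continuous_on_def
  proof
    fix t assume t: "t \<in> I"
    show "((\<lambda>t. pair (u t) \<phi>) \<longlongrightarrow> pair (u t) \<phi>) (at t within I)"
      by (rule pair_test_tendsto[OF L2_conv_L1loc_conv[OF C_H1_conv(1)[OF u t]] \<phi>])
  qed
  have 2: "continuous_on I (\<lambda>t. pair (\<lambda>p. (u t p)\<^sup>2) \<phi>)" if \<phi>: "\<phi> \<in> test_functions UNIV" for \<phi>
    unfolding continuous_on_def
  proof
    fix t assume t: "t \<in> I"
    show "((\<lambda>t. pair (\<lambda>p. (u t p)\<^sup>2) \<phi>) \<longlongrightarrow> pair (\<lambda>p. (u t p)\<^sup>2) \<phi>) (at t within I)"
      by (rule pair_test_tendsto[OF L2_conv_sq_L1loc_conv[OF C_H1_conv(1)[OF u t]] \<phi>])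
  qed
  have 3: "continuous_on I (\<lambda>t. pair (\<lambda>p. (wderiv (1, 0) (u t) p)\<^sup>2) \<phi>)" if \<phi>: "\<phi> \<in> test_functions UNIV" for \<phi>
    unfolding continuous_on_def
  proof
    fix t assume t: "t \<in> I"
    show "((\<lambda>t. pair (\<lambda>p. (wderiv (1, 0) (u t) p)\<^sup>2) \<phi>) \<longlongrightarrow> pair (\<lambda>p. (wderiv (1, 0) (u t) p)\<^sup>2) \<phi>) (at t within I)"
      by (rule pair_test_tendsto[OF L2_conv_sq_L1loc_conv[OF C_H1_conv(2)[OF u t B]] \<phi>])
  qed
  show "continuous_on I (\<lambda>t. pair (u t) \<psi>)" by (rule 1[OF \<psi>])
  show "continuous_on I (\<lambda>t. nonlin \<kappa> (u t) (wderiv (1, 0) (u t)) \<psi>)"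
    unfolding nonlin_def by (intro continuous_intros 1 2 3 test_functions_dderiv_pow \<psi>)
qed

lemma test_functions_product:
  fixes \<rho> :: "real \<Rightarrow> real" and \<psi> :: "real \<times> real \<Rightarrow> real"
  assumes "\<rho> \<in> test_functions X" "\<psi> \<in> test_functions UNIV"
  shows "(\<lambda>z. \<rho> (fst z) * \<psi> (snd z)) \<in> test_functions (X \<times> UNIV)"
    and "Dt (\<lambda>z. \<rho> (fst z) * \<psi> (snd z)) = (\<lambda>z. dderiv 1 \<rho> (fst z) * \<psi> (snd z))"
proof -
  obtain K where K: "smooth \<rho>" "compact K" "\<forall>p. p \<notin> K \<longrightarrow> \<rho> p = 0" "K \<subseteq> X"
    using assms(1) by (rule test_functionsE)
  obtain L where L: "smooth \<psi>" "compact L" "\<forall>p. p \<notin> L \<longrightarrow> \<psi> p = 0"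
    using assms(2) by (rule test_functionsE)
  have s: "smooth (\<lambda>z::real\<times>real\<times>real. \<rho> (fst z))" "smooth (\<lambda>z::real\<times>real\<times>real. \<psi> (snd z))"
    by (rule smooth_linear[OF bounded_linear_fst K(1)] smooth_linear[OF bounded_linear_snd L(1)])+
  show "(\<lambda>z. \<rho> (fst z) * \<psi> (snd z)) \<in> test_functions (X \<times> UNIV)"
  proof (rule test_functionsI[of _ "K \<times> L"])
    show "smooth (\<lambda>z. \<rho> (fst z) * \<psi> (snd z))" by (rule smooth_mult[OF s])
    show "compact (K \<times> L)" by (rule compact_Times[OF K(2) L(2)])
    show "\<rho> (fst z) * \<psi> (snd z) = 0" if "z \<notin> K \<times> L" for z
      using that K(3)[rule_format, of "fst z"] L(3)[rule_format, of "snd z"] by (cases z) auto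
    show "K \<times> L \<subseteq> X \<times> UNIV" using K(4) by auto
  qed
  have "dderiv (1, 0, 0) (\<lambda>z::real\<times>real\<times>real. \<rho> (fst z)) = (\<lambda>z. dderiv 1 \<rho> (fst z))"
    using dderiv_affine[OF bounded_linear_fst smooth_differentiable[OF K(1)], of "(1, 0, 0)" 0] by simp
  moreover have "dderiv (1, 0, 0) (\<lambda>z::real\<times>real\<times>real. \<psi> (snd z)) = (\<lambda>z. 0)"
  proof
    fix z :: "real \<times> real \<times> real"
    have "snd (1::real, 0::real, 0::real) = 0" by (simp only: snd_conv zero_prod_def)
    moreover have "dderiv (1, 0, 0) (\<lambda>z::real\<times>real\<times>real. \<psi> (snd z)) z = dderiv (snd (1::real, 0::real, 0::real)) \<psi> (snd z)"
      using fun_cong[OF dderiv_affine[OF bounded_linear_snd smooth_differentiable[OF L(1)], of "(1, 0, 0)" 0], of z]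
      unfolding add_0_left .
    moreover have "dderiv 0 \<psi> (snd z) = 0"
      unfolding dderiv_def by (rule linear_0[OF linear_frechet_derivative[OF smooth_differentiable[OF L(1)]]])
    ultimately show "dderiv (1, 0, 0) (\<lambda>z::real\<times>real\<times>real. \<psi> (snd z)) z = 0" by (simp only:)
  qed
  moreover note dderiv_mult[OF smooth_differentiable[OF s(1)] smooth_differentiable[OF s(2)], of "(1, 0, 0)"]
  ultimately show "Dt (\<lambda>z. \<rho> (fst z) * \<psi> (snd z)) = (\<lambda>z. dderiv 1 \<rho> (fst z) * \<psi> (snd z))"
    by (simp only: mult_zero_right add_0_left)
qed

text \<open>With \<open>V\<close> a primitive of the continuous function \<open>N\<close>, the weak formulation for \<open>\<rho>(t) \<psi>(x, y)\<close> says that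
\<open>U - V\<close> integrates to zero against \<open>\<rho>'\<close>, so \<open>U - V\<close> is constant.  In contrast to the weak
formulation, the conclusion reaches the endpoints of the interval.\<close>

theorem weak_solution_evolution:
  assumes u: "weak_solution \<kappa> T u" and T: "0 < T" and \<psi>: "\<psi> \<in> test_functions UNIV" and t: "t \<in> {0..T}"
  shows "((\<lambda>s. pair (u s) (Lx \<psi>)) has_real_derivative nonlin \<kappa> (u t) (wderiv (1, 0) (u t)) \<psi>) (at t within {0..T})"
proof -
  define U where "U s = pair (u s) (Lx \<psi>)" for s
  define N where "N s = nonlin \<kappa> (u s) (wderiv (1, 0) (u s)) \<psi>" for s
  define V where "V s = integral {0..s} N" for s
  have uC: "u \<in> C_H1 {0..T}" using u by (simp add: weak_solution_iff)
  have cU: "continuous_on {0..T} U" and cN: "continuous_on {0..T} N"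
    using continuous_on_pair_nonlin[OF uC] \<psi> test_functions_Lx[OF \<psi>] unfolding U_def N_def by auto
  have cV: "continuous_on {0..T} V"
    unfolding V_def by (intro indefinite_integral_continuous_1 integrable_continuous_real cN)
  have dV: "(V has_real_derivative N s) (at s within {0..T})" if "s \<in> {0..T}" for s
    unfolding V_def by (rule integral_has_real_derivative[OF cN that])
  have const: "U t - V t = U 0 - V 0" if "t \<in> {0..T}" for t
  proof (rule du_Bois_Reymond[OF _ T _ that])
    show "continuous_on {0..T} (\<lambda>s. U s - V s)" by (intro continuous_intros cU cV)
    fix \<rho> :: "real \<Rightarrow> real" assume \<rho>: "\<rho> \<in> test_functions {0<..<T}"
    note s\<rho> = test_functions_smooth[OF \<rho>]
    have c\<rho>: "continuous_on {0..T} \<rho>" "continuous_on {0..T} (dderiv 1 \<rho>)"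
      by (intro smooth_continuous_on smooth_dderiv s\<rho>)+
    have "(LINT t:{0..T}|lborel. pair (u t) (Lx (\<lambda>p. dderiv 1 \<rho> t * \<psi> p))
         + nonlin \<kappa> (u t) (wderiv (1, 0) (u t)) (\<lambda>p. \<rho> t * \<psi> p)) = 0"
      using u[unfolded weak_solution_iff, THEN conjunct2, THEN bspec, OF test_functions_product(1)[OF \<rho> \<psi>]]
      unfolding test_functions_product(2)[OF \<rho> \<psi>] by simp
    then have "(LINT t:{0..T}|lborel. dderiv 1 \<rho> t * U t + \<rho> t * N t) = 0"
      by (simp add: Lx_cmult[OF test_functions_smooth[OF \<psi>]] pair_cmult nonlin_cmult[OF test_functions_smooth[OF \<psi>]] U_def N_def)
    then have 1: "integral {0..T} (\<lambda>t. dderiv 1 \<rho> t * U t + \<rho> t * N t) = 0"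
      by (subst (asm) set_borel_integral_eq_integral(2))
         (intro borel_integrable_atLeastAtMost' continuous_intros c\<rho> cU cN, simp)
    \<comment> \<open>The same identity with \<open>V\<close> in place of \<open>U\<close> is the integral of the derivative of \<open>\<rho> V\<close>.\<close>
    have d\<rho>: "(\<rho> has_real_derivative dderiv 1 \<rho> s) (at s)" for s
      using has_real_derivative_line[OF smooth_differentiable[OF s\<rho>], of 0 1 s] by simp
    have "((\<lambda>t. dderiv 1 \<rho> t * V t + \<rho> t * N t) has_integral (\<rho> T * V T - \<rho> 0 * V 0)) {0..T}"
    proof (rule fundamental_theorem_of_calculus)
      fix s assume s: "s \<in> {0..T}"
      show "((\<lambda>t. \<rho> t * V t) has_vector_derivative dderiv 1 \<rho> s * V s + \<rho> s * N s) (at s within {0..T})"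
        unfolding has_real_derivative_iff_has_vector_derivative[symmetric]
        using DERIV_mult[OF has_field_derivative_at_within[OF d\<rho>] dV[OF s]] by (simp add: algebra_simps)
    qed (use T in simp)
    moreover have "\<rho> T = 0" "\<rho> 0 = 0"
    proof -
      obtain K where K: "\<forall>p. p \<notin> K \<longrightarrow> \<rho> p = 0" "K \<subseteq> {0<..<T}"
        using \<rho> by (rule test_functionsE)
      then have "T \<notin> K" "0 \<notin> K" by auto
      then show "\<rho> T = 0" "\<rho> 0 = 0" using K(1) by auto
    qed
    ultimately have 2: "integral {0..T} (\<lambda>t. dderiv 1 \<rho> t * V t + \<rho> t * N t) = 0"
      by (simp add: integral_unique)
    have "integral {0..T} (\<lambda>t. dderiv 1 \<rho> t * (U t - V t))
      = integral {0..T} (\<lambda>t. (dderiv 1 \<rho> t * U t + \<rho> t * N t) - (dderiv 1 \<rho> t * V t + \<rho> t * N t))"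
      by (simp add: algebra_simps)
    also have "\<dots> = 0"
      using 1 2 by (subst integral_diff) (auto intro!: integrable_continuous_real continuous_intros c\<rho> cU cN cV)
    finally show "integral {0..T} (\<lambda>t. dderiv 1 \<rho> t * (U t - V t)) = 0" .
  qed
  have UV: "U s = U 0 - V 0 + V s" if "s \<in> {0..T}" for s using const[OF that] by linarith
  have "((\<lambda>s. U 0 - V 0 + V s) has_real_derivative N t) (at t within {0..T})"
    using DERIV_add[OF DERIV_const dV[OF t]] by simp
  then have "(U has_real_derivative N t) (at t within {0..T})"
    by (rule has_field_derivative_transform_within[OF _ zero_less_one t]) (rule UV[symmetric])
  then show ?thesis by (simp add: U_def[abs_def] N_def)
qed

section \<open>The stationary identity of a symmetric solution\<close>

lemma xaff_plus: "xaff 1 a p = p + (a, 0)"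
  by (cases p) (simp add: xaff_def)

lemma pair_symmetric:
  assumes f: "f \<in> borel_measurable borel" and sym: "AE p in lborel. f p = f (xaff (-1) b p)" and \<psi>: "smooth \<psi>"
  shows "pair f (\<lambda>p. \<psi> (xaff (-1) b p)) = pair f \<psi>"
proof -
  have [measurable]: "xaff (-1) b \<in> borel \<rightarrow>\<^sub>M borel"
    by (intro borel_measurable_continuous_onI continuous_on_xaff)
  note [measurable] = f
  have "pair f (\<lambda>p. \<psi> (xaff (-1) b p)) = pair (\<lambda>p. f (xaff (-1) b p)) (\<lambda>p. \<psi> (xaff (-1) b p))"
    by (rule pair_cong_AE[OF sym f _ smooth_xaff[OF \<psi>]]) measurable
  also have "\<dots> = pair f \<psi>"
    by (rule pair_xaff[OF _ f smooth_borel_measurable[OF \<psi>]]) simp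
  finally show ?thesis .
qed

lemma pair_odd_eq_0:
  assumes f: "f \<in> borel_measurable borel" and sym: "AE p in lborel. f p = f (xaff (-1) b p)" and \<psi>: "smooth \<psi>"
    and odd: "\<And>p. \<psi> (xaff (-1) b p) = - \<psi> p"
  shows "pair f \<psi> = 0"
proof -
  have "pair f (\<lambda>p. - 1 * \<psi> p) = pair f \<psi>"
    using pair_symmetric[OF f sym \<psi>] by (simp add: odd)
  then show ?thesis unfolding pair_cmult by simp
qed

text \<open>The weak \<open>x\<close>-derivative of a symmetric function is odd about the axis; its square is symmetric.\<close>

lemma wderiv_symmetric:
  assumes f: "f \<in> H1" and sym: "AE p in lborel. f p = f (xaff (-1) b p)"
  shows "AE p in lborel. (wderiv (1, 0) f p)\<^sup>2 = (wderiv (1, 0) f (xaff (-1) b p))\<^sup>2"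
proof -
  have s: "(-1::real) * -1 = 1" by simp
  have B: "(1, 0) \<in> (Basis :: (real\<times>real) set)" by (simp add: Basis_real_prod)
  let ?g = "\<lambda>p. f (xaff (-1) b p)"
  have g: "?g \<in> H1" by (rule H1_xaff(1)[OF s f])
  have sym': "AE p in lborel. ?g p = f p" using sym by eventually_elim simp
  have "has_weak_deriv (1, 0) f (wderiv (1, 0) ?g)"
    by (rule has_weak_deriv_cong_AE[OF sym' _ _ wderiv_H1(2)[OF g B]])
       (intro L2_borel_measurable H1_L2 f g)+
  from has_weak_deriv_wderiv_eq[OF f B wderiv_H1(1)[OF g B] this] H1_xaff(2)[OF s f, of b]
  show ?thesis by eventually_elim simp
qed

lemma pair_difference_quotient_tendsto:
  assumes f: "L1loc_conv f g F" and \<eta>: "\<eta> \<in> test_functions X" and h: "(h \<longlongrightarrow> 0) F"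
  shows "((\<lambda>s. pair (f s) (\<lambda>p. if h s = 0 then dderiv v \<eta> p else (\<eta> (p + h s *\<^sub>R v) - \<eta> p) / h s)) \<longlongrightarrow> pair g (dderiv v \<eta>)) F"
proof -
  obtain K where K: "smooth \<eta>" "compact K" "\<forall>p. p \<notin> K \<longrightarrow> \<eta> p = 0"
    using \<eta> by (rule test_functionsE)
  obtain K' where K': "compact K'" "\<forall>p h. norm h \<le> 1 \<longrightarrow> p + h \<in> K \<longrightarrow> p \<in> K'"
    using compact_thicken[OF K(2)] by metis
  have K'0: "p \<notin> K" if "p \<notin> K'" for p using K'(2)[rule_format, of 0 p] that by auto
  have out: "dderiv v \<eta> p = 0" if "p \<notin> K'" for p
    by (rule dderiv_eq_0_outside[OF compact_imp_closed[OF K(2)]]) (use K(3) K'0[OF that] in auto)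
  have "((\<lambda>s. norm (h s *\<^sub>R v)) \<longlongrightarrow> norm (0 *\<^sub>R v)) F" by (intro tendsto_intros h)
  then have ev: "\<forall>\<^sub>F s in F. norm (h s *\<^sub>R v) < 1" by (rule order_tendstoD) simp
  show ?thesis
  proof (rule pair_tendsto[OF f K'(1)])
    show "\<forall>\<^sub>F s in F. continuous_on UNIV (\<lambda>p. if h s = 0 then dderiv v \<eta> p else (\<eta> (p + h s *\<^sub>R v) - \<eta> p) / h s)
      \<and> (\<forall>p. p \<notin> K' \<longrightarrow> (if h s = 0 then dderiv v \<eta> p else (\<eta> (p + h s *\<^sub>R v) - \<eta> p) / h s) = 0)"
      using ev
    proof eventually_elim
      case (elim s)
      have "continuous_on UNIV (\<lambda>p. \<eta> (p + h s *\<^sub>R v))"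
        using smooth_continuous_on[OF smooth_affine[OF bounded_linear_ident K(1), of "h s *\<^sub>R v"]] by (simp add: add.commute)
      then have "continuous_on UNIV (\<lambda>p. if h s = 0 then dderiv v \<eta> p else (\<eta> (p + h s *\<^sub>R v) - \<eta> p) / h s)"
        using smooth_continuous_on[OF smooth_dderiv[OF K(1), of v]] smooth_continuous_on[OF K(1)]
        by (cases "h s = 0") (auto intro!: continuous_intros)
      moreover have "(if h s = 0 then dderiv v \<eta> p else (\<eta> (p + h s *\<^sub>R v) - \<eta> p) / h s) = 0" if "p \<notin> K'" for p
      proof -
        have "p + h s *\<^sub>R v \<notin> K" using K'(2)[rule_format, of "h s *\<^sub>R v" p] elim that by auto
        then have "\<eta> (p + h s *\<^sub>R v) = 0" "\<eta> p = 0" using K(3) K'0[OF that] by auto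
        then show ?thesis using out[OF that] by simp
      qed
      ultimately show ?case by blast
    qed
    show "continuous_on UNIV (dderiv v \<eta>)" by (intro smooth_continuous_on smooth_dderiv K(1))
    show "dderiv v \<eta> p = 0" if "p \<notin> K'" for p by (rule out[OF that])
    have "uniform_limit UNIV (\<lambda>h p. if h = 0 then dderiv v \<eta> p else (\<eta> (p + h *\<^sub>R v) - \<eta> p) / h) (dderiv v \<eta>) (nhds 0)"
      by (rule difference_quotient_uniform_limit[OF K(1,2)]) (use K(3) in auto)
    then show "uniform_limit UNIV (\<lambda>s p. if h s = 0 then dderiv v \<eta> p else (\<eta> (p + h s *\<^sub>R v) - \<eta> p) / h s) (dderiv v \<eta>) F"
      unfolding uniform_limit_iff using eventually_compose_filterlim[OF _ h] by fast
  qed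
qed

text \<open>The symmetry axis moves with \<open>t\<close>, and the test function follows it: \<open>xaff 1 (- \<delta> t)\<close> translates
\<open>\<eta> = Lx \<psi>\<close>, which is odd about the axis at time \<open>t\<^sub>0\<close>, so that it is odd about the axis at time \<open>t\<close>.
Since the pairing with the translate vanishes, the pairing with \<open>\<eta>\<close> itself is a difference in
space of size \<open>\<delta> t\<close>.  Its derivative at \<open>t\<^sub>0\<close> is computed from this and from the evolution equation.\<close>

lemma even_test_identity:
  assumes u: "weak_solution \<kappa> T u" and T: "0 < T" and t0: "t0 \<in> {0..T}"
    and l: "(l has_real_derivative c) (at t0)"
    and sym: "\<And>t. t \<in> {0..T} \<Longrightarrow> AE p in lborel. u t p = u t (xaff (-1) (2 * l t) p)"
    and \<psi>: "\<psi> \<in> test_functions UNIV" and even: "\<And>p. \<psi> (xaff (-1) (2 * l t0) p) = \<psi> p"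
  shows "nonlin \<kappa> (u t0) (wderiv (1, 0) (u t0)) \<psi> = c * pair (u t0) (Lx (d1 \<psi>))"
proof -
  define F where "F = at t0 within {0..T}"
  have F: "F \<noteq> bot"
    unfolding F_def trivial_limit_within using t0 T by (simp add: islimpt_Icc)
  define \<eta> where "\<eta> = Lx \<psi>"
  define \<delta> where "\<delta> t = l t - l t0" for t
  have s\<psi>: "smooth \<psi>" by (rule test_functions_smooth[OF \<psi>])
  have \<eta>: "\<eta> \<in> test_functions UNIV" unfolding \<eta>_def by (rule test_functions_Lx[OF \<psi>])
  have s\<eta>: "smooth \<eta>" by (rule test_functions_smooth[OF \<eta>])
  have uC: "u \<in> C_H1 {0..T}" using u by (simp add: weak_solution_iff)
  have uL: "u t \<in> L2" if "t \<in> {0..T}" for t using uC that by (auto simp: C_H1_def intro: H1_L2)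
  have odd: "\<eta> (xaff (-1) (2 * l t0) p) = - \<eta> p" for p
  proof -
    have inv: "(\<lambda>p. \<psi> (xaff (-1) (2 * l t0) p)) = \<psi>" by (rule ext) (rule even)
    have "Lx \<psi> p = -1 * Lx \<psi> (xaff (-1) (2 * l t0) p)"
      using fun_cong[OF Lx_xaff[of "-1" \<psi> "2 * l t0"], of p] s\<psi> unfolding inv by simp
    then show ?thesis by (simp add: \<eta>_def)
  qed
  have zero: "pair (u t) (\<lambda>p. \<eta> (xaff 1 (- \<delta> t) p)) = 0" if t: "t \<in> {0..T}" for t
  proof (rule pair_odd_eq_0[OF L2_borel_measurable[OF uL[OF t]] sym[OF t] smooth_xaff[OF s\<eta>]])
    fix p
    have "xaff 1 (- \<delta> t) (xaff (-1) (2 * l t) p) = xaff (-1) (2 * l t0) (xaff 1 (- \<delta> t) p)"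
      by (simp add: xaff_def \<delta>_def)
    then show "\<eta> (xaff 1 (- \<delta> t) (xaff (-1) (2 * l t) p)) = - \<eta> (xaff 1 (- \<delta> t) p)"
      by (simp add: odd)
  qed
  define Q where "Q h p = (if h = 0 then d1 \<eta> p else (\<eta> (p + h *\<^sub>R (1, 0)) - \<eta> p) / h)" for h p
  have U: "pair (u t) \<eta> = \<delta> t * pair (u t) (Q (- \<delta> t))" if t: "t \<in> {0..T}" for t
  proof -
    have eq: "(\<lambda>p. \<delta> t * Q (- \<delta> t) p) = (\<lambda>p. \<eta> p + -1 * \<eta> (xaff 1 (- \<delta> t) p))"
    proof
      show "\<delta> t * Q (- \<delta> t) p = \<eta> p + -1 * \<eta> (xaff 1 (- \<delta> t) p)" for p
        by (cases p) (simp add: Q_def xaff_plus)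
    qed
    have "\<delta> t * pair (u t) (Q (- \<delta> t)) = pair (u t) (\<lambda>p. \<eta> p + -1 * \<eta> (xaff 1 (- \<delta> t) p))"
      unfolding pair_cmult[symmetric] eq ..
    also have "\<dots> = pair (u t) \<eta> + pair (u t) (\<lambda>p. -1 * \<eta> (xaff 1 (- \<delta> t) p))"
      by (rule pair_add[OF locally_integrable_L2[OF uL[OF t]] \<eta>])
         (intro test_functions_cmult test_functions_xaff \<eta>, simp)
    also have "\<dots> = pair (u t) \<eta>" unfolding pair_cmult zero[OF t] by simp
    finally show ?thesis by simp
  qed
  have lim_\<delta>: "(\<delta> \<longlongrightarrow> 0) F"
  proof -
    have "(l \<longlongrightarrow> l t0) F"
      unfolding F_def using DERIV_isCont[OF l, unfolded isCont_def] by (rule tendsto_within_subset) simp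
    then show ?thesis unfolding \<delta>_def[abs_def] by (rule LIM_zero)
  qed
  have "((\<lambda>t. pair (u t) (Q (- \<delta> t))) \<longlongrightarrow> pair (u t0) (d1 \<eta>)) F"
    using pair_difference_quotient_tendsto[OF L2_conv_L1loc_conv[OF C_H1_conv(1)[OF uC t0]] \<eta>, of "\<lambda>t. - \<delta> t" "(1, 0)"]
      tendsto_minus[OF lim_\<delta>] unfolding Q_def F_def by simp
  moreover have "((\<lambda>t. \<delta> t / (t - t0)) \<longlongrightarrow> c) F"
    using has_field_derivative_at_within[OF l] unfolding F_def \<delta>_def has_field_derivative_iff by blast
  ultimately have "((\<lambda>t. \<delta> t / (t - t0) * pair (u t) (Q (- \<delta> t))) \<longlongrightarrow> c * pair (u t0) (d1 \<eta>)) F"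
    by (intro tendsto_mult)
  moreover have "((\<lambda>t. \<delta> t / (t - t0) * pair (u t) (Q (- \<delta> t))) \<longlongrightarrow> nonlin \<kappa> (u t0) (wderiv (1, 0) (u t0)) \<psi>) F"
  proof (rule Lim_transform_eventually)
    show "((\<lambda>t. (pair (u t) \<eta> - pair (u t0) \<eta>) / (t - t0)) \<longlongrightarrow> nonlin \<kappa> (u t0) (wderiv (1, 0) (u t0)) \<psi>) F"
      using weak_solution_evolution[OF u T \<psi> t0] unfolding has_field_derivative_iff F_def \<eta>_def .
    have ev: "\<forall>\<^sub>F t in F. t \<in> {0..T}" by (simp add: F_def eventually_at_filter)
    have "pair (u t0) \<eta> = 0" using U[OF t0] by (simp add: \<delta>_def)
    then show "\<forall>\<^sub>F t in F. (pair (u t) \<eta> - pair (u t0) \<eta>) / (t - t0) = \<delta> t / (t - t0) * pair (u t) (Q (- \<delta> t))"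
      by (intro eventually_mono[OF ev]) (simp add: U)
  qed
  ultimately have "nonlin \<kappa> (u t0) (wderiv (1, 0) (u t0)) \<psi> = c * pair (u t0) (d1 \<eta>)"
    using tendsto_unique[OF F] by blast
  then show ?thesis by (simp add: \<eta>_def Lx_d1[OF s\<psi>])
qed

text \<open>Both sides are linear in \<open>\<psi>\<close> and do not change if \<open>\<psi>\<close> is reflected about the axis, so the identity
for the even function \<open>\<psi> + \<psi>'\<close>, with \<open>\<psi>'\<close> the reflection of \<open>\<psi>\<close>, is twice the identity for \<open>\<psi>\<close>.\<close>

theorem symmetric_solution_identity:
  assumes u: "weak_solution \<kappa> T u" and T: "0 < T" and t0: "t0 \<in> {0..T}"
    and l: "(l has_real_derivative c) (at t0)"
    and sym: "\<And>t. t \<in> {0..T} \<Longrightarrow> AE p in lborel. u t p = u t (xaff (-1) (2 * l t) p)"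
    and \<psi>: "\<psi> \<in> test_functions UNIV"
  shows "nonlin \<kappa> (u t0) (wderiv (1, 0) (u t0)) \<psi> = c * pair (u t0) (Lx (d1 \<psi>))"
proof -
  let ?R = "xaff (-1) (2 * l t0)"
  let ?f = "u t0" and ?w = "wderiv (1, 0) (u t0)"
  define \<psi>' where "\<psi>' p = \<psi> (?R p)" for p
  have s: "(-1::real) * -1 = 1" by simp
  have RR: "?R (?R p) = p" for p by (cases p) (simp add: xaff_def)
  have fH: "?f \<in> H1" using u t0 by (auto simp: weak_solution_iff C_H1_def)
  have wL: "?w \<in> L2" by (rule wderiv_H1[OF fH]) (simp add: Basis_real_prod)
  note fm = L2_borel_measurable[OF H1_L2[OF fH]] and wm = L2_borel_measurable[OF wL]
  have [measurable]: "?R \<in> borel \<rightarrow>\<^sub>M borel"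
    by (intro borel_measurable_continuous_onI continuous_on_xaff)
  note s\<psi> = test_functions_smooth[OF \<psi>]
  have \<psi>': "\<psi>' \<in> test_functions UNIV" unfolding \<psi>'_def by (rule test_functions_xaff[OF s \<psi>])
  note s\<psi>' = test_functions_smooth[OF \<psi>']
  have "nonlin \<kappa> ?f ?w (\<lambda>p. \<psi> p + \<psi>' p) = c * pair ?f (Lx (d1 (\<lambda>p. \<psi> p + \<psi>' p)))"
    by (rule even_test_identity[OF u T t0 l sym test_functions_add[OF \<psi> \<psi>']])
       (simp_all add: \<psi>'_def RR)
  moreover have "nonlin \<kappa> ?f ?w (\<lambda>p. \<psi> p + \<psi>' p) = 2 * nonlin \<kappa> ?f ?w \<psi>"
  proof -
    have "nonlin \<kappa> ?f ?w \<psi>' = nonlin \<kappa> (\<lambda>p. ?f (?R p)) (\<lambda>p. ?w (?R p)) \<psi>'"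
      by (rule nonlin_cong_AE[OF sym[OF t0] wderiv_symmetric[OF fH sym[OF t0]] fm _ wm _ s\<psi>'])
         (use fm wm in measurable)
    also have "\<dots> = nonlin \<kappa> ?f ?w \<psi>" unfolding \<psi>'_def by (rule nonlin_xaff[OF s s\<psi> fm wm])
    finally show ?thesis using nonlin_add[OF H1_L2[OF fH] wL \<psi> \<psi>', of \<kappa>] by simp
  qed
  moreover have "pair ?f (Lx (d1 (\<lambda>p. \<psi> p + \<psi>' p))) = 2 * pair ?f (Lx (d1 \<psi>))"
  proof -
    have d: "d1 \<psi>' = (\<lambda>p. -1 * d1 \<psi> (?R p))"
      unfolding \<psi>'_def[abs_def] by (rule dderiv_xaff(1)[OF s\<psi>])
    have "Lx (d1 \<psi>') = (\<lambda>p. Lx (d1 \<psi>) (?R p))"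
      unfolding d Lx_cmult[OF smooth_xaff[OF smooth_dderiv[OF s\<psi>]]] Lx_xaff[OF s smooth_dderiv[OF s\<psi>]] by simp
    then have "pair ?f (Lx (d1 \<psi>')) = pair ?f (Lx (d1 \<psi>))"
      using pair_symmetric[OF fm sym[OF t0] test_functions_smooth[OF test_functions_Lx[OF test_functions_dderiv[OF \<psi>, of "(1, 0)"]]]] by simp
    moreover have "Lx (d1 (\<lambda>p. \<psi> p + \<psi>' p)) = (\<lambda>p. Lx (d1 \<psi>) p + Lx (d1 \<psi>') p)"
      using s\<psi> s\<psi>' by (simp add: dderiv_add smooth_differentiable Lx_add smooth_dderiv)
    ultimately show ?thesis
      using pair_add[OF locally_integrable_L2[OF H1_L2[OF fH]] test_functions_Lx[OF test_functions_dderiv[OF \<psi>]] test_functions_Lx[OF test_functions_dderiv[OF \<psi>']], of "(1, 0)" "(1, 0)"]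
      by simp
  qed
  ultimately show ?thesis by simp
qed

section \<open>The traveling wave is a weak solution\<close>

lemma L2_translation_path_continuous:
  assumes g: "g \<in> L2"
  shows "((\<lambda>s. LINT p|lborel. (g (xaff 1 (- c * (s - t0)) p) - g (xaff 1 (- c * (t - t0)) p))\<^sup>2) \<longlongrightarrow> 0) (at t within I)"
proof -
  define h where "h s = (- c * (s - t), 0::real)" for s
  have "((\<lambda>s. h s) \<longlongrightarrow> (- c * (t - t), 0)) (at t within I)"
    unfolding h_def by (intro tendsto_intros)
  then have "(h \<longlongrightarrow> 0) (at t within I)" by (simp add: zero_prod_def)
  from filterlim_compose[OF L2_translation_continuous[OF g] this]
  have lim: "((\<lambda>s. LINT p|lborel. (g (p + h s) - g p)\<^sup>2) \<longlongrightarrow> 0) (at t within I)" .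
  have "(LINT p|lborel. (g (xaff 1 (- c * (s - t0)) p) - g (xaff 1 (- c * (t - t0)) p))\<^sup>2)
      = (LINT p|lborel. (g (p + h s) - g p)\<^sup>2)" for s
  proof -
    note [measurable] = L2_borel_measurable[OF g]
    have "xaff 1 (- c * (s - t0)) p = xaff 1 (- c * (t - t0)) p + h s" for p
      by (cases p) (simp add: xaff_def h_def algebra_simps)
    then show ?thesis
      using lborel_preserving_integral[OF lborel_preserving_xaff[of 1 "- c * (t - t0)"], of "\<lambda>p. (g (p + h s) - g p)\<^sup>2"]
      by simp
  qed
  with lim show ?thesis by simp
qed

text \<open>Translation is continuous in \<open>L\<^sup>2\<close>, and up to null sets the weak derivatives of a translate are the
translates of the weak derivatives.\<close>

lemma traveling_C_H1:
  assumes f: "f \<in> H1"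
  shows "(\<lambda>t p. f (xaff 1 (- c * (t - t0)) p)) \<in> C_H1 I"
proof -
  define v where "v t p = f (xaff 1 (- c * (t - t0)) p)" for t p
  have s: "(1::real) * 1 = 1" by simp
  have vH: "v t \<in> H1" for t unfolding v_def[abs_def] by (rule H1_xaff(1)[OF s f])
  have B: "(1, 0) \<in> (Basis :: (real\<times>real) set)" "(0, 1) \<in> (Basis :: (real\<times>real) set)"
    by (simp_all add: Basis_real_prod)
  have w: "AE p in lborel. wderiv b (v t) p = wderiv b f (xaff 1 (- c * (t - t0)) p)" if "b \<in> Basis" for b t
    using that H1_xaff(2,3)[OF s f, of "- c * (t - t0)"] unfolding v_def[abs_def] by (auto simp: Basis_real_prod)
  have lim: "((\<lambda>s. H1_norm (\<lambda>p. v s p - v t p)) \<longlongrightarrow> 0) (at t within I)" for t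
  proof -
    have wlim: "((\<lambda>s. LINT p|lborel. (wderiv b (\<lambda>p. v s p - v t p) p)\<^sup>2) \<longlongrightarrow> 0) (at t within I)" if b: "b \<in> Basis" for b
    proof -
      have wL: "wderiv b f \<in> L2" by (rule wderiv_H1[OF f b])
      have "(LINT p|lborel. (wderiv b (\<lambda>p. v s p - v t p) p)\<^sup>2)
        = (LINT p|lborel. (wderiv b f (xaff 1 (- c * (s - t0)) p) - wderiv b f (xaff 1 (- c * (t - t0)) p))\<^sup>2)" for s
        unfolding integral_sq_wderiv_diff[OF vH vH b]
      proof (rule integral_cong_AE)
        have [measurable]: "wderiv b (v r) \<in> borel_measurable borel" for r
          by (rule L2_borel_measurable[OF wderiv_H1(1)[OF vH b]])
        have [measurable]: "(\<lambda>p. wderiv b f (xaff 1 r p)) \<in> borel_measurable borel" for r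
          by (rule L2_borel_measurable[OF lborel_preserving_L2[OF lborel_preserving_xaff[OF s] wL]])
        show "(\<lambda>p. (wderiv b (v s) p - wderiv b (v t) p)\<^sup>2) \<in> borel_measurable lborel"
          "(\<lambda>p. (wderiv b f (xaff 1 (- c * (s - t0)) p) - wderiv b f (xaff 1 (- c * (t - t0)) p))\<^sup>2) \<in> borel_measurable lborel"
          by measurable
        show "AE p in lborel. (wderiv b (v s) p - wderiv b (v t) p)\<^sup>2
          = (wderiv b f (xaff 1 (- c * (s - t0)) p) - wderiv b f (xaff 1 (- c * (t - t0)) p))\<^sup>2"
          using w[OF b, of s] w[OF b, of t] by eventually_elim simp
      qed
      then show ?thesis using L2_translation_path_continuous[OF wL, of c t0 t I] by (simp only:)
    qed
    have lim0: "((\<lambda>s. LINT p|lborel. (v s p - v t p)\<^sup>2) \<longlongrightarrow> 0) (at t within I)"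
      unfolding v_def by (rule L2_translation_path_continuous[OF H1_L2[OF f]])
    have "((\<lambda>s. \<Sum>b\<in>Basis. LINT p|lborel. (wderiv b (\<lambda>p. v s p - v t p) p)\<^sup>2) \<longlongrightarrow> (\<Sum>b\<in>(Basis :: (real\<times>real) set). 0)) (at t within I)"
      by (rule tendsto_sum) (rule wlim)
    from tendsto_real_sqrt[OF tendsto_add[OF lim0 this]] show ?thesis
      unfolding H1_norm_def by (simp only: sum.neutral_const add_0_left real_sqrt_zero)
  qed
  have "v \<in> C_H1 I" using vH lim by (simp add: C_H1_def)
  then show ?thesis by (simp add: v_def[abs_def])
qed

text \<open>Differentiation under the integral sign: the difference quotients of \<open>G\<close> in time converge uniformly
with a common compact support, hence so do their slices.\<close>

lemma pair_slice_has_real_derivative: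
  fixes G :: "real \<times> real \<times> real \<Rightarrow> real"
  assumes f: "f \<in> L2" and G: "G \<in> test_functions X"
  shows "((\<lambda>t. pair f (\<lambda>p. G (t, p))) has_real_derivative pair f (\<lambda>p. Dt G (t, p))) (at t)"
proof -
  obtain K where K: "smooth G" "compact K" "\<forall>p. p \<notin> K \<longrightarrow> G p = 0"
    using G by (rule test_functionsE)
  obtain K' where K': "compact K'" "\<forall>p h. norm h \<le> 1 \<longrightarrow> p + h \<in> K \<longrightarrow> p \<in> K'"
    using compact_thicken[OF K(2)] by metis
  define Q where "Q h z = (if h = 0 then Dt G z else (G (z + h *\<^sub>R (1, 0, 0)) - G z) / h)" for h z
  have li: "locally_integrable f" by (rule locally_integrable_L2[OF f])
  have conv: "L1loc_conv (\<lambda>h. f) f (at (0::real))" using li by (simp add: L1loc_conv_def)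
  have uQ: "uniform_limit UNIV Q (Dt G) (nhds 0)"
    unfolding Q_def by (rule difference_quotient_uniform_limit[OF K(1,2)]) (use K(3) in auto)
  have KK': "z \<notin> K" if "z \<notin> K'" for z using K'(2)[rule_format, of 0 z] that by auto
  have DG: "Dt G z = 0" if "z \<notin> K'" for z
    by (rule dderiv_eq_0_outside[OF compact_imp_closed[OF K(2)]]) (use K(3) KK'[OF that] in auto)
  have slice_out: "(t, p) \<notin> K'" if "p \<notin> snd ` K'" for p
  proof
    assume "(t, p) \<in> K'"
    then have "snd (t, p) \<in> snd ` K'" by (rule imageI)
    with that show False by simp
  qed
  have lim: "((\<lambda>h. pair f (\<lambda>p. Q h (t, p))) \<longlongrightarrow> pair f (\<lambda>p. Dt G (t, p))) (at 0)"
  proof (rule pair_tendsto[OF conv])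
    show "compact (snd ` K')" using K'(1) by (intro compact_continuous_image continuous_intros)
    show "continuous_on UNIV (\<lambda>p. Dt G (t, p))"
      by (intro smooth_continuous_on smooth_slice smooth_dderiv K(1))
    show "Dt G (t, p) = 0" if "p \<notin> snd ` K'" for p by (rule DG[OF slice_out[OF that]])
    show "uniform_limit UNIV (\<lambda>h p. Q h (t, p)) (\<lambda>p. Dt G (t, p)) (at 0)"
    proof (rule uniform_limitI)
      fix e :: real assume "e > 0"
      from uniform_limitD[OF uQ this] have "\<forall>\<^sub>F h in at 0. \<forall>z\<in>UNIV. dist (Q h z) (Dt G z) < e"
        by (rule filter_leD[OF at_within_le_nhds])
      then show "\<forall>\<^sub>F h in at 0. \<forall>p\<in>UNIV. dist (Q h (t, p)) (Dt G (t, p)) < e"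
        by eventually_elim blast
    qed
    have "\<forall>\<^sub>F h in at (0::real). \<bar>h\<bar> < 1 \<and> h \<noteq> 0"
      unfolding eventually_at by (intro exI[of _ 1]) (auto simp: dist_real_def)
    then show "\<forall>\<^sub>F h in at 0. continuous_on UNIV (\<lambda>p. Q h (t, p)) \<and> (\<forall>p. p \<notin> snd ` K' \<longrightarrow> Q h (t, p) = 0)"
    proof eventually_elim
      case (elim h)
      have eq: "(\<lambda>p. Q h (t, p)) = (\<lambda>p. (G (t + h, p) - G (t, p)) / h)"
        using elim by (simp add: Q_def fun_eq_iff)
      have "continuous_on UNIV (\<lambda>p. G (r, p))" for r by (intro smooth_continuous_on smooth_slice K(1))
      then have "continuous_on UNIV (\<lambda>p. Q h (t, p))"
        unfolding eq using elim by (intro continuous_intros) auto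
      moreover have "Q h (t, p) = 0" if "p \<notin> snd ` K'" for p
      proof -
        have out: "(t, p) \<notin> K'" by (rule slice_out[OF that])
        have "norm (h, 0::real\<times>real) \<le> 1" using elim by (simp add: norm_Pair)
        from K'(2)[rule_format, OF this, of "(t, p)"] out have "(t, p) + (h, 0) \<notin> K" by blast
        from K(3)[rule_format, OF this] K(3)[rule_format, OF KK'[OF out]]
        have "G (t + h, p) = 0" "G (t, p) = 0" by simp_all
        then show ?thesis using fun_cong[OF eq, of p] by simp
      qed
      ultimately show ?case by blast
    qed
  qed
  show ?thesis
    unfolding DERIV_def
  proof (rule Lim_transform_eventually[OF lim])
    have "\<forall>\<^sub>F h in at (0::real). h \<noteq> 0" by (simp add: eventually_at_filter)
    then show "\<forall>\<^sub>F h in at 0. pair f (\<lambda>p. Q h (t, p)) = (pair f (\<lambda>p. G (t + h, p)) - pair f (\<lambda>p. G (t, p))) / h"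
    proof eventually_elim
      case (elim h)
      have eq: "(\<lambda>p. Q h (t, p)) = (\<lambda>p. (1 / h) * (G (t + h, p) + -1 * G (t, p)))"
        using elim by (simp add: Q_def fun_eq_iff)
      have "pair f (\<lambda>p. G (t + h, p) + -1 * G (t, p)) = pair f (\<lambda>p. G (t + h, p)) + pair f (\<lambda>p. -1 * G (t, p))"
        by (rule pair_add[OF li test_functions_slice[OF G] test_functions_cmult[OF test_functions_slice[OF G]]])
      then show ?case unfolding eq pair_cmult by simp
    qed
  qed
qed

lemma test_functions_L_op: "\<phi> \<in> test_functions X \<Longrightarrow> L_op \<phi> \<in> test_functions X"
  unfolding L_op_def by (intro test_functions_dderiv test_functions_diff test_functions_dderiv_pow)

lemma L_op_Dt_commute:
  assumes "smooth \<phi>"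
  shows "L_op (Dt \<phi>) = Dt (L_op \<phi>)"
proof -
  have c: "Dx (Dt f) = Dt (Dx f)" if "smooth f" for f by (rule dderiv_commute[OF that])
  have sq: "(Dx ^^ 2) f = Dx (Dx f)" for f by (simp add: numeral_2_eq_2)
  have "(Dx ^^ 2) (Dt \<phi>) = Dt ((Dx ^^ 2) \<phi>)"
    unfolding sq c[OF assms] by (rule c[OF smooth_dderiv[OF assms]])
  then have "(\<lambda>p. Dt \<phi> p - (Dx ^^ 2) (Dt \<phi>) p) = (\<lambda>p. Dt \<phi> p - Dt ((Dx ^^ 2) \<phi>) p)" by (simp only:)
  also have "\<dots> = Dt (\<lambda>p. \<phi> p - (Dx ^^ 2) \<phi> p)"
    by (rule dderiv_diff[symmetric]) (intro smooth_differentiable smooth_dderiv_pow assms)+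
  finally show ?thesis
    unfolding L_op_def by (simp only: c[OF smooth_diff[OF assms smooth_dderiv_pow[OF assms]]])
qed

text \<open>The change to the moving frame preserves the time coordinate, so it keeps supports inside
\<open>S \<times> UNIV\<close>, and it adds the transport term \<open>c \<partial>\<^sub>x\<close> to the time derivative.\<close>

lemma test_functions_shear:
  fixes \<phi> :: "real \<times> real \<times> real \<Rightarrow> real"
  assumes "\<phi> \<in> test_functions (S \<times> UNIV)"
  shows "(\<lambda>z. \<phi> (fst z, xaff 1 (c * (fst z - t0)) (snd z))) \<in> test_functions (S \<times> UNIV)"
    and "Dt (\<lambda>z. \<phi> (fst z, xaff 1 (c * (fst z - t0)) (snd z)))
      = (\<lambda>z. Dt \<phi> (fst z, xaff 1 (c * (fst z - t0)) (snd z)) + c * Dx \<phi> (fst z, xaff 1 (c * (fst z - t0)) (snd z)))"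
proof -
  define A where "A z = (fst z, c * fst z + fst (snd z), snd (snd z))" for z :: "real \<times> real \<times> real"
  define B where "B z = (fst z, fst (snd z) - c * (fst z - t0), snd (snd z))" for z :: "real \<times> real \<times> real"
  have A: "bounded_linear A"
    unfolding A_def[abs_def]
    by (intro bounded_linear_Pair bounded_linear_add bounded_linear_const_mult bounded_linear_fst
        bounded_linear_compose[OF bounded_linear_fst bounded_linear_snd] bounded_linear_compose[OF bounded_linear_snd bounded_linear_snd])
  have eq: "(fst z, xaff 1 (c * (fst z - t0)) (snd z)) = (0, - c * t0, 0) + A z" for z
    by (simp add: A_def xaff_def algebra_simps)
  have B: "continuous_on UNIV B" unfolding B_def[abs_def] by (intro continuous_intros)
  show "(\<lambda>z. \<phi> (fst z, xaff 1 (c * (fst z - t0)) (snd z))) \<in> test_functions (S \<times> UNIV)"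
    unfolding eq
    by (rule test_functions_affine[OF assms A B]) (auto simp: A_def B_def algebra_simps)
  have d: "\<And>p. \<phi> differentiable (at p)" by (rule smooth_differentiable[OF test_functions_smooth[OF assms]])
  have "A (1, 0, 0) = (1, 0, 0) + c *\<^sub>R (0, 1, 0)" by (simp add: A_def)
  then have "dderiv (A (1, 0, 0)) \<phi> p = Dt \<phi> p + c * Dx \<phi> p" for p
    by (simp only: dderiv_plus[OF d] dderiv_scaleR[OF d])
  then show "Dt (\<lambda>z. \<phi> (fst z, xaff 1 (c * (fst z - t0)) (snd z)))
      = (\<lambda>z. Dt \<phi> (fst z, xaff 1 (c * (fst z - t0)) (snd z)) + c * Dx \<phi> (fst z, xaff 1 (c * (fst z - t0)) (snd z)))"
    unfolding eq dderiv_affine[OF A d] by simp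
qed

text \<open>In the moving frame the profile \<open>f\<close> does not depend on time and \<open>\<phi>\<close> becomes \<open>\<Phi>\<close>.  By hypothesis
\<open>nonlin\<close> turns into the transport term, which completes \<open>\<partial>\<^sub>t \<phi>\<close> to \<open>\<partial>\<^sub>t \<Phi>\<close>.  The integrand at
time \<open>t\<close> is then the pairing of \<open>f\<close> with \<open>L \<partial>\<^sub>t \<Phi> = \<partial>\<^sub>t (L \<Phi>)\<close>, which integrates to zero because
\<open>\<Phi>\<close> vanishes near the ends of the time interval.\<close>

theorem traveling_weak_solution:
  assumes f: "f \<in> H1" and T: "0 < T"
    and id: "\<And>\<psi>. \<psi> \<in> test_functions UNIV \<Longrightarrow> nonlin \<kappa> f (wderiv (1, 0) f) \<psi> = c * pair f (Lx (d1 \<psi>))"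
  shows "weak_solution \<kappa> T (\<lambda>t p. f (xaff 1 (- c * (t - t0)) p))"
  unfolding weak_solution_iff
proof (intro conjI ballI)
  show "(\<lambda>t p. f (xaff 1 (- c * (t - t0)) p)) \<in> C_H1 {0..T}" by (rule traveling_C_H1[OF f])
  fix \<phi> assume \<phi>: "\<phi> \<in> test_functions ({0<..<T} \<times> (UNIV :: (real\<times>real) set))"
  define \<Phi> where "\<Phi> z = \<phi> (fst z, xaff 1 (c * (fst z - t0)) (snd z))" for z
  have \<Phi>: "\<Phi> \<in> test_functions ({0<..<T} \<times> UNIV)"
    and Dt\<Phi>: "Dt \<Phi> = (\<lambda>z. Dt \<phi> (fst z, xaff 1 (c * (fst z - t0)) (snd z)) + c * Dx \<phi> (fst z, xaff 1 (c * (fst z - t0)) (snd z)))"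
    unfolding \<Phi>_def[abs_def] by (rule test_functions_shear[OF \<phi>])+
  define G where "G = L_op \<Phi>"
  have G: "G \<in> test_functions ({0<..<T} \<times> UNIV)" unfolding G_def by (rule test_functions_L_op[OF \<Phi>])
  have s: "(1::real) * 1 = 1" by simp
  note fL = H1_L2[OF f] and fm = L2_borel_measurable[OF H1_L2[OF f]]
  have wL: "wderiv (1, 0) f \<in> L2" by (rule wderiv_H1[OF f]) (simp add: Basis_real_prod)
  note wm = L2_borel_measurable[OF wL]
  have inner: "pair (\<lambda>p. f (xaff 1 (- c * (t - t0)) p)) (Lx (\<lambda>p. Dt \<phi> (t, p)))
      + nonlin \<kappa> (\<lambda>p. f (xaff 1 (- c * (t - t0)) p)) (wderiv (1, 0) (\<lambda>p. f (xaff 1 (- c * (t - t0)) p))) (\<lambda>p. \<phi> (t, p))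
    = pair f (\<lambda>p. Dt G (t, p))" for t
  proof -
    let ?S = "xaff 1 (- c * (t - t0))" and ?S' = "xaff 1 (c * (t - t0))"
    have SS: "?S' (?S p) = p" for p by (cases p) (simp add: xaff_def)
    have fS: "(\<lambda>p. f (?S p)) \<in> H1" by (rule H1_xaff(1)[OF s f])
    have wS: "wderiv (1, 0) (\<lambda>p. f (?S p)) \<in> L2" by (rule wderiv_H1[OF fS]) (simp add: Basis_real_prod)
    have wS': "(\<lambda>p. wderiv (1, 0) f (?S p)) \<in> L2" by (rule lborel_preserving_L2[OF lborel_preserving_xaff[OF s] wL])
    \<comment> \<open>The slices of \<open>\<partial>\<^sub>t \<phi>\<close> and \<open>\<phi>\<close> in the moving frame.\<close>
    define \<theta> where "\<theta> p = Dt \<phi> (t, ?S' p)" for p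
    define \<psi> where "\<psi> p = \<phi> (t, ?S' p)" for p
    have \<theta>: "\<theta> \<in> test_functions UNIV" 
      unfolding \<theta>_def by (rule test_functions_xaff[OF s test_functions_slice[OF test_functions_dderiv[OF \<phi>]]])
    have \<psi>: "\<psi> \<in> test_functions UNIV" 
      unfolding \<psi>_def by (rule test_functions_xaff[OF s test_functions_slice[OF \<phi>]])
    note s\<theta> = test_functions_smooth[OF \<theta>] and s\<psi> = test_functions_smooth[OF \<psi>]
    have e\<theta>: "(\<lambda>p. Dt \<phi> (t, p)) = (\<lambda>p. \<theta> (?S p))" and e\<psi>: "(\<lambda>p. \<phi> (t, p)) = (\<lambda>p. \<psi> (?S p))"
      by (simp_all only: \<theta>_def \<psi>_def SS)
    have 1: "pair (\<lambda>p. f (?S p)) (Lx (\<lambda>p. Dt \<phi> (t, p))) = pair f (Lx \<theta>)"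
      unfolding e\<theta> Lx_xaff[OF s s\<theta>] mult_1_left
      by (rule pair_xaff[OF s fm smooth_borel_measurable[OF test_functions_smooth[OF test_functions_Lx[OF \<theta>]]]])
    have "AE p in lborel. (wderiv (1, 0) (\<lambda>p. f (?S p)) p)\<^sup>2 = (wderiv (1, 0) f (?S p))\<^sup>2"
      using H1_xaff(2)[OF s f, of "- c * (t - t0)"] by eventually_elim simp
    note ae = this
    have "nonlin \<kappa> (\<lambda>p. f (?S p)) (wderiv (1, 0) (\<lambda>p. f (?S p))) (\<lambda>p. \<phi> (t, p))
      = nonlin \<kappa> (\<lambda>p. f (?S p)) (\<lambda>p. wderiv (1, 0) f (?S p)) (\<lambda>p. \<psi> (?S p))"
      unfolding e\<psi>
      by (rule nonlin_cong_AE[OF AE_I2[OF refl] ae L2_borel_measurable[OF H1_L2[OF fS]]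
            L2_borel_measurable[OF H1_L2[OF fS]] L2_borel_measurable[OF wS] L2_borel_measurable[OF wS'] smooth_xaff[OF s\<psi>]])
    also have "\<dots> = nonlin \<kappa> f (wderiv (1, 0) f) \<psi>" by (rule nonlin_xaff[OF s s\<psi> fm wm])
    also have "\<dots> = c * pair f (Lx (d1 \<psi>))" by (rule id[OF \<psi>])
    finally have 2: "nonlin \<kappa> (\<lambda>p. f (?S p)) (wderiv (1, 0) (\<lambda>p. f (?S p))) (\<lambda>p. \<phi> (t, p)) = c * pair f (Lx (d1 \<psi>))" .
    have "d1 \<psi> = (\<lambda>p. Dx \<phi> (t, ?S' p))"
      unfolding \<psi>_def[abs_def] dderiv_xaff(1)[OF smooth_slice[OF test_functions_smooth[OF \<phi>]]]
        dderiv_slice[OF test_functions_smooth[OF \<phi>]] by simp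
    then have "(\<lambda>p. Dt \<Phi> (t, p)) = (\<lambda>p. \<theta> p + c * d1 \<psi> p)"
      by (simp add: Dt\<Phi> \<theta>_def)
    then have "Lx (\<lambda>p. Dt \<Phi> (t, p)) = (\<lambda>p. Lx \<theta> p + c * Lx (d1 \<psi>) p)"
      by (simp only: Lx_add[OF s\<theta> smooth_cmult[OF smooth_dderiv[OF s\<psi>]]] Lx_cmult[OF smooth_dderiv[OF s\<psi>]])
    moreover have "(\<lambda>p. Dt G (t, p)) = Lx (\<lambda>p. Dt \<Phi> (t, p))"
      unfolding G_def L_op_Dt_commute[OF test_functions_smooth[OF \<Phi>], symmetric]
      by (rule ext) (rule L_op_slice[OF smooth_dderiv[OF test_functions_smooth[OF \<Phi>]]])
    ultimately have "pair f (\<lambda>p. Dt G (t, p)) = pair f (\<lambda>p. Lx \<theta> p + c * Lx (d1 \<psi>) p)" by simp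
    also have "\<dots> = pair f (Lx \<theta>) + pair f (\<lambda>p. c * Lx (d1 \<psi>) p)"
      by (rule pair_add[OF locally_integrable_L2[OF fL] test_functions_Lx[OF \<theta>] test_functions_cmult[OF test_functions_Lx[OF test_functions_dderiv[OF \<psi>]]]])
    also have "\<dots> = pair f (Lx \<theta>) + c * pair f (Lx (d1 \<psi>))" unfolding pair_cmult ..
    finally show ?thesis using 1 2 by simp
  qed
  let ?H = "\<lambda>t. pair f (\<lambda>p. G (t, p))" and ?H' = "\<lambda>t. pair f (\<lambda>p. Dt G (t, p))"
  have dH: "(?H has_real_derivative ?H' t) (at t)" for t by (rule pair_slice_has_real_derivative[OF fL G])
  have cH': "isCont ?H' t" for t
    by (rule DERIV_isCont[OF pair_slice_has_real_derivative[OF fL test_functions_dderiv[OF G]]])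
  have "(LINT t:{0..T}|lborel. ?H' t) = (LINT t|lborel. ?H' t * indicator {0..T} t)"
    unfolding set_lebesgue_integral_def by (simp add: mult.commute)
  also have "\<dots> = ?H T - ?H 0"
    using T dH cH' by (intro integral_FTC_Icc_real) auto
  also have "\<dots> = 0"
  proof -
    obtain K where K: "\<forall>z. z \<notin> K \<longrightarrow> G z = 0" "K \<subseteq> {0<..<T} \<times> UNIV"
      using G by (rule test_functionsE)
    have "(T, p) \<notin> K" "(0, p) \<notin> K" for p using K(2) by auto
    then have "G (T, p) = 0" "G (0, p) = 0" for p using K(1) by blast+
    then show ?thesis by simp
  qed
  finally show "(LINT t:{0..T}|lborel. pair (\<lambda>p. f (xaff 1 (- c * (t - t0)) p)) (Lx (\<lambda>p. Dt \<phi> (t, p)))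
      + nonlin \<kappa> (\<lambda>p. f (xaff 1 (- c * (t - t0)) p)) (wderiv (1, 0) (\<lambda>p. f (xaff 1 (- c * (t - t0)) p))) (\<lambda>p. \<phi> (t, p))) = 0"
    unfolding inner .
qed

theorem theorem3:
  fixes \<kappa> T t0 :: real
    and u :: "real \<Rightarrow> real \<times> real \<Rightarrow> real"
    and u0 :: "real \<times> real \<Rightarrow> real"
  assumes "T > 0"
    and "t0 \<in> {0..T}"
    and "weak_solution \<kappa> T u"
    and "u0 = u t0"
    and "only_weak_solution \<kappa> T t0 u0 u"
    and "x_symmetric T u"
  shows "x_traveling_wave T u"
proof -
  obtain l :: "real \<Rightarrow> real" where l: "l C1_differentiable_on UNIV"
    and sym: "\<forall>t\<in>{0..T}. AE (x, y) in lborel. u t (x, y) = u t (2 * l t - x, y)"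
    using assms(6) unfolding x_symmetric_def by blast
  obtain c where c: "(l has_real_derivative c) (at t0)"
    using l unfolding C1_differentiable_on_def has_real_derivative_iff_has_vector_derivative by blast
  have sym': "AE p in lborel. u t p = u t (xaff (-1) (2 * l t) p)" if "t \<in> {0..T}" for t
    using bspec[OF sym that] by eventually_elim (auto simp: xaff_def)
  have H: "u t0 \<in> H1" using assms(2,3) by (auto simp: weak_solution_iff C_H1_def)
  let ?v = "\<lambda>t p. u t0 (xaff 1 (- c * (t - t0)) p)"
  have v: "weak_solution \<kappa> T ?v"
    by (rule traveling_weak_solution[OF H assms(1)])
       (rule symmetric_solution_identity[OF assms(3,1,2) c sym'])
  have "xaff 1 0 p = p" for p by (cases p) (simp add: xaff_def)
  then have "AE p in lborel. ?v t0 p = u0 p" using assms(4) by simp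
  with v assms(5) have eq: "\<forall>t\<in>{0..T}. AE p in lborel. ?v t p = u t p"
    unfolding only_weak_solution_def by blast
  have "AE (x, y) in lborel. u t (x, y) = (\<lambda>(x, y). u t0 (x + c * t0, y)) (x - c * t, y)" if "t \<in> {0..T}" for t
    using bspec[OF eq that]
  proof eventually_elim
    case (elim p)
    then show ?case by (cases p) (simp add: xaff_def algebra_simps)
  qed
  then show ?thesis unfolding x_traveling_wave_def by blast
qed

end
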